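(* Assume the setting described in the context. Then on a set of full probability measure $$\sup_{0\le s<t\le1}\frac{\big\|\int_s^t(\omega(\xi)-\omega(s))\otimes_V\circ d\omega(\xi)\big\|_{L_2(L_2(V,V_\delta),V\otimes V)}}{(t-s)^{2\beta'}}<\infty$$ and $$\lim_{n\to\infty}\sup_{0\le s<t\le1}\frac{\big\|\int_s^t(\omega(\xi)-\omega(s))\otimes_V\circ d\omega(\xi)-\int_s^t(\omega^n(\xi)-\omega^n(s))\otimes_V d\omega^n(\xi)\big\|_{L_2(L_2(V,V_\delta),V\otimes V)}}{(t-s)^{2\beta'}}=0.$$
   Context: $V$ is a separable real Hilbert space; $A$ is linear with $-A$ positive self-adjoint with compact inverse, orthonormal eigenbasis $(e_i)$ with $-Ae_i=\lambda_ie_i$, $\lambda_i>0$; $V_\delta=D((-A)^\delta)$ with $|x|_{V_\delta}=|(-A)^\delta x|$, where $\delta\in[0,1]$ and $\sum_i\lambda_i^{-2\delta}<\infty$; $\beta'\in(1/3,1/2)$. $L_2(X,Y)$ denotes Hilbert–Schmidt operators and $V\otimes V$ the Hilbert tensor product. $Q$ is a positive symmetric trace-class operator on $V$ with $Qe_i=q_ie_i$, $q_i>0$, $\sum_iq_i<\infty$. $\omega$ is a $Q$-Wiener process on $[0,1]$ with values in $V$ (on a complete probability space), taken in a version with $\gamma$-Hölder paths for all $\gamma<1/2$; thus $\omega_i=q_i^{-1/2}(\omega,e_i)$ are independent standard real Brownian motions. $\omega^n$ is the piecewise linear interpolation of $\omega$ on the equidistant partition $\{k/n\}_{k=0,\dots,n}$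 of $[0,1]$. $\int_s^t(\omega(\xi)-\omega(s))\otimes_V\circ d\omega(\xi)$ denotes the map $E\in L_2(V,V_\delta)\mapsto\int_s^tE(\omega(\xi)-\omega(s))\otimes_V\circ d\omega(\xi)\in V\otimes V$ (Stratonovich integral), and analogously for $\omega^n$ with Riemann–Stieltjes integrals. *)

theory Defs
  imports "HOL-Probability.Probability"
begin

definition orthonormal_basis :: "(nat \<Rightarrow> 'v::{real_inner,complete_space}) \<Rightarrow> bool" where
  "orthonormal_basis e \<longleftrightarrow>
     (\<forall>i j. e i \<bullet> e j = (if i = j then 1 else 0)) \<and> closure (span (range e)) = UNIV"

definition gaussian_family ::
  "'a measure \<Rightarrow> 'i set \<Rightarrow> ('i \<Rightarrow> 'a \<Rightarrow> real) \<Rightarrow> ('i \<Rightarrow> 'i \<Rightarrow> real) \<Rightarrow> bool" where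
  "gaussian_family M I X C \<longleftrightarrow>
     (\<forall>i\<in>I. X i \<in> borel_measurable M) \<and>
     (\<forall>F c. finite F \<longrightarrow> F \<subseteq> I \<longrightarrow>
        (LINT x|M. cis (\<Sum>i\<in>F. c i * X i x)) =
          complex_of_real (exp (- (\<Sum>i\<in>F. \<Sum>j\<in>F. c i * c j * C i j) / 2)))"

text \<open>Q-Wiener process on [0,1] with values in V, Q e_i = q_i e_i, taken in a version whose
paths are gamma-Hoelder for every gamma < 1/2: the normalised coordinates
omega_i = q_i^(-1/2) (omega, e_i) are independent standard real Brownian motions
(centered Gaussian with covariance delta_ij min(s,t)).\<close>
definition q_wiener ::
  "'a measure \<Rightarrow> (nat \<Rightarrow> 'v::{real_inner,complete_space}) \<Rightarrow> (nat \<Rightarrow> real)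
     \<Rightarrow> (real \<Rightarrow> 'a \<Rightarrow> 'v) \<Rightarrow> bool" where
  "q_wiener M e q \<omega> \<longleftrightarrow>
     (\<forall>t\<in>{0..1}. \<omega> t \<in> borel_measurable M) \<and>
     gaussian_family M (UNIV \<times> {0..1})
        (\<lambda>(i,t) x. (e i \<bullet> \<omega> t x) / sqrt (q i))
        (\<lambda>(i,s) (j,t). if i = j then min s t else 0) \<and>
     (\<forall>x \<in> space M. \<forall>\<gamma>. 0 < \<gamma> \<and> \<gamma> < 1/2 \<longrightarrow>
        (\<exists>C. \<forall>s\<in>{0..1}. \<forall>t\<in>{0..1}. norm (\<omega> t x - \<omega> s x) \<le> C * \<bar>t - s\<bar> powr \<gamma>))"

definition pl_interp :: "nat \<Rightarrow> (real \<Rightarrow> 'v::real_vector) \<Rightarrow> real \<Rightarrow> 'v" where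
  "pl_interp n f t =
     (let k = min (nat \<lfloor>real n * t\<rfloor>) (n - 1)
      in f (real k / real n) + (real n * t - real k) *\<^sub>R (f (real (k+1) / real n) - f (real k / real n)))"

definition rs_int :: "(real \<Rightarrow> real) \<Rightarrow> (real \<Rightarrow> real) \<Rightarrow> real \<Rightarrow> real \<Rightarrow> real" where
  "rs_int f g s t = integral {s..t} (\<lambda>\<xi>. (f \<xi> - f s) * vector_derivative g (at \<xi>))"

definition strat_sum :: "(real \<Rightarrow> 'a \<Rightarrow> real) \<Rightarrow> (real \<Rightarrow> 'a \<Rightarrow> real) \<Rightarrow> real \<Rightarrow> real \<Rightarrow> nat \<Rightarrow> 'a \<Rightarrow> real" where
  "strat_sum Y Z s t m x =
     (\<Sum>k<m. let a = s + real k * (t - s) / real m; b = s + real (Suc k) * (t - s) / real m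
            in ((Y a x + Y b x) / 2 - Y s x) * (Z b x - Z a x))"

definition is_stratonovich ::
  "'a measure \<Rightarrow> (real \<Rightarrow> 'a \<Rightarrow> real) \<Rightarrow> (real \<Rightarrow> 'a \<Rightarrow> real) \<Rightarrow> real \<Rightarrow> real \<Rightarrow> ('a \<Rightarrow> real) \<Rightarrow> bool" where
  "is_stratonovich M Y Z s t I \<longleftrightarrow>
     I \<in> borel_measurable M \<and>
     (\<forall>\<epsilon>>0. (\<lambda>m. measure M {x \<in> space M. \<bar>strat_sum Y Z s t m x - I x\<bar> > \<epsilon>}) \<longlonglongrightarrow> 0)"

definition ennsqrt :: "ennreal \<Rightarrow> ennreal" where
  "ennsqrt a = (if a = \<top> then \<top> else ennreal (sqrt (enn2real a)))"

text \<open>Hilbert--Schmidt norm of an operator given by Phi b c = the (e_k' (x) e_l)-coefficient in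
V (x) V of the image of the b-th orthonormal basis element of the Hilbert space
L_2(V, V_delta), with value \<top> when the defining series diverges.\<close>
definition hs_norm :: "((nat \<times> nat) \<Rightarrow> (nat \<times> nat) \<Rightarrow> real) \<Rightarrow> ennreal" where
  "hs_norm \<Phi> = ennsqrt (\<integral>\<^sup>+ b. (\<integral>\<^sup>+ c. ennreal ((\<Phi> b c)\<^sup>2) \<partial>count_space UNIV) \<partial>count_space UNIV)"

text \<open>The map E \<mapsto> int E(X(xi)) (x) dW(xi) from L_2(V,V_delta) to V (x) V, in coordinates.
The orthonormal basis of L_2(V,V_delta) is f_(k,j) x = lam_k^(-delta) (x,e_j) e_k, and
I j l is the scalar integral of the j-th coordinate of X against the l-th coordinate of W,
so the image of f_(k,j) has (k',l) coefficient [k'=k] lam_k^(-delta) I j l.\<close>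
definition tensor_int_map ::
  "(nat \<Rightarrow> real) \<Rightarrow> real \<Rightarrow> (nat \<Rightarrow> nat \<Rightarrow> real) \<Rightarrow> (nat \<times> nat) \<Rightarrow> (nat \<times> nat) \<Rightarrow> real" where
  "tensor_int_map lam \<delta> I b c = (if fst c = fst b then lam (fst b) powr (- \<delta>) * I (snd b) (snd c) else 0)"

definition simplex01 :: "(real \<times> real) set" where
  "simplex01 = {(s,t). 0 \<le> s \<and> s < t \<and> t \<le> 1}"

end

theory Submission
  imports Defs
begin

text \<open>The integrals of the \<^term>\<open>n\<close>-th and the \<^term>\<open>2 * n\<close>-th interpolation differ, between two points of the
coarse grid, by a sum of signed triangle areas. In coordinates this is a combination, with signs
adding up to zero, of squares of independent Gaussians, and so all its moments are explicitly
bounded. Summing high moments over all pairs of grid points and all coordinates (with the weights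
\<^term>\<open>q j * q l\<close>) gives, almost surely and for every \<^term>\<open>n\<close>, a bound by \<^term>\<open>n powr (- \<theta>)\<close> on the
grid. Chen's relation and the Hoelder continuity of the path in V carry the bound over to all
\<^term>\<open>s < t\<close>. Telescoping along \<^term>\<open>n * 2 ^ r\<close> yields a limit at rate \<^term>\<open>n powr (- \<theta>)\<close>. An L2 estimate
for the midpoint sums together with Fatou's lemma shows that this limit is the Stratonovich
integral, hence independent of \<^term>\<open>n\<close>, which is what makes the whole sequence converge.\<close>

subsection \<open>Integrals along piecewise linear paths\<close>

text \<open>The obstacle is between grid points. There Hoelder regularity bounds each triangle only
  by \<open>n powr (- 2 * \<gamma>)\<close> up to a constant, and adding n of them gives
  \<open>n powr (1 - 2 * \<gamma>)\<close>, which grows because \<gamma> < 1/2. The signs have to be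
  used: a sum of m triangles has size about \<open>sqrt m / n\<close>, and since every moment is
  available, a union bound over all pairs of nodes is affordable. Near the endpoints, in contrast,
  one factor always lives on an interval of length at most 1/n, and the surplus \<theta> of the
  Hoelder exponent \<gamma> = \<beta> + \<theta> turns into the rate. The diagonal j = l is
  deterministic: the triangles degenerate and the midpoint sums telescope. All Gaussian estimates
  are therefore made for j \<noteq> l, where the two coordinates are independent. For different odd
  n the chains \<open>n * 2 ^ r\<close> have no member in common, so pathwise arguments cannot
  compare their limits. The comparison is almost sure for fixed s and t, hence simultaneous only for
  countably many pairs; rational nodes are used, and continuity of the limits does the rest.\<close>

lemma pl_interp_cell:
  assumes "0 < n" "k < n" "real k / real n \<le> t" "t \<le> real (Suc k) / real n"
  shows "pl_interp n f t
    = f (real k / real n) + (real n * t - real k) *\<^sub>R (f (real (Suc k) / real n) - f (real k / real n))"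
proof (cases "t = real (Suc k) / real n")
  case True
  \<comment> \<open>At the right end of the cell the floor is already \<open>Suc k\<close>, so the
    definition moves on to the next cell, or is held in the last one by \<open>min\<close>. Either
    way the value is that of \<open>f\<close> at the node.\<close>
  then have nt: "real n * t = real (Suc k)" using assms by simp
  have fl: "nat \<lfloor>real n * t\<rfloor> = Suc k" unfolding nt by simp
  show ?thesis
  proof (cases "Suc k < n")
    case True
    then have "min (nat \<lfloor>real n * t\<rfloor>) (n - 1) = Suc k" using fl by simp
    then show ?thesis using nt \<open>t = _\<close> unfolding pl_interp_def Let_def by simp
  next
    case False
    then have "min (nat \<lfloor>real n * t\<rfloor>) (n - 1) = k" using fl assms by simp
    then show ?thesis unfolding pl_interp_def Let_def by simp
  qed
next
  case False
  then have "real k \<le> real n * t" "real n * t < real (Suc k)"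
    using assms by (simp_all add: field_simps less_le)
  then have "\<lfloor>real n * t\<rfloor> = int k" by (intro floor_unique) auto
  then have "min (nat \<lfloor>real n * t\<rfloor>) (n - 1) = k" using assms by simp
  then show ?thesis unfolding pl_interp_def Let_def by simp
qed

lemma pl_interp_grid:
  assumes "0 < n" "k \<le> n"
  shows "pl_interp n f (real k / real n) = f (real k / real n)"
proof (cases "k < n")
  case True
  then show ?thesis using assms by (subst pl_interp_cell[of n k]) (auto simp: field_simps)
next
  case False
  then have k: "k = Suc (n - 1)" using assms by simp
  have "pl_interp n f (real (Suc (n - 1)) / real n) = f (real (Suc (n - 1)) / real n)"
    using assms by (subst pl_interp_cell[of n "n - 1"]) (auto simp: field_simps)
  then show ?thesis using k by simp
qed

lemma inner_pl_interp: "v \<bullet> pl_interp n f t = pl_interp n (\<lambda>r. v \<bullet> f r) t"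
  unfolding pl_interp_def Let_def by (simp add: inner_add_right inner_diff_right)

text \<open>Interpolated paths are explicit only inside one cell; facts about longer intervals are
  glued together from there. The induction is on the node that bounds the right endpoint.\<close>

lemma cells_induct [consumes 4, case_names cell trans]:
  fixes P :: "real \<Rightarrow> real \<Rightarrow> bool"
  assumes n: "0 < n" and st: "0 \<le> s" "s \<le> t" "t \<le> 1"
    and cell: "\<And>k s t. \<lbrakk>k < n; real k / real n \<le> s; s \<le> t; t \<le> real (Suc k) / real n\<rbrakk> \<Longrightarrow> P s t"
    and trans: "\<And>s t u. \<lbrakk>0 \<le> s; s \<le> t; t \<le> u; u \<le> 1; P s t; P t u\<rbrakk> \<Longrightarrow> P s u"
  shows "P s t"
proof -
  have "\<forall>s t. 0 \<le> s \<longrightarrow> s \<le> t \<longrightarrow> t \<le> real k / real n \<longrightarrow> P s t" if "k \<le> n" "0 < k" for k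
    using that
  proof (induction k)
    case (Suc k)
    show ?case
    proof (intro allI impI)
      fix s t :: real
      assume a: "0 \<le> s" "s \<le> t" "t \<le> real (Suc k) / real n"
      have k1: "real (Suc k) / real n \<le> 1" using Suc.prems n by simp
      show "P s t"
      proof (cases "real k / real n \<le> s")
        case True
        then show ?thesis using cell[of k s t] a Suc.prems by simp
      next
        case False
        then have k: "0 < k" using a by (cases k) auto
        show ?thesis
        proof (cases "t \<le> real k / real n")
          case True
          then show ?thesis using Suc k a by simp
        next
          case F: False
          have "P s (real k / real n)" using Suc k a False by simp
          moreover have "P (real k / real n) t" using cell[of k "real k / real n" t] F a Suc.prems by simp
          ultimately show ?thesis using trans[of s "real k / real n" t] a False F k1 by linarith
        qed
      qed
    qed
  qed simp
  from this[of n] show ?thesis using n st by simp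
qed

lemma pl_interp_vector_derivative:
  fixes g :: "real \<Rightarrow> real"
  assumes "0 < n" "k < n" "real k / real n < x" "x < real (Suc k) / real n"
  shows "vector_derivative (pl_interp n g) (at x)
    = real n * (g (real (Suc k) / real n) - g (real k / real n))"
proof -
  let ?d = "g (real (Suc k) / real n) - g (real k / real n)"
  have "((\<lambda>t. g (real k / real n) + (real n * t - real k) *\<^sub>R ?d) has_vector_derivative (real n * ?d)) (at x)"
    by (auto intro!: derivative_eq_intros simp flip: has_real_derivative_iff_has_vector_derivative)
  then have "(pl_interp n g has_vector_derivative (real n * ?d)) (at x)"
    using has_vector_derivative_transform_within_open[of _ _ x
        "{real k / real n<..<real (Suc k) / real n}" "pl_interp n g"] assms
    by (auto simp: pl_interp_cell[of n k])
  then show ?thesis by (rule vector_derivative_at)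
qed

lemma pl_interp_integrals_cell:
  fixes f g :: "real \<Rightarrow> real"
  assumes n: "0 < n" "k < n" and st: "real k / real n \<le> s" "s \<le> t" "t \<le> real (Suc k) / real n"
  defines "F \<equiv> pl_interp n f" and "G \<equiv> pl_interp n g"
  shows "((\<lambda>x. vector_derivative G (at x)) has_integral G t - G s) {s..t}"
    and "((\<lambda>x. (F x - c) * vector_derivative G (at x)) has_integral
      ((F t + F s) / 2 - c) * (G t - G s)) {s..t}"
proof -
  define dg where "dg = g (real (Suc k) / real n) - g (real k / real n)"
  define df where "df = f (real (Suc k) / real n) - f (real k / real n)"
  define ga where "ga = g (real k / real n)"
  define fa where "fa = f (real k / real n)"
  have G: "G x = ga + (real n * x - real k) * dg"
    and F: "F x = fa + (real n * x - real k) * df" if "s \<le> x" "x \<le> t" for x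
    using that st n unfolding G_def F_def dg_def df_def ga_def fa_def
    by (simp_all add: pl_interp_cell[of n k] del: of_nat_Suc)
  have d: "vector_derivative G (at x) = real n * dg" if "x \<in> box s t" for x
    using that st n unfolding G_def dg_def by (intro pl_interp_vector_derivative) auto
  have "G t - G s = (t - s) * (real n * dg)"
    using st G[of s] G[of t] by (simp add: algebra_simps)
  then have "((\<lambda>x. real n * dg) has_integral G t - G s) {s..t}"
    using has_integral_const_real[of "real n * dg" s t] st by simp
  \<comment> \<open>At a node the path may have a kink, where \<open>vector_derivative\<close> is an
    arbitrary value; the integral sees only the interior of the cell.\<close>
  then show "((\<lambda>x. vector_derivative G (at x)) has_integral G t - G s) {s..t}"
    using has_integral_spike_interior[of "\<lambda>x. real n * dg" _ s t] d by (auto simp: box_real)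
  \<comment> \<open>An antiderivative of the affine integrand; its increment is the trapezoid
    value.\<close>
  let ?H = "\<lambda>x. ((fa - c) * x + (real n * x\<^sup>2 / 2 - real k * x) * df) * (real n * dg)"
  have "((\<lambda>x. (F x - c) * (real n * dg)) has_integral ?H t - ?H s) {s..t}"
  proof (rule fundamental_theorem_of_calculus)
    fix x assume x: "x \<in> {s..t}"
    have "(?H has_vector_derivative (fa + (real n * x - real k) * df - c) * (real n * dg)) (at x within {s..t})"
      unfolding has_real_derivative_iff_has_vector_derivative[symmetric]
      by (rule derivative_eq_intros refl | simp add: algebra_simps)+
    then show "(?H has_vector_derivative (F x - c) * (real n * dg)) (at x within {s..t})"
      using F[of x] x by simp
  qed (use st in auto)
  moreover have "?H t - ?H s = ((F t + F s) / 2 - c) * (G t - G s)"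
    unfolding F[OF order_refl st(2)] F[OF st(2) order_refl] G[OF order_refl st(2)] G[OF st(2) order_refl]
    by (simp add: field_simps power2_eq_square)
  ultimately show "((\<lambda>x. (F x - c) * vector_derivative G (at x)) has_integral
      ((F t + F s) / 2 - c) * (G t - G s)) {s..t}"
    using has_integral_spike_interior[of "\<lambda>x. (F x - c) * (real n * dg)" _ s t
        "\<lambda>x. (F x - c) * vector_derivative G (at x)"] d by (auto simp: box_real)
qed

lemma pl_interp_integrals:
  fixes f g :: "real \<Rightarrow> real"
  assumes "0 < n" "0 \<le> s" "s \<le> t" "t \<le> 1"
  shows "((\<lambda>x. vector_derivative (pl_interp n g) (at x)) has_integral pl_interp n g t - pl_interp n g s) {s..t}
    \<and> (\<lambda>x. pl_interp n f x * vector_derivative (pl_interp n g) (at x)) integrable_on {s..t}"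
  using assms
proof (induction rule: cells_induct)
  case (cell k s t)
  then show ?case
    using pl_interp_integrals_cell(1)[of n k s t g] pl_interp_integrals_cell(2)[of n k s t f 0 g] \<open>0 < n\<close>
    by (auto simp: has_integral_integrable_integral)
next
  case (trans s t u)
  let ?h = "\<lambda>x. pl_interp n f x * vector_derivative (pl_interp n g) (at x)"
  have "?h integrable_on {s..u}"
    using trans by (intro Henstock_Kurzweil_Integration.integrable_combine[of s t u]) auto
  moreover have "((\<lambda>x. vector_derivative (pl_interp n g) (at x)) has_integral
      (pl_interp n g t - pl_interp n g s) + (pl_interp n g u - pl_interp n g t)) {s..u}"
    using trans by (intro has_integral_combine[of s t u]) auto
  ultimately show ?case by simp
qed

section \<open>Areas of interpolated paths and Chen's relation\<close>

definition pl_area :: "nat \<Rightarrow> (real \<Rightarrow> real) \<Rightarrow> (real \<Rightarrow> real) \<Rightarrow> real \<Rightarrow> real \<Rightarrow> real" where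
  "pl_area n f g s t = rs_int (pl_interp n f) (pl_interp n g) s t"

lemma pl_area_cell:
  assumes "0 < n" "k < n" "real k / real n \<le> s" "s \<le> t" "t \<le> real (Suc k) / real n"
  shows "pl_area n f g s t
    = (pl_interp n f t - pl_interp n f s) * (pl_interp n g t - pl_interp n g s) / 2"
  using integral_unique[OF pl_interp_integrals_cell(2)[of n k s t f "pl_interp n f s" g]] assms
  unfolding pl_area_def rs_int_def by (simp add: field_simps)

text \<open>On the second interval the integrand is restarted at t instead of s. This changes it by
  a constant, whose integral against the second path is the product term.\<close>

lemma pl_area_chen:
  assumes n: "0 < n" and st: "0 \<le> s" "s \<le> t" "t \<le> u" "u \<le> 1"
  shows "pl_area n f g s u = pl_area n f g s t + pl_area n f g t u
    + (pl_interp n f t - pl_interp n f s) * (pl_interp n g u - pl_interp n g t)"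
proof -
  let ?F = "pl_interp n f" and ?G = "pl_interp n g"
  let ?G' = "\<lambda>x. vector_derivative ?G (at x)"
  have int: "(?G' has_integral ?G b - ?G a) {a..b}" "(\<lambda>x. ?F x * ?G' x) integrable_on {a..b}"
    if "0 \<le> a" "a \<le> b" "b \<le> 1" for a b
    using pl_interp_integrals[of n a b g f] n that by auto
  \<comment> \<open>With the base value split off, what remains is an integral that is additive in
    the interval.\<close>
  have R: "rs_int ?F ?G a b = integral {a..b} (\<lambda>x. ?F x * ?G' x) - ?F a * (?G b - ?G a)"
    if "0 \<le> a" "a \<le> b" "b \<le> 1" for a b
  proof -
    have "((\<lambda>x. ?F x * ?G' x - ?F a * ?G' x) has_integral
        integral {a..b} (\<lambda>x. ?F x * ?G' x) - ?F a * (?G b - ?G a)) {a..b}"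
      using int[OF that] by (intro has_integral_diff has_integral_mult_right) (auto simp: integrable_integral)
    then show ?thesis unfolding rs_int_def by (simp add: left_diff_distrib integral_unique)
  qed
  have "integral {s..t} (\<lambda>x. ?F x * ?G' x) + integral {t..u} (\<lambda>x. ?F x * ?G' x)
      = integral {s..u} (\<lambda>x. ?F x * ?G' x)"
    using st by (intro Henstock_Kurzweil_Integration.integral_combine int) auto
  then show ?thesis using st by (simp add: pl_area_def R algebra_simps)
qed

lemma pl_area_refl: "pl_area n f g s s = 0"
  by (simp add: pl_area_def rs_int_def)

text \<open>The trapezoid values of the cells add up to a midpoint sum of the original path. This
  links interpolations to \<open>strat_sum\<close>, but only between nodes, which is why endpoints
  are later moved to nodes before passing to a limit.\<close>

lemma pl_area_grid:
  assumes n: "0 < n" and "a + m \<le> n"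
  shows "pl_area n f g (real a / real n) (real (a + m) / real n)
    = (\<Sum>i<m. ((f (real (a + i) / real n) + f (real (a + Suc i) / real n)) / 2 - f (real a / real n))
        * (g (real (a + Suc i) / real n) - g (real (a + i) / real n)))"
  using \<open>a + m \<le> n\<close>
proof (induction m)
  case 0
  then show ?case by (simp add: pl_area_refl)
next
  case (Suc m)
  let ?p = "\<lambda>i. real i / real n"
  have "pl_area n f g (?p a) (?p (a + Suc m)) = pl_area n f g (?p a) (?p (a + m))
      + pl_area n f g (?p (a + m)) (?p (a + Suc m))
      + (pl_interp n f (?p (a + m)) - pl_interp n f (?p a)) * (pl_interp n g (?p (a + Suc m)) - pl_interp n g (?p (a + m)))"
    using n Suc.prems by (intro pl_area_chen) (auto simp: field_simps)
  also have "pl_area n f g (?p (a + m)) (?p (a + Suc m)) = (pl_interp n f (?p (a + Suc m)) - pl_interp n f (?p (a + m)))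
     * (pl_interp n g (?p (a + Suc m)) - pl_interp n g (?p (a + m))) / 2"
    using n Suc.prems by (intro pl_area_cell[of n "a + m"]) (auto simp: field_simps)
  also have "pl_area n f g (?p a) (?p (a + m)) = (\<Sum>i<m. ((f (?p (a + i)) + f (?p (a + Suc i))) / 2 - f (?p a))
        * (g (?p (a + Suc i)) - g (?p (a + i))))"
    using Suc by simp
  finally show ?case
    using Suc.prems n by (simp add: pl_interp_grid algebra_simps add_divide_distrib diff_divide_distrib del: add_Suc_right of_nat_Suc of_nat_add)
qed

text \<open>At coarse nodes both interpolations equal the path, so the product terms of Chen's
  relation cancel and each cell contributes separately. Inside a cell, replacing the chord by two
  half chords adds the signed area of the triangle they span, half the determinant of the two half
  increments.\<close>

lemma pl_area_double:
  assumes n: "0 < n" and "a + m \<le> n"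
  shows "pl_area (2 * n) f g (real a / real n) (real (a + m) / real n)
      - pl_area n f g (real a / real n) (real (a + m) / real n)
    = (\<Sum>i<m. let x = \<lambda>h d. h (real (2 * (a + i) + Suc d) / real (2 * n)) - h (real (2 * (a + i) + d) / real (2 * n))
        in (x f 0 * x g 1 - x f 1 * x g 0) / 2)"
  using \<open>a + m \<le> n\<close>
proof (induction m)
  case 0
  then show ?case by (simp add: pl_area_refl)
next
  case (Suc m)
  define p where "p = (\<lambda>i. real i / real n)"
  define r where "r = (\<lambda>i. real i / real (2 * n))"
  have pr: "p i = r (2 * i)" for i unfolding p_def r_def by simp
  have r2: "r i = real i / real (2 * n)" for i by (simp add: r_def)
  have le: "0 \<le> r i" "i \<le> 2 * n \<Longrightarrow> r i \<le> 1" "i \<le> j \<Longrightarrow> r i \<le> r j" for i j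
    unfolding r_def using n by (auto simp: divide_right_mono)
  have G: "pl_interp (2 * n) h (r i) = h (r i)" if "i \<le> 2 * n" for h :: "real \<Rightarrow> real" and i
    unfolding r_def using n that by (intro pl_interp_grid) auto
  have Gn: "pl_interp n h (r (2 * i)) = h (r (2 * i))" if "i \<le> n" for h :: "real \<Rightarrow> real" and i
    unfolding pr[symmetric] p_def using n that by (intro pl_interp_grid) auto
  have Gp: "pl_interp n h (p i) = h (p i)" "pl_interp (2 * n) h (p i) = h (p i)" if "i \<le> n" for h :: "real \<Rightarrow> real" and i
    using G[of "2 * i" h] Gn[of i h] that by (simp_all add: pr)
  have lep: "0 \<le> p a" "p a \<le> p (a + m)" "p (a + m) \<le> p (a + Suc m)" "p (a + Suc m) \<le> 1"
    unfolding p_def using n Suc.prems by (auto intro!: divide_right_mono)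
  have ai: "a \<le> n" "a + m \<le> n" "a + Suc m \<le> n" using Suc.prems by auto
  note Gpi = Gp[OF ai(1)] Gp[OF ai(2)] Gp[OF ai(3)]
  have 1: "pl_area n f g (p a) (p (a + Suc m)) = pl_area n f g (p a) (p (a + m))
      + pl_area n f g (p (a + m)) (p (a + Suc m))
      + (f (p (a + m)) - f (p a)) * (g (p (a + Suc m)) - g (p (a + m)))"
    using pl_area_chen[OF n lep, of f g] unfolding Gpi .
  have n2: "0 < 2 * n" using n by simp
  have 2: "pl_area (2 * n) f g (p a) (p (a + Suc m)) = pl_area (2 * n) f g (p a) (p (a + m))
      + pl_area (2 * n) f g (p (a + m)) (p (a + Suc m))
      + (f (p (a + m)) - f (p a)) * (g (p (a + Suc m)) - g (p (a + m)))"
    using pl_area_chen[OF n2 lep, of f g] unfolding Gpi .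
  have 3: "pl_area n f g (p (a + m)) (p (a + Suc m)) = (f (p (a + Suc m)) - f (p (a + m)))
     * (g (p (a + Suc m)) - g (p (a + m))) / 2"
    using pl_area_cell[OF n, of "a + m" "p (a + m)" "p (a + Suc m)" f g] lep ai unfolding Gpi
    by (simp add: p_def)
  define b where "b = 2 * (a + m)"
  have b: "p (a + m) = r b" "p (a + Suc m) = r (Suc (Suc b))" "Suc (Suc b) \<le> 2 * n"
    using Suc.prems by (simp_all add: pr b_def)
  have 4: "pl_area (2 * n) f g (r c) (r (Suc c)) = (f (r (Suc c)) - f (r c)) * (g (r (Suc c)) - g (r c)) / 2"
    if "Suc c \<le> 2 * n" for c
    using pl_area_cell[OF n2, of c "r c" "r (Suc c)" f g] that le(3)[of c "Suc c"] G[of c] G[of "Suc c"] by (simp add: r_def)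
  have 5: "pl_area (2 * n) f g (p (a + m)) (p (a + Suc m))
     = pl_area (2 * n) f g (r b) (r (Suc b)) + pl_area (2 * n) f g (r (Suc b)) (r (Suc (Suc b)))
      + (f (r (Suc b)) - f (r b)) * (g (r (Suc (Suc b))) - g (r (Suc b)))"
    using pl_area_chen[OF n2, of "r b" "r (Suc b)" "r (Suc (Suc b))" f g] le(3)[of b "Suc b"]
      le(3)[of "Suc b" "Suc (Suc b)"] b by (simp add: le(1,2) G)
  have IH: "pl_area (2 * n) f g (p a) (p (a + m)) - pl_area n f g (p a) (p (a + m))
    = (\<Sum>i<m. let x = \<lambda>h d. h (r (2 * (a + i) + Suc d)) - h (r (2 * (a + i) + d))
        in (x f 0 * x g 1 - x f 1 * x g 0) / 2)"
    using Suc unfolding p_def r_def by simp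
  have cell: "pl_area (2 * n) f g (p (a + m)) (p (a + Suc m)) - pl_area n f g (p (a + m)) (p (a + Suc m))
     = ((f (r (Suc b)) - f (r b)) * (g (r (Suc (Suc b))) - g (r (Suc b))) - (f (r (Suc (Suc b))) - f (r (Suc b))) * (g (r (Suc b)) - g (r b))) / 2"
  proof -
    have c: "Suc b \<le> 2 * n" "Suc (Suc b) \<le> 2 * n" using b(3) by auto
    show ?thesis unfolding 3 5 unfolding 4[OF c(1)] 4[OF c(2)] b(1,2) by (simp add: field_simps)
  qed
  have "pl_area (2 * n) f g (p a) (p (a + Suc m)) - pl_area n f g (p a) (p (a + Suc m))
    = (pl_area (2 * n) f g (p a) (p (a + m)) - pl_area n f g (p a) (p (a + m)))
     + ((f (r (Suc b)) - f (r b)) * (g (r (Suc (Suc b))) - g (r (Suc b))) - (f (r (Suc (Suc b))) - f (r (Suc b))) * (g (r (Suc b)) - g (r b))) / 2"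
    unfolding 1 2 cell[symmetric] by simp
  also have "\<dots> = (\<Sum>i<Suc m. let x = \<lambda>h d. h (r (2 * (a + i) + Suc d)) - h (r (2 * (a + i) + d))
        in (x f 0 * x g 1 - x f 1 * x g 0) / 2)"
    unfolding IH by (simp add: Let_def b_def)
  finally show ?case unfolding p_def r_def .
qed

subsection \<open>Pathwise comparison of successive refinements\<close>

text \<open>A bound on the Hilbert-Schmidt norm, phrased through finite index sets so that no
  summability has to be carried along: addition is Minkowski's inequality for \<open>L2_set\<close>,
  and entrywise limits preserve the bound.\<close>

definition hs_bound :: "(nat \<Rightarrow> nat \<Rightarrow> real) \<Rightarrow> real \<Rightarrow> bool" where
  "hs_bound f B \<longleftrightarrow> 0 \<le> B \<and> (\<forall>F. finite F \<longrightarrow> L2_set (\<lambda>p. f (fst p) (snd p)) F \<le> B)"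

lemma hs_bound_nonneg: "hs_bound f B \<Longrightarrow> 0 \<le> B"
  by (simp add: hs_bound_def)

lemma hs_bound_mono: "hs_bound f B \<Longrightarrow> B \<le> B' \<Longrightarrow> hs_bound f B'"
  unfolding hs_bound_def by (meson order_trans)

lemma hs_bound_add:
  assumes "hs_bound f B" "hs_bound g B'"
  shows "hs_bound (\<lambda>j l. f j l + g j l) (B + B')"
  using assms L2_set_triangle_ineq[of "\<lambda>p. f (fst p) (snd p)" "\<lambda>p. g (fst p) (snd p)"]
  unfolding hs_bound_def by (meson add_mono add_nonneg_nonneg order_trans)

lemma hs_bound_uminus: "hs_bound f B \<Longrightarrow> hs_bound (\<lambda>j l. - f j l) B"
  unfolding hs_bound_def L2_set_def by simp

lemma hs_bound_diff:
  assumes "hs_bound f B" "hs_bound g B'"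
  shows "hs_bound (\<lambda>j l. f j l - g j l) (B + B')"
  using hs_bound_add[OF assms(1) hs_bound_uminus[OF assms(2)]] by simp

lemma hs_bound_zero: "0 \<le> B \<Longrightarrow> hs_bound (\<lambda>j l. 0) B"
  by (simp add: hs_bound_def L2_set_def)

lemma hs_bound_component:
  assumes "hs_bound f B"
  shows "\<bar>f j l\<bar> \<le> B"
proof -
  have "L2_set (\<lambda>p. f (fst p) (snd p)) {(j, l)} \<le> B"
    using assms unfolding hs_bound_def by blast
  then show ?thesis by (simp add: L2_set_def)
qed

lemma hs_bound_limit:
  assumes "\<And>r. hs_bound (f r) B" "\<And>j l. (\<lambda>r. f r j l) \<longlonglongrightarrow> g j l"
  shows "hs_bound g B"
  unfolding hs_bound_def
proof (intro conjI allI impI)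
  show "0 \<le> B" using assms(1) by (rule hs_bound_nonneg)
  fix F :: "(nat \<times> nat) set" assume "finite F"
  have "(\<lambda>r. L2_set (\<lambda>p. f r (fst p) (snd p)) F) \<longlonglongrightarrow> L2_set (\<lambda>p. g (fst p) (snd p)) F"
    unfolding L2_set_def by (intro tendsto_intros assms)
  then show "L2_set (\<lambda>p. g (fst p) (snd p)) F \<le> B"
    using assms(1) \<open>finite F\<close> by (intro LIMSEQ_le_const2) (auto simp: hs_bound_def)
qed

lemma hs_boundI:
  assumes "0 \<le> B" "\<And>N. (\<Sum>j<N. \<Sum>l<N. (f j l)\<^sup>2) \<le> B\<^sup>2"
  shows "hs_bound f B"
  unfolding hs_bound_def
proof (intro conjI allI impI assms(1))
  fix F :: "(nat \<times> nat) set" assume F: "finite F"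
  define N where "N = Suc (Max (insert 0 (fst ` F \<union> snd ` F)))"
  have "F \<subseteq> {..<N} \<times> {..<N}"
    using F unfolding N_def by (force simp: less_Suc_eq_le intro: Max_ge)
  then have "(\<Sum>p\<in>F. (f (fst p) (snd p))\<^sup>2) \<le> (\<Sum>p\<in>{..<N} \<times> {..<N}. (f (fst p) (snd p))\<^sup>2)"
    by (intro sum_mono2) auto
  also have "\<dots> = (\<Sum>j<N. \<Sum>l<N. (f j l)\<^sup>2)"
    by (simp add: sum.cartesian_product split_def)
  also have "\<dots> \<le> B\<^sup>2" by (rule assms)
  finally show "L2_set (\<lambda>p. f (fst p) (snd p)) F \<le> B"
    unfolding L2_set_def using assms(1) by (simp add: real_le_lsqrt)
qed

lemma bessel_inequality:
  fixes e :: "nat \<Rightarrow> 'v::real_inner"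
  assumes on: "\<And>i j. e i \<bullet> e j = (if i = j then 1 else 0)" and "finite J"
  shows "(\<Sum>j\<in>J. (e j \<bullet> u)\<^sup>2) \<le> (norm u)\<^sup>2"
proof -
  let ?p = "\<Sum>j\<in>J. (e j \<bullet> u) *\<^sub>R e j"
  have pu: "?p \<bullet> u = (\<Sum>j\<in>J. (e j \<bullet> u)\<^sup>2)"
    by (simp add: inner_sum_left power2_eq_square)
  have "?p \<bullet> ?p = (\<Sum>i\<in>J. \<Sum>j\<in>J. (e i \<bullet> u) * (e j \<bullet> u) * (e j \<bullet> e i))"
    by (simp add: inner_sum_left inner_sum_right sum_distrib_left sum_distrib_right mult_ac)
  also have "\<dots> = (\<Sum>i\<in>J. \<Sum>j\<in>J. if i = j then (e i \<bullet> u)\<^sup>2 else 0)"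
    by (intro sum.cong refl) (auto simp: on power2_eq_square)
  also have "\<dots> = (\<Sum>j\<in>J. (e j \<bullet> u)\<^sup>2)" using \<open>finite J\<close> by simp
  finally have pp: "?p \<bullet> ?p = (\<Sum>j\<in>J. (e j \<bullet> u)\<^sup>2)" .
  have "0 \<le> (u - ?p) \<bullet> (u - ?p)" by simp
  moreover have "(u - ?p) \<bullet> (u - ?p) = u \<bullet> u - ?p \<bullet> u - u \<bullet> ?p + ?p \<bullet> ?p"
    by (simp only: inner_diff_left inner_diff_right)
  moreover have "u \<bullet> ?p = ?p \<bullet> u" by (rule inner_commute)
  ultimately show ?thesis
    using pu pp unfolding power2_norm_eq_inner by linarith
qed

text \<open>The double sum of squares factors and Bessel's inequality bounds each factor. All
  coordinates are thus handled at once by norms in V.\<close>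

lemma hs_bound_tensor:
  fixes e :: "nat \<Rightarrow> 'v::real_inner"
  assumes on: "\<And>i j. e i \<bullet> e j = (if i = j then 1 else 0)" and "norm u * norm v \<le> B"
  shows "hs_bound (\<lambda>j l. (e j \<bullet> u) * (e l \<bullet> v)) B"
proof -
  have "hs_bound (\<lambda>j l. (e j \<bullet> u) * (e l \<bullet> v)) (norm u * norm v)"
  proof (rule hs_boundI)
    fix N
    have "(\<Sum>j<N. \<Sum>l<N. ((e j \<bullet> u) * (e l \<bullet> v))\<^sup>2) = (\<Sum>j<N. (e j \<bullet> u)\<^sup>2) * (\<Sum>l<N. (e l \<bullet> v)\<^sup>2)"
      by (simp add: sum_product power_mult_distrib)
    also have "\<dots> \<le> (norm u)\<^sup>2 * (norm v)\<^sup>2"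
      by (intro mult_mono bessel_inequality on sum_nonneg) auto
    finally show "(\<Sum>j<N. \<Sum>l<N. ((e j \<bullet> u) * (e l \<bullet> v))\<^sup>2) \<le> (norm u * norm v)\<^sup>2"
      by (simp add: power_mult_distrib)
  qed simp
  then show ?thesis using assms(2) by (rule hs_bound_mono)
qed

section \<open>Cells of the grid\<close>

definition in_cell :: "nat \<Rightarrow> real \<Rightarrow> real \<Rightarrow> bool" where
  "in_cell n s t \<longleftrightarrow> (\<exists>k<n. real k / real n \<le> s \<and> s \<le> t \<and> t \<le> real (Suc k) / real n)"

lemma in_cellD:
  assumes "in_cell n s t"
  shows "0 \<le> s" "s \<le> t" "t \<le> 1" "t - s \<le> 1 / real n"
proof -
  obtain k where k: "k < n" "real k / real n \<le> s" "s \<le> t" "t \<le> real (Suc k) / real n"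
    using assms unfolding in_cell_def by blast
  show "0 \<le> s" using k(2) by (meson divide_nonneg_nonneg of_nat_0_le_iff order_trans)
  show "s \<le> t" by fact
  have "real (Suc k) / real n \<le> 1" using k(1) by simp
  then show "t \<le> 1" using k(4) by linarith
  show "t - s \<le> 1 / real n" using k by (simp add: add_divide_distrib)
qed

lemma in_cell_exists:
  assumes "0 < n" "0 \<le> s" "s \<le> 1"
  obtains k where "k < n" "real k / real n \<le> s" "s \<le> real (Suc k) / real n"
proof (cases "s = 1")
  case True
  then show ?thesis using that[of "n - 1"] assms by simp
next
  case False
  define k where "k = nat \<lfloor>real n * s\<rfloor>"
  have "real n * s < real n" using False assms by simp
  then have "k < n" "real k \<le> real n * s" "real n * s \<le> real (Suc k)"
    unfolding k_def using assms by (auto simp: nat_less_iff floor_less_iff) linarith+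
  then show ?thesis using that[of k] assms by (auto simp: field_simps)
qed

text \<open>The inner nodes are the right end of a cell containing s and the left end of a cell
  containing t. They are in order because no single cell contains both points; they may
  coincide.\<close>

lemma cell_decomposition:
  assumes "0 < n" "0 \<le> s" "s \<le> t" "t \<le> 1" "\<not> in_cell n s t"
  obtains a b where "a \<le> b" "b \<le> n" "in_cell n s (real a / real n)" "in_cell n (real b / real n) t"
proof -
  obtain k where k: "k < n" "real k / real n \<le> s" "s \<le> real (Suc k) / real n"
    using in_cell_exists[of n s] assms by auto
  obtain l where l: "l < n" "real l / real n \<le> t" "t \<le> real (Suc l) / real n"
    using in_cell_exists[of n t] assms by auto
  have "real (Suc k) / real n < t" using k assms unfolding in_cell_def by force
  then have "real (Suc k) / real n < real (Suc l) / real n" using l by linarith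
  then have "Suc k \<le> l" using assms(1) by (simp add: divide_less_cancel)
  moreover have "in_cell n s (real (Suc k) / real n)" "in_cell n (real l / real n) t"
    using k l unfolding in_cell_def by blast+
  ultimately show ?thesis using that[of "Suc k" l] l by simp
qed

definition path_area :: "(nat \<Rightarrow> 'v::real_inner) \<Rightarrow> (real \<Rightarrow> 'v) \<Rightarrow> nat \<Rightarrow> nat \<Rightarrow> nat \<Rightarrow> real \<Rightarrow> real \<Rightarrow> real" where
  "path_area e w n j l s t = pl_area n (\<lambda>r. e j \<bullet> w r) (\<lambda>r. e l \<bullet> w r) s t"

text \<open>\<open>\<beta>\<close> is half the exponent aimed at in the time increment;
  \<open>\<theta>\<close> is surplus regularity, to be exchanged for a rate in n.\<close>

locale holder_path =
  fixes e :: "nat \<Rightarrow> 'v::real_inner" and w :: "real \<Rightarrow> 'v" and C \<beta> \<theta> \<gamma> :: real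
  assumes on: "\<And>i j. e i \<bullet> e j = (if i = j then 1 else 0)"
    and C: "0 \<le> C" and exponents: "0 < \<beta>" "0 < \<theta>" "\<gamma> = \<beta> + \<theta>" "\<gamma> < 1"
    and holder: "\<And>s t. \<lbrakk>0 \<le> s; s \<le> t; t \<le> 1\<rbrakk> \<Longrightarrow> norm (w t - w s) \<le> C * (t - s) powr \<gamma>"
begin

abbreviation "p n \<equiv> pl_interp n w"

abbreviation "A \<equiv> path_area e w"

lemma A_refl: "A n j l s s = 0"
  by (simp add: path_area_def pl_area_refl)

lemma A_chen:
  assumes "0 < n" "0 \<le> s" "s \<le> t" "t \<le> u" "u \<le> 1"
  shows "A n j l s u = A n j l s t + A n j l t u + (e j \<bullet> (p n t - p n s)) * (e l \<bullet> (p n u - p n t))"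
  unfolding path_area_def using pl_area_chen[OF assms] by (simp add: inner_diff_right inner_pl_interp)

lemma A_cell:
  assumes "in_cell n s t"
  shows "A n j l s t = (e j \<bullet> (p n t - p n s)) * (e l \<bullet> (p n t - p n s)) / 2"
proof -
  obtain k where k: "k < n" "real k / real n \<le> s" "s \<le> t" "t \<le> real (Suc k) / real n"
    using assms unfolding in_cell_def by blast
  then have "0 < n" by simp
  then show ?thesis
    unfolding path_area_def using pl_area_cell[OF _ k] by (simp add: inner_diff_right inner_pl_interp)
qed

text \<open>Inside a cell the path is affine and \<open>y\<close> is the fraction of the cell that
  is traversed. As y \<le> 1 and \<gamma> < 1, y is at most \<open>y powr \<gamma>\<close>, so the
  Hoelder constant is not enlarged.\<close>

lemma p_holder_cell:
  assumes "in_cell n s t"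
  shows "norm (p n t - p n s) \<le> C * (t - s) powr \<gamma>"
proof -
  obtain k where k: "k < n" "real k / real n \<le> s" "s \<le> t" "t \<le> real (Suc k) / real n"
    using assms unfolding in_cell_def by blast
  have n: "0 < n" using k by simp
  define y where "y = real n * (t - s)"
  have y: "0 \<le> y" unfolding y_def using k(3) by simp
  have "y \<le> real n * (1 / real n)"
    unfolding y_def using in_cellD(4)[OF assms] by (intro mult_left_mono) auto
  then have y1: "y \<le> 1" using n by simp
  let ?d = "w (real (Suc k) / real n) - w (real k / real n)"
  have "p n t - p n s = y *\<^sub>R ?d"
  proof -
    have "p n t = w (real k / real n) + (real n * t - real k) *\<^sub>R ?d"
      "p n s = w (real k / real n) + (real n * s - real k) *\<^sub>R ?d"
      using k n by (intro pl_interp_cell; linarith)+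
    moreover have "y = (real n * t - real k) - (real n * s - real k)"
      by (simp add: y_def right_diff_distrib)
    ultimately show ?thesis by (simp only: scaleR_left_diff_distrib) simp
  qed
  then have "norm (p n t - p n s) = y * norm ?d" using y by simp
  also have "\<dots> \<le> y powr \<gamma> * (C * (1 / real n) powr \<gamma>)"
  proof (intro mult_mono)
    show "y \<le> y powr \<gamma>"
      using powr_mono'[of \<gamma> 1 y] y y1 exponents by (cases "y = 0") auto
    have "real (Suc k) / real n \<le> 1" using k by simp
    then have "norm ?d \<le> C * (real (Suc k) / real n - real k / real n) powr \<gamma>"
      by (intro holder) (auto simp: divide_right_mono)
    then show "norm ?d \<le> C * (1 / real n) powr \<gamma>" by (simp add: add_divide_distrib)
  qed (use C in auto)
  also have "\<dots> = C * (t - s) powr \<gamma>"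
    using n k y by (simp add: y_def powr_mult powr_divide)
  finally show ?thesis .
qed

text \<open>Three pieces, hence the factor 3: two inside cells, and one between nodes, where the
  interpolation is the path itself.\<close>

lemma p_holder:
  assumes n: "0 < n" and st: "0 \<le> s" "s \<le> t" "t \<le> 1"
  shows "norm (p n t - p n s) \<le> 3 * C * (t - s) powr \<gamma>"
proof (cases "in_cell n s t")
  case True
  have "0 \<le> C * (t - s) powr \<gamma>" using C by simp
  then show ?thesis using p_holder_cell[OF True] by linarith
next
  case False
  then obtain a b where ab: "a \<le> b" "b \<le> n" "in_cell n s (real a / real n)" "in_cell n (real b / real n) t"
    using cell_decomposition assms by metis
  let ?a = "real a / real n" and ?b = "real b / real n"
  have ord: "s \<le> ?a" "?a \<le> ?b" "?b \<le> t" "?b \<le> 1" "0 \<le> ?a"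
    using in_cellD[OF ab(3)] in_cellD[OF ab(4)] ab by (auto simp: divide_right_mono)
  have mono: "C * (v - u) powr \<gamma> \<le> C * (t - s) powr \<gamma>" if "s \<le> u" "u \<le> v" "v \<le> t" for u v
    using that C exponents by (intro mult_left_mono powr_mono2) auto
  have "norm (p n t - p n s) \<le> norm (p n t - p n ?b) + norm (p n ?b - p n ?a) + norm (p n ?a - p n s)"
    using norm_triangle_ineq[of "p n t - p n ?b" "p n ?b - p n s"]
      norm_triangle_ineq[of "p n ?b - p n ?a" "p n ?a - p n s"] by simp
  also have "\<dots> \<le> C * (t - s) powr \<gamma> + C * (t - s) powr \<gamma> + C * (t - s) powr \<gamma>"
  proof (intro add_mono)
    show "norm (p n t - p n ?b) \<le> C * (t - s) powr \<gamma>"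
      using p_holder_cell[OF ab(4)] mono[of ?b t] ord by linarith
    show "norm (p n ?a - p n s) \<le> C * (t - s) powr \<gamma>"
      using p_holder_cell[OF ab(3)] mono[of s ?a] ord by linarith
    show "norm (p n ?b - p n ?a) \<le> C * (t - s) powr \<gamma>"
      using holder[of ?a ?b] mono[of ?a ?b] ord ab n by (simp add: pl_interp_grid)
  qed
  finally show ?thesis by simp
qed

text \<open>This is the exchange of regularity for rate. The short interval gives up its factor
  \<open>x powr \<theta>\<close>, bounded through x \<le> 1/n; an exponent of at least \<beta> is
  left on either factor.\<close>

lemma powr_gain:
  assumes "0 < n" "0 \<le> x" "x \<le> 1 / real n" "x \<le> d" "0 \<le> y" "y \<le> d" "d \<le> 1"
  shows "x powr \<gamma> * y powr \<gamma> \<le> real n powr (- \<theta>) * d powr (2 * \<beta>)"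
proof -
  have "x powr \<gamma> * y powr \<gamma> = x powr \<theta> * (x powr \<beta> * y powr \<gamma>)"
    using exponents by (simp add: powr_add)
  also have "\<dots> \<le> (1 / real n) powr \<theta> * (d powr \<beta> * d powr \<beta>)"
  proof (intro mult_mono)
    have "y powr \<gamma> \<le> y powr \<beta>"
      using exponents assms by (cases "y = 0") (auto intro: powr_mono')
    then show "y powr \<gamma> \<le> d powr \<beta>"
      using powr_mono2[of \<beta> y d] exponents assms by linarith
  qed (use assms exponents in \<open>auto intro: powr_mono2\<close>)
  also have "\<dots> = real n powr (- \<theta>) * d powr (2 * \<beta>)"
    using assms by (simp add: powr_divide powr_minus_divide flip: powr_add)
  finally show ?thesis .
qed

abbreviation "L \<equiv> 3 * C"

lemma tensor_p_bound:
  assumes n: "0 < n" "0 < m" and o1: "0 \<le> s" "s \<le> t" "t \<le> 1" and o2: "0 \<le> u" "u \<le> v" "v \<le> 1"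
  shows "hs_bound (\<lambda>j l. (e j \<bullet> (p n t - p n s)) * (e l \<bullet> (p m v - p m u)))
    (L\<^sup>2 * ((t - s) powr \<gamma> * (v - u) powr \<gamma>))"
proof (rule hs_bound_tensor[OF on])
  have "norm (p n t - p n s) * norm (p m v - p m u) \<le> (L * (t - s) powr \<gamma>) * (L * (v - u) powr \<gamma>)"
    using C by (intro mult_mono p_holder n o1 o2) auto
  then show "norm (p n t - p n s) * norm (p m v - p m u) \<le> L\<^sup>2 * ((t - s) powr \<gamma> * (v - u) powr \<gamma>)"
    by (simp add: power2_eq_square mult_ac)
qed

lemma A_cell_bound:
  assumes "in_cell n s t"
  shows "hs_bound (\<lambda>j l. A n j l s t) (L\<^sup>2 * ((t - s) powr \<gamma> * (t - s) powr \<gamma>) / 2)"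
proof -
  have n: "0 < n" using assms unfolding in_cell_def by auto
  have "hs_bound (\<lambda>j l. (e j \<bullet> (p n t - p n s)) * (e l \<bullet> (p n t - p n s)))
    (L\<^sup>2 * ((t - s) powr \<gamma> * (t - s) powr \<gamma>))"
    using in_cellD[OF assms] n by (intro tensor_p_bound)
  then have "hs_bound (\<lambda>j l. (e j \<bullet> (p n t - p n s)) * (e l \<bullet> (p n t - p n s)) / 2)
    (L\<^sup>2 * ((t - s) powr \<gamma> * (t - s) powr \<gamma>) / 2)"
    unfolding hs_bound_def L2_set_def by (simp add: power_divide sum_divide_distrib[symmetric] real_sqrt_divide)
  then show ?thesis by (simp add: A_cell[OF assms])
qed

text \<open>The midpoint \<open>\<mu>\<close> cuts a coarse cell into two fine cells. The factor 2
  is 1/2 + 1/2 for the two areas plus 1 for the product term.\<close>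

lemma A_double_cell_bound:
  assumes "in_cell n s t"
  shows "hs_bound (\<lambda>j l. A (2 * n) j l s t) (2 * (L\<^sup>2 * ((t - s) powr \<gamma> * (t - s) powr \<gamma>)))"
proof -
  obtain k where k: "k < n" "real k / real n \<le> s" "s \<le> t" "t \<le> real (Suc k) / real n"
    using assms unfolding in_cell_def by blast
  have n: "0 < n" using k by simp
  define \<mu> where "\<mu> = real (2 * k + 1) / real (2 * n)"
  have le: "L\<^sup>2 * ((t - s) powr \<gamma> * (t - s) powr \<gamma>) / 2 \<le> 2 * (L\<^sup>2 * ((t - s) powr \<gamma> * (t - s) powr \<gamma>))"
    by simp
  have mid: "real k / real n \<le> \<mu>" "\<mu> \<le> real (Suc k) / real n" "0 \<le> \<mu>"
    using n by (auto simp: \<mu>_def field_simps)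
  have c1: "in_cell (2 * n) u v" if "real k / real n \<le> u" "u \<le> v" "v \<le> \<mu>" for u v
    unfolding in_cell_def using that k by (intro exI[of _ "2 * k"]) (auto simp: \<mu>_def)
  have c2: "in_cell (2 * n) u v" if "\<mu> \<le> u" "u \<le> v" "v \<le> real (Suc k) / real n" for u v
    unfolding in_cell_def using that k n by (intro exI[of _ "2 * k + 1"]) (auto simp: \<mu>_def field_simps)
  consider "t \<le> \<mu>" | "\<mu> \<le> s" | "s \<le> \<mu>" "\<mu> \<le> t" by linarith
  then show ?thesis
  proof cases
    case 1
    then show ?thesis using A_cell_bound[OF c1[of s t]] k le by (meson hs_bound_mono)
  next
    case 2
    then show ?thesis using A_cell_bound[OF c2[of s t]] k le by (meson hs_bound_mono)
  next
    case 3
    have t1: "t \<le> 1" "0 \<le> s" using in_cellD[OF assms] by auto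
    have m: "(v - u) powr \<gamma> \<le> (t - s) powr \<gamma>" if "s \<le> u" "u \<le> v" "v \<le> t" for u v
      using that exponents by (intro powr_mono2) auto
    have mm: "L\<^sup>2 * ((v - u) powr \<gamma> * (v' - u') powr \<gamma>) \<le> L\<^sup>2 * ((t - s) powr \<gamma> * (t - s) powr \<gamma>)"
      if "s \<le> u" "u \<le> v" "v \<le> t" "s \<le> u'" "u' \<le> v'" "v' \<le> t" for u v u' v'
      using that by (intro mult_left_mono mult_mono m) auto
    have "hs_bound (\<lambda>j l. A (2 * n) j l s \<mu> + A (2 * n) j l \<mu> t
        + (e j \<bullet> (p (2 * n) \<mu> - p (2 * n) s)) * (e l \<bullet> (p (2 * n) t - p (2 * n) \<mu>)))
      (L\<^sup>2 * ((\<mu> - s) powr \<gamma> * (\<mu> - s) powr \<gamma>) / 2 + L\<^sup>2 * ((t - \<mu>) powr \<gamma> * (t - \<mu>) powr \<gamma>) / 2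
       + L\<^sup>2 * ((\<mu> - s) powr \<gamma> * (t - \<mu>) powr \<gamma>))"
      using 3 k n t1 mid by (intro hs_bound_add A_cell_bound c1 c2 tensor_p_bound) auto
    moreover have "L\<^sup>2 * ((\<mu> - s) powr \<gamma> * (\<mu> - s) powr \<gamma>) / 2 + L\<^sup>2 * ((t - \<mu>) powr \<gamma> * (t - \<mu>) powr \<gamma>) / 2
       + L\<^sup>2 * ((\<mu> - s) powr \<gamma> * (t - \<mu>) powr \<gamma>) \<le> 2 * (L\<^sup>2 * ((t - s) powr \<gamma> * (t - s) powr \<gamma>))"
      using mm[of s \<mu> s \<mu>] mm[of \<mu> t \<mu> t] mm[of s \<mu> \<mu> t] 3 by linarith
    moreover have "A (2 * n) j l s t = A (2 * n) j l s \<mu> + A (2 * n) j l \<mu> t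
        + (e j \<bullet> (p (2 * n) \<mu> - p (2 * n) s)) * (e l \<bullet> (p (2 * n) t - p (2 * n) \<mu>))" for j l
      using n t1 3 by (intro A_chen) auto
    ultimately show ?thesis by (simp add: hs_bound_mono)
  qed
qed

lemma A_diff_cell_bound:
  assumes "in_cell n s t" "t - s \<le> d" "d \<le> 1"
  shows "hs_bound (\<lambda>j l. A (2 * n) j l s t - A n j l s t) (5/2 * L\<^sup>2 * real n powr (- \<theta>) * d powr (2 * \<beta>))"
proof -
  have n: "0 < n" using assms unfolding in_cell_def by auto
  have "(t - s) powr \<gamma> * (t - s) powr \<gamma> \<le> real n powr (- \<theta>) * d powr (2 * \<beta>)"
    using in_cellD[OF assms(1)] assms n by (intro powr_gain) auto
  then have "5/2 * (L\<^sup>2 * ((t - s) powr \<gamma> * (t - s) powr \<gamma>)) \<le> 5/2 * (L\<^sup>2 * (real n powr (- \<theta>) * d powr (2 * \<beta>)))"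
    by (intro mult_left_mono) auto
  then show ?thesis
    using hs_bound_diff[OF A_double_cell_bound[OF assms(1)] A_cell_bound[OF assms(1)]]
    by (elim hs_bound_mono) (simp add: mult_ac)
qed

text \<open>Chen's relation at the two inner nodes leaves a middle part, covered by
  \<open>grid\<close>, and terms with a factor on an end cell, covered by \<open>powr_gain\<close>.
  The 9 is 5/2 + 5/2 for the two end cells plus 4 for the two product terms of each of the two
  interpolations.\<close>

lemma A_diff_bound:
  assumes n: "0 < n" and st: "0 \<le> s" "s \<le> t" "t \<le> 1" and R: "0 \<le> R"
    and grid: "\<And>a b. a < b \<Longrightarrow> b \<le> n \<Longrightarrow>
      hs_bound (\<lambda>j l. A (2 * n) j l (real a / real n) (real b / real n) - A n j l (real a / real n) (real b / real n))
        (R * real n powr (- \<theta>) * (real b / real n - real a / real n) powr (2 * \<beta>))"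
  shows "hs_bound (\<lambda>j l. A (2 * n) j l s t - A n j l s t)
    ((R + 9 * L\<^sup>2) * real n powr (- \<theta>) * (t - s) powr (2 * \<beta>))"
proof (cases "in_cell n s t")
  case True
  have "5/2 * L\<^sup>2 * (real n powr (- \<theta>) * (t - s) powr (2 * \<beta>)) \<le> (R + 9 * L\<^sup>2) * (real n powr (- \<theta>) * (t - s) powr (2 * \<beta>))"
    using R by (intro mult_right_mono) auto
  then show ?thesis
    using A_diff_cell_bound[OF True order_refl] st by (auto simp: mult_ac elim!: hs_bound_mono)
next
  case False
  define d where "d = t - s"
  define \<epsilon> where "\<epsilon> = real n powr (- \<theta>) * d powr (2 * \<beta>)"
  have \<epsilon>: "0 \<le> \<epsilon>" unfolding \<epsilon>_def by simp
  obtain a b where ab: "a \<le> b" "b \<le> n" "in_cell n s (real a / real n)" "in_cell n (real b / real n) t"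
    using cell_decomposition[OF n st False] by metis
  define x where "x = real a / real n"
  define y where "y = real b / real n"
  have o: "0 \<le> s" "s \<le> x" "x \<le> y" "y \<le> t" "t \<le> 1" "x - s \<le> 1 / real n" "t - y \<le> 1 / real n"
    using in_cellD[OF ab(3)] in_cellD[OF ab(4)] ab by (auto simp: divide_right_mono x_def y_def)
  note cells = ab(3,4)[folded x_def y_def]
  have mid: "hs_bound (\<lambda>j l. A (2 * n) j l x y - A n j l x y) (R * \<epsilon>)"
  proof (cases "a = b")
    case True
    then show ?thesis using R \<epsilon> by (simp add: x_def y_def A_refl hs_bound_zero)
  next
    case False
    have "R * real n powr (- \<theta>) * (y - x) powr (2 * \<beta>) \<le> R * real n powr (- \<theta>) * d powr (2 * \<beta>)"
      using o exponents R by (intro mult_left_mono powr_mono2) (auto simp: d_def)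
    then show ?thesis
      using grid[of a b] False ab unfolding \<epsilon>_def x_def[symmetric] y_def[symmetric]
      by (auto simp: mult_ac elim!: hs_bound_mono)
  qed
  \<comment> \<open>The product terms of the two interpolations are bounded one by one, without
    cancellation: one factor in each is an increment over an end cell.\<close>
  have cross: "hs_bound (\<lambda>j l. (e j \<bullet> (p m x - p m s)) * (e l \<bullet> (p m t - p m x))) (L\<^sup>2 * \<epsilon>)"
     "hs_bound (\<lambda>j l. (e j \<bullet> (p m y - p m x)) * (e l \<bullet> (p m t - p m y))) (L\<^sup>2 * \<epsilon>)" if m: "0 < m" for m
  proof -
    have "L\<^sup>2 * ((x - s) powr \<gamma> * (t - x) powr \<gamma>) \<le> L\<^sup>2 * \<epsilon>"
      unfolding \<epsilon>_def using o n by (intro mult_left_mono powr_gain) (auto simp: d_def)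
    moreover have "hs_bound (\<lambda>j l. (e j \<bullet> (p m x - p m s)) * (e l \<bullet> (p m t - p m x))) (L\<^sup>2 * ((x - s) powr \<gamma> * (t - x) powr \<gamma>))"
      using o m by (intro tensor_p_bound) auto
    ultimately show "hs_bound (\<lambda>j l. (e j \<bullet> (p m x - p m s)) * (e l \<bullet> (p m t - p m x))) (L\<^sup>2 * \<epsilon>)"
      by (rule hs_bound_mono[rotated])
    have "L\<^sup>2 * ((t - y) powr \<gamma> * (y - x) powr \<gamma>) \<le> L\<^sup>2 * \<epsilon>"
      unfolding \<epsilon>_def using o n by (intro mult_left_mono powr_gain) (auto simp: d_def)
    moreover have "hs_bound (\<lambda>j l. (e j \<bullet> (p m y - p m x)) * (e l \<bullet> (p m t - p m y))) (L\<^sup>2 * ((y - x) powr \<gamma> * (t - y) powr \<gamma>))"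
      using o m by (intro tensor_p_bound) auto
    ultimately show "hs_bound (\<lambda>j l. (e j \<bullet> (p m y - p m x)) * (e l \<bullet> (p m t - p m y))) (L\<^sup>2 * \<epsilon>)"
      by (elim hs_bound_mono) (simp add: mult.commute)
  qed
  have ends: "hs_bound (\<lambda>j l. A (2 * n) j l s x - A n j l s x) (5/2 * L\<^sup>2 * \<epsilon>)"
    "hs_bound (\<lambda>j l. A (2 * n) j l y t - A n j l y t) (5/2 * L\<^sup>2 * \<epsilon>)"
    unfolding \<epsilon>_def using A_diff_cell_bound[OF cells(1), of d] A_diff_cell_bound[OF cells(2), of d] o
    by (auto simp: d_def mult_ac)
  have ch: "A m j l s t = A m j l s x + A m j l x y + A m j l y t
      + (e j \<bullet> (p m y - p m x)) * (e l \<bullet> (p m t - p m y)) + (e j \<bullet> (p m x - p m s)) * (e l \<bullet> (p m t - p m x))"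
    if "0 < m" for m j l
    using that o A_chen[of m s x t j l] A_chen[of m x y t j l] by simp
  let ?D = "\<lambda>j l. (A (2 * n) j l s x - A n j l s x) + (A (2 * n) j l x y - A n j l x y)
     + (A (2 * n) j l y t - A n j l y t)
     + ((e j \<bullet> (p (2*n) y - p (2*n) x)) * (e l \<bullet> (p (2*n) t - p (2*n) y)) - (e j \<bullet> (p n y - p n x)) * (e l \<bullet> (p n t - p n y)))
     + ((e j \<bullet> (p (2*n) x - p (2*n) s)) * (e l \<bullet> (p (2*n) t - p (2*n) x)) - (e j \<bullet> (p n x - p n s)) * (e l \<bullet> (p n t - p n x)))"
  have "A (2 * n) j l s t - A n j l s t = ?D j l" for j l
    using ch[of n j l] ch[of "2 * n" j l] n by simp
  moreover have "hs_bound ?D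
    (5/2 * L\<^sup>2 * \<epsilon> + R * \<epsilon> + 5/2 * L\<^sup>2 * \<epsilon> + (L\<^sup>2 * \<epsilon> + L\<^sup>2 * \<epsilon>) + (L\<^sup>2 * \<epsilon> + L\<^sup>2 * \<epsilon>))"
    using n by (intro hs_bound_add hs_bound_diff[of "\<lambda>j l. _ j l * _ j l"] mid ends cross hs_bound_diff) auto
  moreover have "5/2 * L\<^sup>2 * \<epsilon> + R * \<epsilon> + 5/2 * L\<^sup>2 * \<epsilon> + (L\<^sup>2 * \<epsilon> + L\<^sup>2 * \<epsilon>) + (L\<^sup>2 * \<epsilon> + L\<^sup>2 * \<epsilon>)
    = (R + 9 * L\<^sup>2) * real n powr (- \<theta>) * (t - s) powr (2 * \<beta>)"
    unfolding \<epsilon>_def d_def[symmetric] by (simp add: algebra_simps)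
  ultimately show ?thesis by simp
qed

end

subsection \<open>Limits of the dyadic refinements\<close>

text \<open>The starting value n of the chain is kept as an argument because the limit might depend
  on it. Where the chain diverges, \<open>lim\<close> is an arbitrary value.\<close>

definition path_area_lim :: "(nat \<Rightarrow> 'v::real_inner) \<Rightarrow> (real \<Rightarrow> 'v) \<Rightarrow> nat \<Rightarrow> nat \<Rightarrow> nat \<Rightarrow> real \<Rightarrow> real \<Rightarrow> real" where
  "path_area_lim e w n j l s t = lim (\<lambda>r. path_area e w (n * 2 ^ r) j l s t)"

definition grid_floor :: "nat \<Rightarrow> real \<Rightarrow> real" where
  "grid_floor n t = real (nat \<lfloor>real n * t\<rfloor>) / real n"

lemma grid_floor_in_cell:
  assumes "0 < n" "0 \<le> t" "t \<le> 1"
  shows "in_cell n (grid_floor n t) t"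
proof (cases "t = 1")
  case True
  \<comment> \<open>For t = 1 the floor is the node 1 itself, which belongs to the last cell only as
    its right end.\<close>
  then show ?thesis using assms unfolding in_cell_def grid_floor_def
    by (intro exI[of _ "n - 1"]) (auto simp: divide_right_mono)
next
  case False
  define k where "k = nat \<lfloor>real n * t\<rfloor>"
  have "real n * t < real n" using False assms by simp
  then have "k < n" "real k \<le> real n * t" "real n * t \<le> real (Suc k)"
    unfolding k_def using assms by (auto simp: nat_less_iff floor_less_iff) linarith+
  then show ?thesis using assms unfolding in_cell_def grid_floor_def k_def[symmetric]
    by (intro exI[of _ k]) (auto simp: field_simps)
qed

lemma grid_floor_mono:
  assumes "s \<le> t"
  shows "grid_floor n s \<le> grid_floor n t"
  unfolding grid_floor_def using assms
  by (intro divide_right_mono of_nat_mono nat_mono floor_mono mult_left_mono) auto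

lemma filterlim_mult_power2:
  assumes "0 < (n::nat)"
  shows "filterlim (\<lambda>r. n * 2 ^ r) at_top sequentially"
proof (rule filterlim_at_top_mono[OF filterlim_ident])
  show "\<forall>\<^sub>F r in sequentially. r \<le> n * 2 ^ r"
    by (intro always_eventually allI)
       (metis assms less_exp less_imp_le mult_le_mono nat_mult_1 Suc_leI One_nat_def order_trans mult_1)
qed

lemma tendsto_inverse_powr:
  assumes "0 < (n::nat)" "0 < a"
  shows "(\<lambda>r. (1 / real (n * 2 ^ r)) powr a) \<longlonglongrightarrow> 0"
proof -
  have "filterlim (\<lambda>r. real (n * 2 ^ r)) at_top sequentially"
    by (rule filterlim_compose[OF filterlim_real_sequentially filterlim_mult_power2[OF assms(1)]])
  then have "(\<lambda>r. real (n * 2 ^ r) powr (- a)) \<longlonglongrightarrow> 0"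
    by (intro tendsto_neg_powr) (use assms in auto)
  then show ?thesis using assms by (simp add: powr_divide powr_minus_divide)
qed

section \<open>Convergence of the interpolated paths\<close>

context holder_path
begin

lemma p_near:
  assumes "0 < n" "0 \<le> t" "t \<le> 1"
  shows "norm (p n t - w t) \<le> 2 * C * (1 / real n) powr \<gamma>"
proof -
  let ?a = "grid_floor n t"
  have c: "in_cell n ?a t" by (rule grid_floor_in_cell[OF assms])
  have pa: "p n ?a = w ?a"
    unfolding grid_floor_def using assms
    by (intro pl_interp_grid) (auto simp: nat_le_iff floor_le_iff mult_le_cancel_left1 intro: le_less_trans[of _ "real n"])
  have m: "C * (t - ?a) powr \<gamma> \<le> C * (1 / real n) powr \<gamma>"
    using in_cellD[OF c] C exponents by (intro mult_left_mono powr_mono2) auto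
  have "norm (p n t - w t) \<le> norm (p n t - p n ?a) + norm (w t - w ?a)"
    using norm_triangle_ineq4[of "p n t - p n ?a" "w t - w ?a"] by (simp add: pa)
  also have "\<dots> \<le> C * (t - ?a) powr \<gamma> + C * (t - ?a) powr \<gamma>"
    using in_cellD[OF c] by (intro add_mono p_holder_cell c holder) auto
  finally show ?thesis using m by simp
qed

lemma p_tendsto:
  assumes "0 < n" "0 \<le> t" "t \<le> 1"
  shows "(\<lambda>r. p (n * 2 ^ r) t) \<longlonglongrightarrow> w t"
proof -
  have "(\<lambda>r. 2 * C * (1 / real (n * 2 ^ r)) powr \<gamma>) \<longlonglongrightarrow> 0"
    using exponents by (intro tendsto_mult_right_zero tendsto_inverse_powr assms) auto
  then have "(\<lambda>r. p (n * 2 ^ r) t - w t) \<longlonglongrightarrow> 0"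
    by (rule Lim_null_comparison[rotated]) (use assms in \<open>auto intro!: always_eventually p_near simp del: of_nat_mult\<close>)
  then show ?thesis by (rule LIM_zero_cancel)
qed

text \<open>For n = 1 the whole unit interval is a single cell, so the bound is purely pathwise. It
  is the starting value to which the telescoped differences are added.\<close>

lemma A_one_bound:
  assumes "0 \<le> s" "s \<le> t" "t \<le> 1"
  shows "hs_bound (\<lambda>j l. A 1 j l s t) (L\<^sup>2 * (t - s) powr (2 * \<beta>))"
proof -
  have c: "in_cell 1 s t" using assms unfolding in_cell_def by auto
  have "(t - s) powr \<gamma> * (t - s) powr \<gamma> \<le> real 1 powr (- \<theta>) * (t - s) powr (2 * \<beta>)"
    using assms by (intro powr_gain) auto
  then have "L\<^sup>2 * ((t - s) powr \<gamma> * (t - s) powr \<gamma>) \<le> L\<^sup>2 * (t - s) powr (2 * \<beta>)"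
    by (intro mult_left_mono) auto
  moreover have "0 \<le> L\<^sup>2 * ((t - s) powr \<gamma> * (t - s) powr \<gamma>)" by simp
  ultimately show ?thesis
    using A_cell_bound[OF c] by (elim hs_bound_mono) linarith
qed

end

text \<open>\<open>refine\<close> is the single input of probabilistic origin; all that is drawn
  from it in this locale is pathwise.\<close>

locale holder_path_conv = holder_path +
  fixes K :: real
  assumes K: "0 \<le> K"
    and refine: "\<And>n s t. \<lbrakk>0 < n; 0 \<le> s; s \<le> t; t \<le> 1\<rbrakk> \<Longrightarrow>
      hs_bound (\<lambda>j l. A (2 * n) j l s t - A n j l s t) (K * real n powr (- \<theta>) * (t - s) powr (2 * \<beta>))"
begin

abbreviation "Alim \<equiv> path_area_lim e w"

text \<open>The sum of the geometric series of ratio \<open>2 powr (- \<theta>)\<close>, the factor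
  gained with each doubling.\<close>

definition "\<kappa> = 1 / (1 - 2 powr (- \<theta>))"

lemma ratio: "0 \<le> (2::real) powr (- \<theta>)" "(2::real) powr (- \<theta>) < 1"
  using exponents by (auto simp: powr_less_one)

lemma kappa_nonneg: "0 \<le> \<kappa>"
  using ratio by (simp add: \<kappa>_def)

lemma step_bound:
  assumes "0 < n" "0 \<le> s" "s \<le> t" "t \<le> 1"
  shows "hs_bound (\<lambda>j l. A (n * 2 ^ Suc r) j l s t - A (n * 2 ^ r) j l s t)
    (K * real n powr (- \<theta>) * (t - s) powr (2 * \<beta>) * (2 powr (- \<theta>)) ^ r)"
proof -
  have "real (n * 2 ^ r) powr (- \<theta>) = real n powr (- \<theta>) * (2 powr (- \<theta>)) ^ r"
    by (simp add: powr_mult powr_power mult.commute flip: powr_realpow)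
       (simp add: powr_powr mult.commute)
  then show ?thesis using refine[of "n * 2 ^ r" s t] assms by (simp add: mult_ac)
qed

lemma partial_bound:
  assumes "0 < n" "0 \<le> s" "s \<le> t" "t \<le> 1"
  shows "hs_bound (\<lambda>j l. A (n * 2 ^ r) j l s t - A n j l s t)
    (K * \<kappa> * real n powr (- \<theta>) * (t - s) powr (2 * \<beta>))"
proof -
  define D where "D = K * real n powr (- \<theta>) * (t - s) powr (2 * \<beta>)"
  have D: "0 \<le> D" unfolding D_def using K by simp
  have "hs_bound (\<lambda>j l. A (n * 2 ^ r) j l s t - A n j l s t) (D * (\<Sum>i<r. (2 powr (- \<theta>)) ^ i))"
  proof (induction r)
    case 0
    then show ?case by (simp add: hs_bound_zero)
  next
    case (Suc r)
    have "hs_bound (\<lambda>j l. (A (n * 2 ^ r) j l s t - A n j l s t) + (A (n * 2 ^ Suc r) j l s t - A (n * 2 ^ r) j l s t))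
      (D * (\<Sum>i<r. (2 powr (- \<theta>)) ^ i) + D * (2 powr (- \<theta>)) ^ r)"
      by (intro hs_bound_add Suc step_bound[OF assms, folded D_def])
    then show ?case by (simp add: distrib_left)
  qed
  moreover have "(\<Sum>i<r. (2 powr (- \<theta>)) ^ i) \<le> \<kappa>"
    unfolding \<kappa>_def using ratio suminf_geometric[of "2 powr (- \<theta>)"]
      sum_le_suminf[OF summable_geometric, of "2 powr (- \<theta>)" "{..<r}"] by simp
  then have "D * (\<Sum>i<r. (2 powr (- \<theta>)) ^ i) \<le> D * \<kappa>" using D by (intro mult_left_mono)
  ultimately show ?thesis unfolding D_def by (auto simp: mult_ac elim!: hs_bound_mono)
qed

lemma Alim_tendsto:
  assumes "0 < n" "0 \<le> s" "s \<le> t" "t \<le> 1"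
  shows "(\<lambda>r. A (n * 2 ^ r) j l s t) \<longlonglongrightarrow> Alim n j l s t"
proof -
  define D where "D = K * real n powr (- \<theta>) * (t - s) powr (2 * \<beta>)"
  have "summable (\<lambda>r. A (n * 2 ^ Suc r) j l s t - A (n * 2 ^ r) j l s t)"
  proof (rule summable_comparison_test')
    show "summable (\<lambda>r. D * (2 powr (- \<theta>)) ^ r)"
      using ratio by (intro summable_mult summable_geometric) simp
    show "norm (A (n * 2 ^ Suc r) j l s t - A (n * 2 ^ r) j l s t) \<le> D * (2 powr (- \<theta>)) ^ r" for r
      using hs_bound_component[OF step_bound[OF assms, of r], of j l] unfolding D_def by simp
  qed
  moreover have "(\<Sum>i<r. A (n * 2 ^ Suc i) j l s t - A (n * 2 ^ i) j l s t) = A (n * 2 ^ r) j l s t - A n j l s t" for r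
    using sum_lessThan_telescope[of "\<lambda>r. A (n * 2 ^ r) j l s t" r] by (simp only: power_0 mult_1_right)
  ultimately have "convergent (\<lambda>r. A (n * 2 ^ r) j l s t)"
    by (simp only: summable_iff_convergent convergent_diff_const_right_iff)
  then show ?thesis unfolding path_area_lim_def by (simp add: convergent_LIMSEQ_iff)
qed

lemma Alim_bound:
  assumes "0 < n" "0 \<le> s" "s \<le> t" "t \<le> 1"
  shows "hs_bound (\<lambda>j l. Alim n j l s t - A n j l s t)
    (K * \<kappa> * real n powr (- \<theta>) * (t - s) powr (2 * \<beta>))"
  by (rule hs_bound_limit[where f = "\<lambda>r j l. A (n * 2 ^ r) j l s t - A n j l s t", OF partial_bound[OF assms]]) (intro tendsto_intros Alim_tendsto assms)

text \<open>A tail of the chain of n is the chain of \<open>n * 2 ^ r\<close>. Hence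
  \<open>Alim_bound\<close> can be applied at any later stage while the limit stays the
  same.\<close>

lemma Alim_shift:
  assumes "0 < n" "0 \<le> s" "s \<le> t" "t \<le> 1"
  shows "Alim (n * 2 ^ r) j l s t = Alim n j l s t"
proof -
  have "(\<lambda>i. A (n * 2 ^ (i + r)) j l s t) \<longlonglongrightarrow> Alim n j l s t"
    using LIMSEQ_ignore_initial_segment[OF Alim_tendsto[OF assms]] by simp
  moreover have "(\<lambda>i. A (n * 2 ^ r * 2 ^ i) j l s t) \<longlonglongrightarrow> Alim (n * 2 ^ r) j l s t"
    using assms by (intro Alim_tendsto) auto
  ultimately show ?thesis
    by (intro LIMSEQ_unique[of "\<lambda>i. A (n * 2 ^ r * 2 ^ i) j l s t"]) (simp_all add: power_add mult_ac)
qed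

lemma Alim_chen:
  assumes "0 < n" "0 \<le> s" "s \<le> t" "t \<le> u" "u \<le> 1"
  shows "Alim n j l s u = Alim n j l s t + Alim n j l t u + (e j \<bullet> (w t - w s)) * (e l \<bullet> (w u - w t))"
proof (rule LIMSEQ_unique)
  show "(\<lambda>r. A (n * 2 ^ r) j l s u) \<longlonglongrightarrow> Alim n j l s u"
    using assms by (intro Alim_tendsto) auto
  have "(\<lambda>r. A (n * 2 ^ r) j l s t + A (n * 2 ^ r) j l t u
      + (e j \<bullet> (p (n * 2 ^ r) t - p (n * 2 ^ r) s)) * (e l \<bullet> (p (n * 2 ^ r) u - p (n * 2 ^ r) t)))
    \<longlonglongrightarrow> Alim n j l s t + Alim n j l t u + (e j \<bullet> (w t - w s)) * (e l \<bullet> (w u - w t))"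
    using assms by (intro tendsto_intros Alim_tendsto p_tendsto) auto
  then show "(\<lambda>r. A (n * 2 ^ r) j l s u)
    \<longlonglongrightarrow> Alim n j l s t + Alim n j l t u + (e j \<bullet> (w t - w s)) * (e l \<bullet> (w u - w t))"
    using assms by (subst A_chen[where t = t]) auto
qed

lemma Alim_one_bound:
  assumes "0 \<le> s" "s \<le> t" "t \<le> 1"
  shows "hs_bound (\<lambda>j l. Alim 1 j l s t) ((K * \<kappa> + L\<^sup>2) * (t - s) powr (2 * \<beta>))"
  using hs_bound_add[OF Alim_bound[of 1, OF _ assms] A_one_bound[OF assms]]
  by (simp add: distrib_right)

text \<open>Chen's relation on the interval from s' to t, cut once at s and once at t'. The function
  \<open>G\<close> is arbitrary so that both the approximating areas and their limit can be
  inserted.\<close>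

lemma chen_near:
  fixes G :: "real \<Rightarrow> real \<Rightarrow> real" and v :: "real \<Rightarrow> 'a"
  assumes chen: "\<And>s t u. \<lbrakk>0 \<le> s; s \<le> t; t \<le> u; u \<le> 1\<rbrakk> \<Longrightarrow>
      G s u = G s t + G t u + (e j \<bullet> (v t - v s)) * (e l \<bullet> (v u - v t))"
    and o: "0 \<le> s'" "s' \<le> s" "s \<le> t" "s' \<le> t'" "t' \<le> t" "t \<le> 1"
  shows "G s' t' = G s t + G s' s - G t' t + (e j \<bullet> (v s - v s')) * (e l \<bullet> (v t - v s))
    - (e j \<bullet> (v t' - v s')) * (e l \<bullet> (v t - v t'))"
  using chen[of s' s t] chen[of s' t' t] o by linarith

lemma grid_floor_facts:
  assumes "0 < n" "0 \<le> t" "t \<le> 1"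
  shows "0 \<le> grid_floor n t" "grid_floor n t \<le> t" "t - grid_floor n t \<le> 1 / real n"
  using in_cellD[OF grid_floor_in_cell[OF assms]] by auto

lemma grid_floor_powr_tendsto:
  assumes "0 < n" "0 \<le> t" "t \<le> 1" "0 < a"
  shows "(\<lambda>r. (t - grid_floor (n * 2 ^ r) t) powr a) \<longlonglongrightarrow> 0"
proof (rule tendsto_sandwich[OF _ _ tendsto_const])
  show "(\<lambda>r. (1 / real (n * 2 ^ r)) powr a) \<longlonglongrightarrow> 0" by (intro tendsto_inverse_powr assms)
  show "\<forall>\<^sub>F r in sequentially. (t - grid_floor (n * 2 ^ r) t) powr a \<le> (1 / real (n * 2 ^ r)) powr a"
    using assms by (intro always_eventually allI powr_mono2 grid_floor_facts) (auto simp: grid_floor_facts)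
qed auto

text \<open>Interpolation and endpoints move together here. By \<open>chen_near\<close> the effect
  of moving the endpoints consists of areas over one cell and of products with one factor over one
  cell, all of which vanish.\<close>

lemma A_grid_tendsto:
  assumes n: "0 < n" and st: "0 \<le> s" "s \<le> t" "t \<le> 1"
  shows "(\<lambda>r. A (n * 2 ^ r) j l (grid_floor (n * 2 ^ r) s) (grid_floor (n * 2 ^ r) t)) \<longlonglongrightarrow> Alim n j l s t"
proof -
  define N where "N r = n * 2 ^ r" for r
  define S where "S r = grid_floor (N r) s" for r
  define T where "T r = grid_floor (N r) t" for r
  have N: "0 < N r" for r using n by (simp add: N_def)
  have t01: "0 \<le> t" "s \<le> 1" using st by auto
  have cs: "in_cell (N r) (S r) s" and ct: "in_cell (N r) (T r) t" for r
    unfolding S_def T_def using N st by (auto intro: grid_floor_in_cell)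
  have o: "0 \<le> S r" "S r \<le> s" "S r \<le> T r" "T r \<le> t" "0 \<le> T r" for r
    using in_cellD[OF cs[of r]] in_cellD[OF ct[of r]] grid_floor_mono[OF st(2), of "N r"]
    by (auto simp: S_def T_def)
  have ps: "(\<lambda>r. (s - S r) powr \<gamma>) \<longlonglongrightarrow> 0" and pt: "(\<lambda>r. (t - T r) powr \<gamma>) \<longlonglongrightarrow> 0"
    unfolding S_def T_def N_def using n st t01 exponents by (auto intro!: grid_floor_powr_tendsto)
  \<comment> \<open>Only the factor \<open>a\<close> has to tend to zero; \<open>b\<close> merely
    stays below 1.\<close>
  have null: "f \<longlonglongrightarrow> 0" if "\<And>r. norm (f r) \<le> M * (a r * b r)" "a \<longlonglongrightarrow> 0" "\<And>r. 0 \<le> a r" "\<And>r. 0 \<le> b r" "\<And>r. b r \<le> 1" "0 \<le> M"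
    for f :: "nat \<Rightarrow> real" and M :: real and a b :: "nat \<Rightarrow> real"
  proof (rule Lim_null_comparison)
    show "\<forall>\<^sub>F r in sequentially. norm (f r) \<le> M * a r"
      using that by (intro always_eventually allI) (meson mult_left_mono mult_left_le order_trans)
    show "(\<lambda>r. M * a r) \<longlonglongrightarrow> 0" using that(2) tendsto_mult_right_zero by blast
  qed
  have le1: "x powr \<gamma> \<le> 1" if "0 \<le> x" "x \<le> 1" for x
    using that exponents by (simp add: powr_le1)
  have 1: "(\<lambda>r. A (N r) j l (S r) s) \<longlonglongrightarrow> 0"
    using hs_bound_component[OF A_cell_bound[OF cs]] o t01 by (intro null[OF _ ps, of _ "L\<^sup>2 / 2" "\<lambda>r. (s - S r) powr \<gamma>"] le1) (auto simp: le_diff_eq diff_le_eq add_increasing2)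
  have 2: "(\<lambda>r. A (N r) j l (T r) t) \<longlonglongrightarrow> 0"
    using hs_bound_component[OF A_cell_bound[OF ct]] o st by (intro null[OF _ pt, of _ "L\<^sup>2 / 2" "\<lambda>r. (t - T r) powr \<gamma>"] le1) (auto simp: le_diff_eq diff_le_eq add_increasing2)
  have 3: "(\<lambda>r. (e j \<bullet> (p (N r) s - p (N r) (S r))) * (e l \<bullet> (p (N r) t - p (N r) s))) \<longlonglongrightarrow> 0"
    using hs_bound_component[OF tensor_p_bound] o st t01 N
    by (intro null[OF _ ps, of _ "L\<^sup>2" "\<lambda>r. (t - s) powr \<gamma>"] le1) (auto simp: le_diff_eq diff_le_eq add_increasing2)
  have 4: "(\<lambda>r. (e j \<bullet> (p (N r) (T r) - p (N r) (S r))) * (e l \<bullet> (p (N r) t - p (N r) (T r)))) \<longlonglongrightarrow> 0"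
  proof (rule null[OF _ pt, of _ "L\<^sup>2" "\<lambda>r. (T r - S r) powr \<gamma>"])
    show "norm ((e j \<bullet> (p (N r) (T r) - p (N r) (S r))) * (e l \<bullet> (p (N r) t - p (N r) (T r))))
      \<le> L\<^sup>2 * ((t - T r) powr \<gamma> * (T r - S r) powr \<gamma>)" for r
      using hs_bound_component[OF tensor_p_bound[OF N[of r] N[of r], of "S r" "T r" "T r" t], of j l] o[of r] st
      by (simp add: mult.commute)
    show "(T r - S r) powr \<gamma> \<le> 1" for r using o[of r] st by (intro le1) auto
  qed auto
  have eq: "A (N r) j l (S r) (T r) = A (N r) j l s t + A (N r) j l (S r) s - A (N r) j l (T r) t
      + (e j \<bullet> (p (N r) s - p (N r) (S r))) * (e l \<bullet> (p (N r) t - p (N r) s))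
      - (e j \<bullet> (p (N r) (T r) - p (N r) (S r))) * (e l \<bullet> (p (N r) t - p (N r) (T r)))" for r
    by (rule chen_near[where G = "A (N r) j l" and v = "p (N r)", OF A_chen[OF N] o(1,2) st(2) o(3,4) st(3)])
  have "(\<lambda>r. A (N r) j l (S r) (T r)) \<longlonglongrightarrow> Alim n j l s t + 0 - 0 + 0 - 0"
    unfolding eq using n st by (intro tendsto_add tendsto_diff 1 2 3 4) (auto simp: N_def intro: Alim_tendsto)
  then show ?thesis by (simp add: N_def S_def T_def)
qed

lemma w_grid_tendsto:
  assumes "0 < n" "0 \<le> t" "t \<le> 1"
  shows "(\<lambda>r. w (grid_floor (n * 2 ^ r) t)) \<longlonglongrightarrow> w t"
proof -
  have "(\<lambda>r. C * (t - grid_floor (n * 2 ^ r) t) powr \<gamma>) \<longlonglongrightarrow> 0"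
    using exponents by (intro tendsto_mult_right_zero grid_floor_powr_tendsto assms) auto
  then have "(\<lambda>r. w t - w (grid_floor (n * 2 ^ r) t)) \<longlonglongrightarrow> 0"
    by (rule Lim_null_comparison[rotated]) (use assms in \<open>auto intro!: always_eventually holder grid_floor_facts\<close>)
  then have "(\<lambda>r. w t - (w t - w (grid_floor (n * 2 ^ r) t))) \<longlonglongrightarrow> w t - 0"
    by (intro tendsto_diff tendsto_const)
  then show ?thesis by simp
qed

lemma Alim_one_grid_tendsto:
  assumes n: "0 < n" and st: "0 \<le> s" "s \<le> t" "t \<le> 1"
  shows "(\<lambda>r. Alim 1 j l (grid_floor (n * 2 ^ r) s) (grid_floor (n * 2 ^ r) t)) \<longlonglongrightarrow> Alim 1 j l s t"
proof -
  define S where "S r = grid_floor (n * 2 ^ r) s" for r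
  define T where "T r = grid_floor (n * 2 ^ r) t" for r
  have N: "0 < n * 2 ^ r" for r using n by simp
  have t01: "0 \<le> t" "s \<le> 1" using st by auto
  have o: "0 \<le> S r" "S r \<le> s" "S r \<le> T r" "T r \<le> t" "0 \<le> T r" for r
    using grid_floor_facts[OF N, of s r] grid_floor_facts[OF N, of t r] grid_floor_mono[OF st(2)] st
    by (auto simp: S_def T_def)
  have ps: "(\<lambda>r. (s - S r) powr (2 * \<beta>)) \<longlonglongrightarrow> 0" and pt: "(\<lambda>r. (t - T r) powr (2 * \<beta>)) \<longlonglongrightarrow> 0"
    unfolding S_def T_def using n st t01 exponents by (auto intro!: grid_floor_powr_tendsto)
  have ws: "(\<lambda>r. w (S r)) \<longlonglongrightarrow> w s" and wt: "(\<lambda>r. w (T r)) \<longlonglongrightarrow> w t"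
    unfolding S_def T_def using n st t01 by (auto intro!: w_grid_tendsto)
  have 1: "(\<lambda>r. Alim 1 j l (S r) s) \<longlonglongrightarrow> 0"
  proof (rule Lim_null_comparison)
    show "(\<lambda>r. (K * \<kappa> + L\<^sup>2) * (s - S r) powr (2 * \<beta>)) \<longlonglongrightarrow> 0"
      using ps by (rule tendsto_mult_right_zero)
  qed (use hs_bound_component[OF Alim_one_bound] o t01 in auto)
  have 2: "(\<lambda>r. Alim 1 j l (T r) t) \<longlonglongrightarrow> 0"
  proof (rule Lim_null_comparison)
    show "(\<lambda>r. (K * \<kappa> + L\<^sup>2) * (t - T r) powr (2 * \<beta>)) \<longlonglongrightarrow> 0"
      using pt by (rule tendsto_mult_right_zero)
  qed (use hs_bound_component[OF Alim_one_bound] o st in auto)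
  have eq: "Alim 1 j l (S r) (T r) = Alim 1 j l s t + Alim 1 j l (S r) s - Alim 1 j l (T r) t
      + (e j \<bullet> (w s - w (S r))) * (e l \<bullet> (w t - w s))
      - (e j \<bullet> (w (T r) - w (S r))) * (e l \<bullet> (w t - w (T r)))" for r
    by (rule chen_near[where G = "Alim 1 j l" and v = w, OF Alim_chen[OF zero_less_one] o(1,2) st(2) o(3,4) st(3)])
  have "(\<lambda>r. Alim 1 j l (S r) (T r)) \<longlonglongrightarrow> Alim 1 j l s t + 0 - 0
      + (e j \<bullet> (w s - w s)) * (e l \<bullet> (w t - w s)) - (e j \<bullet> (w t - w s)) * (e l \<bullet> (w t - w t))"
    unfolding eq by (intro tendsto_intros 1 2 ws wt)
  then show ?thesis by (simp add: S_def T_def)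
qed

text \<open>\<open>grid\<close> concerns only rational endpoints. At the nodes of the grid
  \<open>n * 2 ^ r\<close>, the limit for n is close to \<open>A (n * 2 ^ r)\<close> uniformly in
  the endpoints, by \<open>Alim_shift\<close> and \<open>Alim_bound\<close>, and the latter
  converges by \<open>A_grid_tendsto\<close>; the limit for 1 is continuous along the same
  nodes.\<close>

lemma Alim_eq_Alim_one:
  assumes n: "0 < n" and st: "0 \<le> s" "s \<le> t" "t \<le> 1"
    and grid: "\<And>N a b. \<lbrakk>0 < N; a \<le> b; b \<le> N\<rbrakk> \<Longrightarrow>
      Alim n j l (real a / real N) (real b / real N) = Alim 1 j l (real a / real N) (real b / real N)"
  shows "Alim n j l s t = Alim 1 j l s t"
proof (rule LIMSEQ_unique[OF _ Alim_one_grid_tendsto[OF n st]])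
  define N where "N r = n * 2 ^ r" for r
  have N: "0 < N r" for r using n by (simp add: N_def)
  define S where "S r = grid_floor (N r) s" for r
  define T where "T r = grid_floor (N r) t" for r
  have o: "0 \<le> S r" "S r \<le> T r" "T r \<le> 1" for r
    using grid_floor_facts[OF N, of s r] grid_floor_facts[OF N, of t r] grid_floor_mono[OF st(2)] st
    by (auto simp: S_def T_def intro: order_trans)
  have eqn: "Alim n j l (S r) (T r) = Alim 1 j l (S r) (T r)" for r
  proof -
    have "nat \<lfloor>real (N r) * s\<rfloor> \<le> nat \<lfloor>real (N r) * t\<rfloor>"
      using st by (intro nat_mono floor_mono mult_left_mono) auto
    moreover have "nat \<lfloor>real (N r) * t\<rfloor> \<le> N r"
    proof -
      have "T r \<le> 1" by (rule o)
      then show ?thesis using N[of r] unfolding T_def grid_floor_def by simp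
    qed
    ultimately show ?thesis unfolding S_def T_def grid_floor_def by (intro grid N)
  qed
  have "(\<lambda>r. Alim n j l (S r) (T r) - A (N r) j l (S r) (T r)) \<longlonglongrightarrow> 0"
  proof (rule Lim_null_comparison)
    have "(\<lambda>r. K * \<kappa> * (1 / real (n * 2 ^ r)) powr \<theta>) \<longlonglongrightarrow> 0"
      using exponents n by (intro tendsto_mult_right_zero tendsto_inverse_powr) auto
    then show "(\<lambda>r. K * \<kappa> * (1 / real (N r)) powr \<theta>) \<longlonglongrightarrow> 0" by (simp add: N_def)
    show "\<forall>\<^sub>F r in sequentially. norm (Alim n j l (S r) (T r) - A (N r) j l (S r) (T r)) \<le> K * \<kappa> * (1 / real (N r)) powr \<theta>"
    proof (intro always_eventually allI)
      fix r
      have "\<bar>Alim (N r) j l (S r) (T r) - A (N r) j l (S r) (T r)\<bar>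
        \<le> K * \<kappa> * real (N r) powr (- \<theta>) * (T r - S r) powr (2 * \<beta>)"
        by (rule hs_bound_component[OF Alim_bound[OF N o]])
      also have "\<dots> \<le> K * \<kappa> * real (N r) powr (- \<theta>)"
        using o[of r] exponents K kappa_nonneg by (intro mult_left_le powr_le1) auto
      also have "real (N r) powr (- \<theta>) = (1 / real (N r)) powr \<theta>"
        using N[of r] by (simp add: powr_divide powr_minus_divide)
      finally show "norm (Alim n j l (S r) (T r) - A (N r) j l (S r) (T r)) \<le> K * \<kappa> * (1 / real (N r)) powr \<theta>"
        using Alim_shift[OF n o(1)[of r] o(2)[of r] o(3)[of r], of r j l] by (simp add: N_def)
    qed
  qed
  moreover have "(\<lambda>r. A (N r) j l (S r) (T r)) \<longlonglongrightarrow> Alim n j l s t"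
    using A_grid_tendsto[OF n st] by (simp add: N_def S_def T_def)
  ultimately have "(\<lambda>r. (Alim n j l (S r) (T r) - A (N r) j l (S r) (T r)) + A (N r) j l (S r) (T r)) \<longlonglongrightarrow> 0 + Alim n j l s t"
    by (rule tendsto_add)
  then show "(\<lambda>r. Alim 1 j l (grid_floor (n * 2 ^ r) s) (grid_floor (n * 2 ^ r) t)) \<longlonglongrightarrow> Alim n j l s t"
    by (simp add: eqn) (simp add: S_def T_def N_def)
qed

end

subsection \<open>Gaussian families\<close>

lemma gaussian_family_cong:
  assumes "gaussian_family M I X C" "\<And>i j. i \<in> I \<Longrightarrow> j \<in> I \<Longrightarrow> C i j = C' i j"
    and "\<And>i x. i \<in> I \<Longrightarrow> X i x = X' i x"
  shows "gaussian_family M I X' C'"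
  unfolding gaussian_family_def
proof (intro conjI ballI allI impI)
  fix i assume "i \<in> I"
  then have "X i = X' i" "X i \<in> borel_measurable M"
    using assms unfolding gaussian_family_def by auto
  then show "X' i \<in> borel_measurable M" by simp
next
  fix F c assume F: "finite F" "F \<subseteq> I"
  have "(LINT x|M. cis (\<Sum>i\<in>F. c i * X' i x)) = (LINT x|M. cis (\<Sum>i\<in>F. c i * X i x))"
    using F assms(3) by (intro arg_cong[where f = "integral\<^sup>L M"] ext arg_cong[where f = cis] sum.cong) auto
  also have "\<dots> = complex_of_real (exp (- (\<Sum>i\<in>F. \<Sum>j\<in>F. c i * c j * C i j) / 2))"
    using assms(1) F unfolding gaussian_family_def by blast
  also have "(\<Sum>i\<in>F. \<Sum>j\<in>F. c i * c j * C i j) = (\<Sum>i\<in>F. \<Sum>j\<in>F. c i * c j * C' i j)"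
    using F assms(2) by (intro sum.cong refl) (metis subsetD)
  finally show "(LINT x|M. cis (\<Sum>i\<in>F. c i * X' i x)) = complex_of_real (exp (- (\<Sum>i\<in>F. \<Sum>j\<in>F. c i * c j * C' i j) / 2))" .
qed

lemma gaussian_family_combine:
  assumes G: "gaussian_family M I X C" and ph: "\<And>k. k \<in> K \<Longrightarrow> \<phi> k \<in> I" and ps: "\<And>k. k \<in> K \<Longrightarrow> \<psi> k \<in> I"
  shows "gaussian_family M K (\<lambda>k x. a k * X (\<phi> k) x + b k * X (\<psi> k) x)
    (\<lambda>k k'. a k * a k' * C (\<phi> k) (\<phi> k') + a k * b k' * C (\<phi> k) (\<psi> k')
      + b k * a k' * C (\<psi> k) (\<phi> k') + b k * b k' * C (\<psi> k) (\<psi> k'))"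
  (is "gaussian_family M K _ ?C")
  unfolding gaussian_family_def
proof (intro conjI ballI allI impI)
  have [measurable]: "X i \<in> borel_measurable M" if "i \<in> I" for i
    using G that unfolding gaussian_family_def by blast
  fix k assume "k \<in> K"
  then show "(\<lambda>x. a k * X (\<phi> k) x + b k * X (\<psi> k) x) \<in> borel_measurable M"
    using ph ps by measurable
next
  fix F c assume F: "finite F" "F \<subseteq> K"
  define T where "T = \<phi> ` F \<union> \<psi> ` F"
  have T: "finite T" "T \<subseteq> I" using F ph ps unfolding T_def by auto
  \<comment> \<open>\<open>\<phi>\<close> and \<open>\<psi>\<close> need not be injective and their
    images may overlap, so all coefficients that fall on one original variable are added up.\<close>
  define d where "d i = (\<Sum>k\<in>F. c k * (a k * (if i = \<phi> k then 1 else 0) + b k * (if i = \<psi> k then 1 else 0)))" for i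
  have lin: "(\<Sum>i\<in>T. d i * h i) = (\<Sum>k\<in>F. c k * (a k * h (\<phi> k) + b k * h (\<psi> k)))" for h
  proof -
    have "(\<Sum>i\<in>T. d i * h i) = (\<Sum>k\<in>F. \<Sum>i\<in>T. c k * (a k * (if i = \<phi> k then h i else 0) + b k * (if i = \<psi> k then h i else 0)))"
      unfolding d_def sum_distrib_right by (subst sum.swap) (auto intro!: sum.cong simp: algebra_simps)
    also have "\<dots> = (\<Sum>k\<in>F. c k * (a k * h (\<phi> k) + b k * h (\<psi> k)))"
    proof (rule sum.cong[OF refl])
      fix k assume "k \<in> F"
      then have "\<phi> k \<in> T" "\<psi> k \<in> T" unfolding T_def by auto
      then show "(\<Sum>i\<in>T. c k * (a k * (if i = \<phi> k then h i else 0) + b k * (if i = \<psi> k then h i else 0)))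
        = c k * (a k * h (\<phi> k) + b k * h (\<psi> k))"
        using T(1) by (simp add: sum_distrib_left[symmetric] sum.distrib)
    qed
    finally show ?thesis .
  qed
  have "(\<Sum>i\<in>T. \<Sum>j\<in>T. d i * d j * C i j) = (\<Sum>i\<in>T. d i * (\<Sum>j\<in>T. d j * C i j))"
    by (simp add: sum_distrib_left mult.assoc)
  also have "\<dots> = (\<Sum>k\<in>F. c k * (a k * (\<Sum>k'\<in>F. c k' * (a k' * C (\<phi> k) (\<phi> k') + b k' * C (\<phi> k) (\<psi> k')))
      + b k * (\<Sum>k'\<in>F. c k' * (a k' * C (\<psi> k) (\<phi> k') + b k' * C (\<psi> k) (\<psi> k')))))"
    unfolding lin ..
  also have "\<dots> = (\<Sum>k\<in>F. \<Sum>k'\<in>F. c k * c k' * ?C k k')"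
    unfolding sum_distrib_left sum.distrib[symmetric] by (intro sum.cong refl) (simp add: algebra_simps)
  finally have quad: "(\<Sum>i\<in>T. \<Sum>j\<in>T. d i * d j * C i j) = \<dots>" .
  have "(LINT x|M. cis (\<Sum>i\<in>T. d i * X i x)) = complex_of_real (exp (- (\<Sum>i\<in>T. \<Sum>j\<in>T. d i * d j * C i j) / 2))"
    using G T unfolding gaussian_family_def by blast
  then show "(LINT x|M. cis (\<Sum>k\<in>F. c k * (a k * X (\<phi> k) x + b k * X (\<psi> k) x))) =
      complex_of_real (exp (- (\<Sum>k\<in>F. \<Sum>k'\<in>F. c k * c k' * ?C k k') / 2))"
    unfolding lin quad .
qed

section \<open>Laws and moments of Gaussian variables\<close>

lemma measurable_cis [measurable]: "cis \<in> borel_measurable borel"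
  by (intro borel_measurable_continuous_onI continuous_intros)

lemma char_eq_cis: "char D t = (LINT x|D. cis (t * x))"
  unfolding char_def by (simp add: cis_conv_exp mult.commute)

text \<open>\<open>gaussian_family\<close> puts no sign condition on C; the variance is nonnegative
  because a characteristic function is bounded by 1. The law is written as an image of the standard
  normal law so that variance zero, which has no density, is included.\<close>

lemma gaussian_family_distr:
  assumes "prob_space M" and G: "gaussian_family M I X C" and i: "i \<in> I"
  shows "0 \<le> C i i" and "distr M borel (X i) = distr std_normal_distribution borel (\<lambda>y. sqrt (C i i) * y)"
proof -
  interpret prob_space M by fact
  interpret N: real_distribution std_normal_distribution by (rule real_dist_normal_dist)
  have [measurable]: "X i \<in> borel_measurable M" using G i unfolding gaussian_family_def by blast
  have cf: "(LINT x|M. cis (t * X i x)) = complex_of_real (exp (- (t * t * C i i) / 2))" for t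
  proof -
    have "finite {i}" "{i} \<subseteq> I" using i by auto
    then have "(LINT x|M. cis (\<Sum>j\<in>{i}. t * X j x)) = complex_of_real (exp (- (\<Sum>j\<in>{i}. \<Sum>k\<in>{i}. t * t * C j k) / 2))"
      using G[unfolded gaussian_family_def, THEN conjunct2, rule_format, of "{i}" "\<lambda>_. t"] by blast
    then show ?thesis by simp
  qed
  have "norm (LINT x|M. cis (1 * X i x)) \<le> (LINT x|M. norm (cis (1 * X i x)))"
    by (rule integral_norm_bound)
  then have "exp (- C i i / 2) \<le> 1" unfolding cf by (simp add: prob_space)
  then show C: "0 \<le> C i i" by simp
  show "distr M borel (X i) = distr std_normal_distribution borel (\<lambda>y. sqrt (C i i) * y)"
  proof (rule Levy_uniqueness)
    show "real_distribution (distr M borel (X i))" by (rule real_distribution_distr) simp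
    show "real_distribution (distr std_normal_distribution borel (\<lambda>y. sqrt (C i i) * y))"
      by (rule N.real_distribution_distr) simp
    show "char (distr M borel (X i)) = char (distr std_normal_distribution borel (\<lambda>y. sqrt (C i i) * y))"
    proof
      fix t
      have "char (distr std_normal_distribution borel (\<lambda>y. sqrt (C i i) * y)) t = char std_normal_distribution (t * sqrt (C i i))"
        unfolding char_eq_cis by (subst integral_distr) (auto simp: mult.assoc)
      also have "\<dots> = complex_of_real (exp (- (t * t * C i i) / 2))"
        using C by (simp add: char_std_normal_distribution power_mult_distrib power2_eq_square[of t])
      also have "\<dots> = char (distr M borel (X i)) t"
        unfolding char_eq_cis by (subst integral_distr) (auto simp: cf)
      finally show "char (distr M borel (X i)) t = char (distr std_normal_distribution borel (\<lambda>y. sqrt (C i i) * y)) t" ..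
    qed
  qed
qed

lemma gaussian_family_fourth_moment:
  assumes "prob_space M" and G: "gaussian_family M I X C" and i: "i \<in> I"
  shows "integrable M (\<lambda>x. X i x ^ 4)" "(LINT x|M. X i x ^ 4) = 3 * (C i i)\<^sup>2"
proof -
  have [measurable]: "X i \<in> borel_measurable M" using G i unfolding gaussian_family_def by blast
  note D = gaussian_family_distr[OF assms]
  have C4: "(sqrt (C i i) * y) ^ 4 = (C i i)\<^sup>2 * y ^ (2 * 2)" for y
    using D(1) by (simp add: power_mult_distrib) (metis numeral_Bit0 power_add power2_eq_square real_sqrt_pow2)
  have "integrable (distr std_normal_distribution borel (\<lambda>y. sqrt (C i i) * y)) (\<lambda>y. y ^ 4)"
    using std_normal_distribution_even_moments(2)[of 2] by (subst integrable_distr_eq) (simp_all add: C4)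
  then show "integrable M (\<lambda>x. X i x ^ 4)"
    unfolding D(2)[symmetric] by (subst (asm) integrable_distr_eq) simp_all
  have "(LINT x|M. X i x ^ 4) = (LINT y|distr M borel (X i). y ^ 4)"
    by (subst integral_distr) simp_all
  also have "\<dots> = (LINT y|std_normal_distribution. (sqrt (C i i) * y) ^ 4)"
    unfolding D(2) by (subst integral_distr) simp_all
  also have "\<dots> = (C i i)\<^sup>2 * 3"
    unfolding C4 using std_normal_distribution_even_moments(1)[of 2] by (simp add: fact_numeral)
  finally show "(LINT x|M. X i x ^ 4) = 3 * (C i i)\<^sup>2" by simp
qed

lemma gaussian_family_isserlis:
  assumes P: "prob_space M" and G: "gaussian_family M I X C"
    and sym: "\<And>i j. i \<in> I \<Longrightarrow> j \<in> I \<Longrightarrow> C i j = C j i"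
    and abcd: "a \<in> I" "b \<in> I" "c \<in> I" "d \<in> I"
  shows "integrable M (\<lambda>x. X a x * X b x * X c x * X d x)"
    and "(LINT x|M. X a x * X b x * X c x * X d x) = C a b * C c d + C a c * C b d + C a d * C b c"
proof -
  text \<open>Polarisation reduces the product to fourth powers of linear combinations.\<close>
  define V where "V \<epsilon> \<eta> \<kappa> x = X a x + \<epsilon> * X b x + \<kappa> * (X c x + \<eta> * X d x)" for \<epsilon> \<eta> \<kappa> :: real and x
  define Q where "Q \<epsilon> \<eta> \<kappa> = C a a + \<epsilon>\<^sup>2 * C b b + \<kappa>\<^sup>2 * C c c + (\<kappa> * \<eta>)\<^sup>2 * C d d
    + 2 * (\<epsilon> * C a b + \<kappa> * C a c + \<kappa> * \<eta> * C a d + \<epsilon> * \<kappa> * C b c + \<epsilon> * \<kappa> * \<eta> * C b d + \<kappa>\<^sup>2 * \<eta> * C c d)" for \<epsilon> \<eta> \<kappa>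
  have V: "integrable M (\<lambda>x. V \<epsilon> \<eta> \<kappa> x ^ 4) \<and> (LINT x|M. V \<epsilon> \<eta> \<kappa> x ^ 4) = 3 * (Q \<epsilon> \<eta> \<kappa>)\<^sup>2" for \<epsilon> \<eta> \<kappa>
  proof -
    \<comment> \<open>\<open>gaussian_family_combine\<close> joins two members at a time: a family
      indexed by \<open>bool\<close> holds the combinations of a, b and of c, d, and one indexed by
      \<open>unit\<close> joins these two.\<close>
    note G1 = gaussian_family_combine[OF G, of UNIV "\<lambda>k::bool. if k then a else c" "\<lambda>k. if k then b else d" "\<lambda>k. 1" "\<lambda>k. if k then \<epsilon> else \<eta>"]
    note G2 = gaussian_family_combine[OF G1, of UNIV "\<lambda>k::unit. True" "\<lambda>k. False" "\<lambda>k. 1" "\<lambda>k. \<kappa>"]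
    note fm = gaussian_family_fourth_moment[OF P G2, of "()"]
    show ?thesis
      using fm abcd sym[of b a] sym[of c a] sym[of d a] sym[of c b] sym[of d b] sym[of d c]
      by (simp add: V_def[abs_def] Q_def power2_eq_square algebra_simps)
  qed
  have four: "(p + r) ^ 4 + (p - r) ^ 4 = 2 * p ^ 4 + 12 * (p\<^sup>2 * r\<^sup>2) + 2 * r ^ 4" for p r :: real
    by algebra
  \<comment> \<open>Adding the two signs of \<open>\<kappa>\<close> isolates 12 times a product of
    squares, by \<open>four\<close>. The differences over \<open>\<epsilon>\<close> and
    \<open>\<eta>\<close> turn these squares into 4 times a product each, whence 192 = 12 * 4 *
    4.\<close>
  have pol: "X a x * X b x * X c x * X d x = (V 1 1 1 x ^ 4 + V 1 1 (-1) x ^ 4 + V (-1) (-1) 1 x ^ 4 + V (-1) (-1) (-1) x ^ 4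
     - V (-1) 1 1 x ^ 4 - V (-1) 1 (-1) x ^ 4 - V 1 (-1) 1 x ^ 4 - V 1 (-1) (-1) x ^ 4) / 192" for x
  proof -
    have s: "V \<epsilon> \<eta> 1 x ^ 4 + V \<epsilon> \<eta> (-1) x ^ 4 = 2 * (X a x + \<epsilon> * X b x) ^ 4
        + 12 * ((X a x + \<epsilon> * X b x)\<^sup>2 * (X c x + \<eta> * X d x)\<^sup>2) + 2 * (X c x + \<eta> * X d x) ^ 4" for \<epsilon> \<eta>
    proof -
      have "V \<epsilon> \<eta> 1 x = (X a x + \<epsilon> * X b x) + (X c x + \<eta> * X d x)"
        "V \<epsilon> \<eta> (-1) x = (X a x + \<epsilon> * X b x) - (X c x + \<eta> * X d x)"
        by (simp_all add: V_def)
      then show ?thesis by (simp only: four)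
    qed
    have "192 * (X a x * X b x * X c x * X d x)
       = 12 * ((X a x + X b x)\<^sup>2 - (X a x - X b x)\<^sup>2) * ((X c x + X d x)\<^sup>2 - (X c x - X d x)\<^sup>2)"
      by algebra
    also have "\<dots> = (V 1 1 1 x ^ 4 + V 1 1 (-1) x ^ 4) + (V (-1) (-1) 1 x ^ 4 + V (-1) (-1) (-1) x ^ 4)
     - (V (-1) 1 1 x ^ 4 + V (-1) 1 (-1) x ^ 4) - (V 1 (-1) 1 x ^ 4 + V 1 (-1) (-1) x ^ 4)"
      unfolding s by (simp add: left_diff_distrib right_diff_distrib)
    finally show ?thesis by simp
  qed
  show "integrable M (\<lambda>x. X a x * X b x * X c x * X d x)"
    unfolding pol using V by (intro integrable_divide Bochner_Integration.integrable_diff Bochner_Integration.integrable_add) auto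
  have "(LINT x|M. X a x * X b x * X c x * X d x) = 3 * ((Q 1 1 1)\<^sup>2 + (Q 1 1 (-1))\<^sup>2 + (Q (-1) (-1) 1)\<^sup>2 + (Q (-1) (-1) (-1))\<^sup>2
     - (Q (-1) 1 1)\<^sup>2 - (Q (-1) 1 (-1))\<^sup>2 - (Q 1 (-1) 1)\<^sup>2 - (Q 1 (-1) (-1))\<^sup>2) / 192"
    unfolding pol using V by (simp add: algebra_simps)
  also have "\<dots> = C a b * C c d + C a c * C b d + C a d * C b c"
    unfolding Q_def by (simp add: field_simps power2_eq_square)
  finally show "(LINT x|M. X a x * X b x * X c x * X d x) = C a b * C c d + C a c * C b d + C a d * C b c" .
qed

text \<open>At t = 0 the hypothesis \<open>cf\<close> identifies r as the mass of \<rho>; after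
  division by r, Levy's theorem applies. The product form of the result plays the role of
  independence of \<rho> and U.\<close>

lemma tilted_gaussian:
  assumes P: "prob_space M" and U[measurable]: "U \<in> borel_measurable M" and rho: "integrable M \<rho>" "\<And>x. 0 \<le> \<rho> x"
    and r: "0 < r" and cf: "\<And>t. (LINT x|M. \<rho> x *\<^sub>R cis (t * U x)) = complex_of_real (r * exp (- t\<^sup>2 / 2))"
    and g: "integrable std_normal_distribution g"
  shows "integrable M (\<lambda>x. \<rho> x * g (U x))" "(LINT x|M. \<rho> x * g (U x)) = r * (LINT y|std_normal_distribution. g y)"
proof -
  interpret prob_space M by fact
  have [measurable]: "\<rho> \<in> borel_measurable M" using rho by auto
  have [measurable]: "g \<in> borel_measurable borel" using borel_measurable_integrable[OF g] by simp
  have "complex_of_real (LINT x|M. \<rho> x) = (LINT x|M. \<rho> x *\<^sub>R cis (0 * U x))"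
    by (simp add: scaleR_conv_of_real)
  also have "\<dots> = complex_of_real r" using cf[of 0] by simp
  finally have Er: "(LINT x|M. \<rho> x) = r" by (simp only: of_real_eq_iff)
  define M' where "M' = density M (\<lambda>x. ennreal (\<rho> x / r))"
  have nn: "0 \<le> \<rho> x / r" for x using rho r by simp
  have [measurable_cong]: "sets M' = sets M" by (simp add: M'_def)
  have "emeasure M' (space M') = (\<integral>\<^sup>+ x. ennreal (\<rho> x / r) \<partial>M)"
    unfolding M'_def by (subst emeasure_density) (auto intro!: nn_integral_cong simp: indicator_def)
  also have "\<dots> = ennreal (LINT x|M. \<rho> x / r)"
    using rho nn by (intro nn_integral_eq_integral) auto
  also have "\<dots> = 1" using Er r by simp
  finally interpret M': prob_space M' by (intro prob_spaceI)
  have D: "distr M' borel U = std_normal_distribution"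
  proof (rule Levy_uniqueness[OF _ real_dist_normal_dist])
    show "real_distribution (distr M' borel U)" by (rule M'.real_distribution_distr) simp
    show "char (distr M' borel U) = char std_normal_distribution"
    proof
      fix t
      have "char (distr M' borel U) t = (LINT x|M'. cis (t * U x))"
        unfolding char_eq_cis by (subst integral_distr) simp_all
      also have "\<dots> = (LINT x|M. (\<rho> x / r) *\<^sub>R cis (t * U x))"
        unfolding M'_def using nn by (subst integral_density) auto
      also have "\<dots> = (1 / r) *\<^sub>R (LINT x|M. \<rho> x *\<^sub>R cis (t * U x))"
        by (subst integral_scaleR_right[symmetric]) simp
      also have "\<dots> = char std_normal_distribution t"
        unfolding cf using r by (simp add: char_std_normal_distribution scaleR_conv_of_real)
      finally show "char (distr M' borel U) t = char std_normal_distribution t" .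
    qed
  qed
  have "integrable M' (\<lambda>x. g (U x))"
    using g unfolding D[symmetric] by (subst (asm) integrable_distr_eq) simp_all
  then have "integrable M (\<lambda>x. (\<rho> x / r) *\<^sub>R g (U x))"
    unfolding M'_def using nn by (subst (asm) integrable_density) auto
  then have "integrable M (\<lambda>x. r * ((\<rho> x / r) *\<^sub>R g (U x)))" by (rule integrable_mult_right)
  then show "integrable M (\<lambda>x. \<rho> x * g (U x))" using r by simp
  have "(LINT y|std_normal_distribution. g y) = (LINT x|M'. g (U x))"
    unfolding D[symmetric] by (subst integral_distr) simp_all
  also have "\<dots> = (LINT x|M. (\<rho> x / r) *\<^sub>R g (U x))"
    unfolding M'_def using nn by (subst integral_density) auto
  also have "\<dots> = (LINT x|M. \<rho> x * g (U x)) / r" by simp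
  finally show "(LINT x|M. \<rho> x * g (U x)) = r * (LINT y|std_normal_distribution. g y)" using r by simp
qed


text \<open>Independence is obtained one variable at a time, from Levy's uniqueness theorem on the real line: under the probability measure with density proportional to
\<^term>\<open>\<rho>\<close>, for \<^term>\<open>\<rho>\<close> a function of the other variables, the remaining variable is still standard normal.
The densities used are a product \<^term>\<open>Q\<close> of functions of single variables times
\<^term>\<open>1 + cos S\<close> or \<^term>\<open>1 + sin S\<close>, with \<^term>\<open>S\<close> a linear combination.\<close>

lemma independent_gaussians_prod:
  assumes P: "prob_space M" and K: "finite K"
    and G: "gaussian_family M K U (\<lambda>k k'. if k = k' then 1 else 0)"
    and g: "\<And>k y. 0 \<le> g k y" "\<And>k. integrable std_normal_distribution (g k)"
      "\<And>k. 0 < (LINT y|std_normal_distribution. g k y)"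
    and F: "F \<subseteq> K"
  shows "integrable M (\<lambda>x. \<Prod>k\<in>F. g k (U k x)) \<and>
    (\<forall>c. (\<forall>k\<in>F. c k = 0) \<longrightarrow> (LINT x|M. (\<Prod>k\<in>F. g k (U k x)) *\<^sub>R cis (\<Sum>k\<in>K. c k * U k x)) =
      complex_of_real ((\<Prod>k\<in>F. LINT y|std_normal_distribution. g k y) * exp (- (\<Sum>k\<in>K. (c k)\<^sup>2) / 2)))"
proof -
  interpret prob_space M by fact
  have U[measurable]: "U k \<in> borel_measurable M" if "k \<in> K" for k
    using G that unfolding gaussian_family_def by blast
  have gm[measurable]: "g k \<in> borel_measurable borel" for k using borel_measurable_integrable[OF g(2)] by simp
  let ?m = "\<lambda>k. LINT y|std_normal_distribution. g k y"
  have "finite F" using F K finite_subset by blast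
  then show ?thesis using F
  proof (induction F)
    case empty
    have "(LINT x|M. cis (\<Sum>k\<in>K. c k * U k x)) = complex_of_real (exp (- (\<Sum>k\<in>K. (c k)\<^sup>2) / 2))" for c
    proof -
      have "(LINT x|M. cis (\<Sum>k\<in>K. c k * U k x)) = complex_of_real (exp (- (\<Sum>i\<in>K. \<Sum>j\<in>K. c i * c j * (if i = j then 1 else 0)) / 2))"
        using G K unfolding gaussian_family_def by blast
      also have "(\<Sum>i\<in>K. \<Sum>j\<in>K. c i * c j * (if i = j then 1 else 0)) = (\<Sum>k\<in>K. (c k)\<^sup>2)"
        using K by (simp add: power2_eq_square if_distrib[of "\<lambda>x. _ * x"] cong: if_cong)
      finally show ?thesis .
    qed
    then show ?case by simp
  next
    case (insert k0 F)
    have k0: "k0 \<in> K" and FK: "F \<subseteq> K" using insert.prems by auto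
    define Q where "Q x = (\<Prod>k\<in>F. g k (U k x))" for x
    define p where "p = (\<Prod>k\<in>F. ?m k)"
    have p: "0 < p" unfolding p_def using g(3) by (intro prod_pos) auto
    have Q0: "0 \<le> Q x" for x unfolding Q_def using g(1) by (intro prod_nonneg) auto
    note IH = insert.IH[OF FK, folded Q_def p_def]
    have Qi: "integrable M Q" using IH by simp
    have Qm[measurable]: "Q \<in> borel_measurable M" using Qi by auto
    have Q: "(LINT x|M. Q x *\<^sub>R cis (\<Sum>k\<in>K. c k * U k x)) = complex_of_real (p * exp (- (\<Sum>k\<in>K. (c k)\<^sup>2) / 2))"
      if "\<forall>k\<in>F. c k = 0" for c using IH that by blast
    have Qcis: "integrable M (\<lambda>x. Q x *\<^sub>R cis (f x))" if "f \<in> borel_measurable M" for f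
      using Qi that Q0 by (rule_tac Bochner_Integration.integrable_bound[OF Qi]) auto
    \<comment> \<open>The induction hypothesis admits all coefficients that vanish on
      \<open>F\<close>. Since \<open>k0\<close> is not in \<open>F\<close>, its coefficient may be
      set to t.\<close>
    have tilt: "(LINT x|M. Q x *\<^sub>R cis (t * U k0 x + (\<Sum>k\<in>K. c k * U k x)))
        = complex_of_real (p * (exp (- t\<^sup>2 / 2) * exp (- (\<Sum>k\<in>K. (c k)\<^sup>2) / 2)))"
      if c: "\<forall>k\<in>insert k0 F. c k = 0" for c t
    proof -
      define c' where "c' k = (if k = k0 then t else c k)" for k
      have split: "(\<Sum>k\<in>K. h (c' k) k) = h t k0 + (\<Sum>k\<in>K. h (c k) k)" if "h 0 k0 = 0" for h :: "real \<Rightarrow> 'b \<Rightarrow> real"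
        using k0 K c that by (simp add: sum.remove[of K k0] c'_def)
      have "\<forall>k\<in>F. c' k = 0" using c insert.hyps by (auto simp: c'_def)
      from Q[OF this] show ?thesis
        by (simp add: split[of "\<lambda>y k. y * U k _"] split[of "\<lambda>y k. y\<^sup>2"] add_divide_distrib exp_add[symmetric])
    qed
    have res: "integrable M (\<lambda>x. Q x * g k0 (U k0 x)) \<and>
        (LINT x|M. (Q x * g k0 (U k0 x)) *\<^sub>R cis (\<Sum>k\<in>K. c k * U k x)) =
        complex_of_real (p * ?m k0 * exp (- (\<Sum>k\<in>K. (c k)\<^sup>2) / 2))"
      if c: "\<forall>k\<in>insert k0 F. c k = 0" for c
    proof -
      define S where "S x = (\<Sum>k\<in>K. c k * U k x)" for x
      define v where "v = exp (- (\<Sum>k\<in>K. (c k)\<^sup>2) / 2)"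
      have v: "0 < v" by (simp add: v_def)
      have Sm[measurable]: "S \<in> borel_measurable M" unfolding S_def by measurable
      have U0[measurable]: "U k0 \<in> borel_measurable M" using k0 by measurable
      have t0: "(LINT x|M. Q x *\<^sub>R cis (t * U k0 x)) = complex_of_real (p * exp (- t\<^sup>2 / 2))" for t
        using tilt[of "\<lambda>_. 0" t] by simp
      have tp: "(LINT x|M. Q x *\<^sub>R cis (t * U k0 x + S x)) = complex_of_real (p * (exp (- t\<^sup>2 / 2) * v))" for t
        using tilt[OF c, of t] by (simp add: S_def v_def)
      have tm: "(LINT x|M. Q x *\<^sub>R cis (t * U k0 x - S x)) = complex_of_real (p * (exp (- t\<^sup>2 / 2) * v))" for t
        using tilt[of "\<lambda>k. - c k" t] c by (simp add: S_def v_def sum_negf)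
      have 1: "integrable M (\<lambda>x. Q x * g k0 (U k0 x))" "(LINT x|M. Q x * g k0 (U k0 x)) = p * ?m k0"
        by (intro tilted_gaussian[OF P U0 Qi Q0 p t0 g(2)])+
      have qb: "integrable M (\<lambda>x. Q x * h x)" if "h \<in> borel_measurable M" "\<And>x. \<bar>h x\<bar> \<le> 2" for h
      proof (rule Bochner_Integration.integrable_bound[of M "\<lambda>x. 2 * Q x"])
        show "integrable M (\<lambda>x. 2 * Q x)" using Qi by simp
        show "AE x in M. norm (Q x * h x) \<le> norm (2 * Q x)"
          using that(2) Q0 by (intro AE_I2) (simp add: abs_mult mult.commute mult_left_mono)
      qed (use that in measurable)
      have cosb: "0 \<le> 1 + cos y" "\<bar>1 + cos y\<bar> \<le> 2" for y :: real
        using cos_le_one[of y] cos_ge_minus_one[of y] unfolding abs_le_iff by linarith+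
      have sinb: "0 \<le> 1 + sin y" "\<bar>1 + sin y\<bar> \<le> 2" for y :: real
        using sin_le_one[of y] sin_ge_minus_one[of y] unfolding abs_le_iff by linarith+
      \<comment> \<open>The cosine and sine of S are combinations of \<open>cis S\<close> and
        \<open>cis (- S)\<close>, which reduces the tilted characteristic functions to
        \<open>t0\<close>, \<open>tp\<close> and \<open>tm\<close>. The added 1 keeps the densities
        nonnegative.\<close>
      have cosc: "(Q x * (1 + cos (S x))) *\<^sub>R cis (t * U k0 x) = Q x *\<^sub>R cis (t * U k0 x)
          + (1/2) *\<^sub>R (Q x *\<^sub>R cis (t * U k0 x + S x)) + (1/2) *\<^sub>R (Q x *\<^sub>R cis (t * U k0 x - S x))" for x t
        by (simp add: complex_eq_iff cos_add sin_add cos_diff sin_diff field_simps)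
      have sinc: "(Q x * (1 + sin (S x))) *\<^sub>R cis (t * U k0 x) = Q x *\<^sub>R cis (t * U k0 x)
          + (- \<i> / 2) * (Q x *\<^sub>R cis (t * U k0 x + S x)) - (- \<i> / 2) * (Q x *\<^sub>R cis (t * U k0 x - S x))" for x t
        by (simp add: complex_eq_iff cos_add sin_add cos_diff sin_diff field_simps)
      have ints: "integrable M (\<lambda>x. Q x *\<^sub>R cis (t * U k0 x))" "integrable M (\<lambda>x. Q x *\<^sub>R cis (t * U k0 x + S x))"
        "integrable M (\<lambda>x. Q x *\<^sub>R cis (t * U k0 x - S x))" for t
        by (intro Qcis; measurable)+
      have cfc: "(LINT x|M. (Q x * (1 + cos (S x))) *\<^sub>R cis (t * U k0 x)) = complex_of_real (p * (1 + v) * exp (- t\<^sup>2 / 2))" for t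
      proof -
        have "(LINT x|M. (Q x * (1 + cos (S x))) *\<^sub>R cis (t * U k0 x)) = (LINT x|M. Q x *\<^sub>R cis (t * U k0 x))
          + (1/2) *\<^sub>R (LINT x|M. Q x *\<^sub>R cis (t * U k0 x + S x)) + (1/2) *\<^sub>R (LINT x|M. Q x *\<^sub>R cis (t * U k0 x - S x))"
          unfolding cosc by (simp only: Bochner_Integration.integral_add Bochner_Integration.integrable_add integrable_scaleR_right integral_scaleR_right ints)
        then show ?thesis unfolding t0 tp tm by (simp add: scaleR_conv_of_real algebra_simps)
      qed
      \<comment> \<open>The contributions of S and - S cancel, so this density has mass
        \<open>p\<close>, whereas the cosine density has mass \<open>p * (1 + v)\<close>.\<close>
      have cfs: "(LINT x|M. (Q x * (1 + sin (S x))) *\<^sub>R cis (t * U k0 x)) = complex_of_real (p * exp (- t\<^sup>2 / 2))" for t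
      proof -
        have "(LINT x|M. (Q x * (1 + sin (S x))) *\<^sub>R cis (t * U k0 x)) = (LINT x|M. Q x *\<^sub>R cis (t * U k0 x))
          + (- \<i> / 2) * (LINT x|M. Q x *\<^sub>R cis (t * U k0 x + S x)) - (- \<i> / 2) * (LINT x|M. Q x *\<^sub>R cis (t * U k0 x - S x))"
          unfolding sinc by (simp only: Bochner_Integration.integral_add Bochner_Integration.integrable_add Bochner_Integration.integral_diff Bochner_Integration.integrable_diff integrable_mult_right integral_mult_right_zero ints)
        then show ?thesis unfolding t0 tp tm by simp
      qed
      have 2: "integrable M (\<lambda>x. Q x * (1 + cos (S x)) * g k0 (U k0 x))"
        "(LINT x|M. Q x * (1 + cos (S x)) * g k0 (U k0 x)) = p * (1 + v) * ?m k0"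
        using p v by (intro tilted_gaussian[OF P U0 qb _ _ cfc g(2)] mult_nonneg_nonneg Q0 cosb mult_pos_pos; simp)+
      have 3: "integrable M (\<lambda>x. Q x * (1 + sin (S x)) * g k0 (U k0 x))"
        "(LINT x|M. Q x * (1 + sin (S x)) * g k0 (U k0 x)) = p * ?m k0"
        using p v by (intro tilted_gaussian[OF P U0 qb _ _ cfs g(2)] mult_nonneg_nonneg Q0 sinb; simp)+
      \<comment> \<open>Subtracting the integral without tilt removes the added 1 and leaves the
        real and the imaginary part of the integral wanted.\<close>
      have cs: "(Q x * g k0 (U k0 x)) *\<^sub>R cis (S x)
          = complex_of_real (Q x * (1 + cos (S x)) * g k0 (U k0 x) - Q x * g k0 (U k0 x))
          + \<i> * complex_of_real (Q x * (1 + sin (S x)) * g k0 (U k0 x) - Q x * g k0 (U k0 x))" for x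
        by (simp add: complex_eq_iff algebra_simps)
      have "(LINT x|M. (Q x * g k0 (U k0 x)) *\<^sub>R cis (S x))
         = complex_of_real (p * (1 + v) * ?m k0 - p * ?m k0) + \<i> * complex_of_real (p * ?m k0 - p * ?m k0)"
      proof -
        have i: "integrable M (\<lambda>x. Q x * (1 + cos (S x)) * g k0 (U k0 x) - Q x * g k0 (U k0 x))"
          "integrable M (\<lambda>x. Q x * (1 + sin (S x)) * g k0 (U k0 x) - Q x * g k0 (U k0 x))"
          by (intro Bochner_Integration.integrable_diff 1 2 3)+
        note ic = i[THEN integrable_of_real[where 'a = complex]]
        have v1: "(LINT x|M. Q x * (1 + cos (S x)) * g k0 (U k0 x) - Q x * g k0 (U k0 x)) = p * (1 + v) * ?m k0 - p * ?m k0"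
          "(LINT x|M. Q x * (1 + sin (S x)) * g k0 (U k0 x) - Q x * g k0 (U k0 x)) = p * ?m k0 - p * ?m k0"
          by (simp_all only: Bochner_Integration.integral_diff 1 2 3)
        show ?thesis
          unfolding cs
          by (subst Bochner_Integration.integral_add[OF ic(1) integrable_mult_right[OF ic(2)]])
             (simp only: integral_mult_right_zero integral_complex_of_real v1)
      qed
      then show ?thesis using 1 by (simp add: S_def v_def algebra_simps)
    qed
    have ins: "(\<Prod>k\<in>insert k0 F. g k (U k x)) = Q x * g k0 (U k0 x)" for x
      using insert.hyps by (simp add: Q_def mult.commute)
    have ins2: "(\<Prod>k\<in>insert k0 F. ?m k) = p * ?m k0"
      using insert.hyps by (simp add: p_def mult.commute)
    show ?case unfolding ins ins2 using res res[of "\<lambda>_. 0"] by blast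
  qed
qed

section \<open>Exponential and power moments of signed sums of squares\<close>

lemma std_normal_exp_square:
  assumes "\<bar>a\<bar> \<le> 1/4"
  shows "integrable std_normal_distribution (\<lambda>y. exp (a * y\<^sup>2))"
    and "(LINT y|std_normal_distribution. exp (a * y\<^sup>2)) = 1 / sqrt (1 - 2 * a)"
    and "1 / sqrt (1 - 2 * a) \<le> exp (a + 4 * a\<^sup>2)"
proof -
  have a: "0 < 1 - 2 * a" using assms by linarith
  define \<sigma> where "\<sigma> = 1 / sqrt (1 - 2 * a)"
  have s2: "\<sigma>\<^sup>2 = 1 / (1 - 2 * a)" using a by (simp add: \<sigma>_def power_divide)
  have s: "0 < \<sigma>" using a by (simp add: \<sigma>_def)
  \<comment> \<open>Absorbing the exponential into the Gaussian density changes the variance to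
    \<open>\<sigma>\<^sup>2\<close> and the normalisation by \<sigma>.\<close>
  have eq: "std_normal_density y *\<^sub>R exp (a * y\<^sup>2) = \<sigma> * normal_density 0 \<sigma> y" for y
  proof -
    have "- y\<^sup>2 / 2 + a * y\<^sup>2 = - (y - 0)\<^sup>2 / (2 * \<sigma>\<^sup>2)"
      unfolding s2 using a by (simp add: field_simps)
    moreover have "\<sigma> * (1 / sqrt (2 * pi * \<sigma>\<^sup>2)) = 1 / sqrt (2 * pi)"
      using s by (simp add: real_sqrt_mult)
    ultimately show ?thesis
      unfolding std_normal_density_def unfolding normal_density_def
      by (metis (no_types, lifting) exp_add mult.assoc real_scaleR_def)
  qed
  show "integrable std_normal_distribution (\<lambda>y. exp (a * y\<^sup>2))"
    using s by (subst integrable_density) (auto simp: eq simp del: real_scaleR_def)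
  show "(LINT y|std_normal_distribution. exp (a * y\<^sup>2)) = 1 / sqrt (1 - 2 * a)"
    using s by (subst integral_density) (auto simp: eq \<sigma>_def[symmetric] simp del: real_scaleR_def)
  \<comment> \<open>Second order control of the logarithm at - 2 * a. The linear term a is kept
    exact because it is what the signs cancel later.\<close>
  have "\<bar>ln (1 + (- 2 * a)) - (- 2 * a)\<bar> \<le> 2 * (- 2 * a)\<^sup>2"
    using assms by (intro abs_ln_one_plus_x_minus_x_bound) auto
  then have "- (ln (1 - 2 * a) / 2) \<le> a + 4 * a\<^sup>2" by (simp add: power2_eq_square abs_le_iff)
  then have "exp (- (ln (1 - 2 * a) / 2)) \<le> exp (a + 4 * a\<^sup>2)" by simp
  moreover have "exp (- (ln (1 - 2 * a) / 2)) = 1 / sqrt (1 - 2 * a)"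
  proof -
    have "ln (1 - 2 * a) / 2 = ln (sqrt (1 - 2 * a))" using a by (simp only: ln_sqrt)
    moreover have "exp (ln (sqrt (1 - 2 * a))) = sqrt (1 - 2 * a)" using a by (intro exp_ln) simp
    ultimately show ?thesis by (simp only: exp_minus inverse_eq_divide)
  qed
  ultimately show "1 / sqrt (1 - 2 * a) \<le> exp (a + 4 * a\<^sup>2)" by simp
qed

text \<open>The expectation is a product over k. Since the signs add up to zero, the linear terms in
  the exponent cancel and only the quadratic ones remain; this makes the signed sum as small as the
  square root of the number of its terms.\<close>

lemma gaussian_chaos_exp:
  assumes P: "prob_space M" and K: "finite K"
    and G: "gaussian_family M K U (\<lambda>k k'. if k = k' then 1 else 0)"
    and \<epsilon>: "\<And>k. \<bar>\<epsilon> k\<bar> = 1" "(\<Sum>k\<in>K. \<epsilon> k) = 0" and \<mu>: "\<bar>\<mu>\<bar> \<le> 1/4"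
  shows "integrable M (\<lambda>x. exp (\<mu> * (\<Sum>k\<in>K. \<epsilon> k * (U k x)\<^sup>2)))"
    and "(LINT x|M. exp (\<mu> * (\<Sum>k\<in>K. \<epsilon> k * (U k x)\<^sup>2))) \<le> exp (4 * \<mu>\<^sup>2 * card K)"
proof -
  have a: "\<bar>\<mu> * \<epsilon> k\<bar> \<le> 1/4" for k using \<mu> \<epsilon>(1)[of k] by (simp add: abs_mult)
  note S = std_normal_exp_square[OF a]
  have pos: "0 < (LINT y|std_normal_distribution. exp (\<mu> * \<epsilon> k * y\<^sup>2))" for k
    unfolding S(2) using a[of k] by simp
  note pr = independent_gaussians_prod[OF P K G, of "\<lambda>k y. exp (\<mu> * \<epsilon> k * y\<^sup>2)" K, OF _ S(1) pos order_refl]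
  have eq: "exp (\<mu> * (\<Sum>k\<in>K. \<epsilon> k * (U k x)\<^sup>2)) = (\<Prod>k\<in>K. exp (\<mu> * \<epsilon> k * (U k x)\<^sup>2))" for x
    using K by (simp add: exp_sum[symmetric] sum_distrib_left mult.assoc)
  show "integrable M (\<lambda>x. exp (\<mu> * (\<Sum>k\<in>K. \<epsilon> k * (U k x)\<^sup>2)))"
    unfolding eq using pr by simp
  \<comment> \<open>The coefficients c served the induction; at c = 0 the formula is the product
    rule for expectations.\<close>
  have "complex_of_real (LINT x|M. (\<Prod>k\<in>K. exp (\<mu> * \<epsilon> k * (U k x)\<^sup>2)))
     = complex_of_real (\<Prod>k\<in>K. LINT y|std_normal_distribution. exp (\<mu> * \<epsilon> k * y\<^sup>2))"
    using pr[THEN conjunct2, rule_format, of "\<lambda>_. 0"] by (simp add: scaleR_conv_of_real del: of_real_prod)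
  then have "(LINT x|M. exp (\<mu> * (\<Sum>k\<in>K. \<epsilon> k * (U k x)\<^sup>2))) = (\<Prod>k\<in>K. 1 / sqrt (1 - 2 * (\<mu> * \<epsilon> k)))"
    unfolding eq of_real_eq_iff S(2) .
  also have "\<dots> \<le> (\<Prod>k\<in>K. exp (\<mu> * \<epsilon> k + 4 * (\<mu> * \<epsilon> k)\<^sup>2))"
  proof (intro prod_mono conjI S(3))
    fix k
    have "2 * (\<mu> * \<epsilon> k) \<le> 1" using abs_ge_self[of "\<mu> * \<epsilon> k"] a[of k] by linarith
    then show "0 \<le> 1 / sqrt (1 - 2 * (\<mu> * \<epsilon> k))" by simp
  qed
  also have "\<dots> = exp (\<mu> * (\<Sum>k\<in>K. \<epsilon> k) + (\<Sum>k\<in>K. 4 * \<mu>\<^sup>2 * \<bar>\<epsilon> k\<bar>\<^sup>2))"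
    using K by (simp add: exp_sum[symmetric] sum.distrib sum_distrib_left power_mult_distrib mult.assoc)
  also have "\<dots> = exp (4 * \<mu>\<^sup>2 * card K)" by (simp only: \<epsilon>) (simp add: mult.commute)
  finally show "(LINT x|M. exp (\<mu> * (\<Sum>k\<in>K. \<epsilon> k * (U k x)\<^sup>2))) \<le> exp (4 * \<mu>\<^sup>2 * card K)" .
qed

lemma even_power_le_exp:
  fixes y :: real
  shows "y ^ (2 * r) \<le> fact (2 * r) * (exp y + exp (- y))"
proof -
  have "\<bar>y\<bar> ^ (2 * r) / fact (2 * r) \<le> exp \<bar>y\<bar>"
  proof -
    have s: "(\<lambda>n. \<bar>y\<bar> ^ n /\<^sub>R fact n) sums exp \<bar>y\<bar>" by (rule exp_converges)
    have "(\<Sum>n\<in>{2 * r}. \<bar>y\<bar> ^ n /\<^sub>R fact n) \<le> (\<Sum>n. \<bar>y\<bar> ^ n /\<^sub>R fact n)"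
      using s by (intro sum_le_suminf) (auto simp: sums_iff)
    then show ?thesis using s by (simp add: sums_iff divide_inverse mult.commute)
  qed
  also have "exp \<bar>y\<bar> \<le> exp y + exp (- y)" by (simp add: abs_if)
  finally show ?thesis by (simp add: power_even_abs pos_divide_le_eq mult.commute)
qed

lemma gaussian_chaos_moment:
  assumes P: "prob_space M" and K: "finite K" "K \<noteq> {}"
    and G: "gaussian_family M K U (\<lambda>k k'. if k = k' then 1 else 0)"
    and \<epsilon>: "\<And>k. \<bar>\<epsilon> k\<bar> = 1" "(\<Sum>k\<in>K. \<epsilon> k) = 0"
  shows "(\<integral>\<^sup>+ x. ennreal ((\<Sum>k\<in>K. \<epsilon> k * (U k x)\<^sup>2) ^ (2 * r)) \<partial>M) \<le> ennreal (4 * fact (2 * r) * (16 * real (card K)) ^ r)"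
proof -
  define n where "n = real (card K)"
  have n: "1 \<le> n" using K by (simp add: n_def Suc_leI card_gt_0_iff)
  \<comment> \<open>The scale at which \<open>4 * \<mu>\<^sup>2 * n\<close> equals 1/4, so that both
    exponential moments are at most exp (1/4) \<le> 2. The leading 4 of the bound is 2 + 2.\<close>
  define \<mu> where "\<mu> = 1 / (4 * sqrt n)"
  have l: "0 < \<mu>" "\<mu> \<le> 1/4" "\<mu>\<^sup>2 = 1 / (16 * n)"
    using n by (auto simp: \<mu>_def field_simps power2_eq_square)
  have al: "\<bar>\<mu>\<bar> \<le> 1/4" "\<bar>- \<mu>\<bar> \<le> 1/4" using l by auto
  define Z where "Z x = (\<Sum>k\<in>K. \<epsilon> k * (U k x)\<^sup>2)" for x
  note e1 = gaussian_chaos_exp[OF P K(1) G \<epsilon> al(1), folded Z_def n_def]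
  note e2 = gaussian_chaos_exp[OF P K(1) G \<epsilon> al(2), folded Z_def n_def]
  have "(1/4::real) \<le> ln 2" using ln2_ge_two_thirds by simp
  then have "exp (1/4::real) \<le> exp (ln 2)" by (simp only: exp_le_cancel_iff)
  then have e4: "exp (1/4::real) \<le> 2" by simp
  have "4 * \<mu>\<^sup>2 * n = 1/4" using n by (simp add: l(3))
  then have b: "(LINT x|M. exp (\<mu> * Z x)) \<le> 2" "(LINT x|M. exp (- \<mu> * Z x)) \<le> 2"
    using e1(2) e2(2) e4 by (simp_all only: power2_minus)
  have pt: "Z x ^ (2 * r) \<le> (16 * n) ^ r * fact (2 * r) * (exp (\<mu> * Z x) + exp (- \<mu> * Z x))" for x
  proof -
    have "(\<mu> * Z x) ^ (2 * r) \<le> fact (2 * r) * (exp (\<mu> * Z x) + exp (- \<mu> * Z x))"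
      using even_power_le_exp[of "\<mu> * Z x" r] by simp
    moreover have "(\<mu> * Z x) ^ (2 * r) = Z x ^ (2 * r) / (16 * n) ^ r"
      by (simp add: power_mult_distrib power_mult l(3) power_divide)
    ultimately show ?thesis using n by (simp add: pos_divide_le_eq mult_ac)
  qed
  have "(\<integral>\<^sup>+ x. ennreal (Z x ^ (2 * r)) \<partial>M)
     \<le> (\<integral>\<^sup>+ x. ennreal ((16 * n) ^ r * fact (2 * r) * (exp (\<mu> * Z x) + exp (- \<mu> * Z x))) \<partial>M)"
    by (intro nn_integral_mono ennreal_leI pt)
  also have "\<dots> = ennreal (LINT x|M. (16 * n) ^ r * fact (2 * r) * (exp (\<mu> * Z x) + exp (- \<mu> * Z x)))"
    using e1(1) e2(1) n by (intro nn_integral_eq_integral) auto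
  also have "\<dots> = ennreal ((16 * n) ^ r * fact (2 * r) * ((LINT x|M. exp (\<mu> * Z x)) + (LINT x|M. exp (- \<mu> * Z x))))"
    using e1(1) e2(1) by simp
  also have "\<dots> \<le> ennreal ((16 * n) ^ r * fact (2 * r) * 4)"
    using b n by (intro ennreal_leI mult_left_mono) auto
  finally show ?thesis by (simp add: Z_def n_def mult_ac)
qed

subsection \<open>Moment bounds for Brownian coordinates\<close>

locale brownian_coords = prob_space M for M :: "'a measure" +
  fixes B :: "nat \<Rightarrow> real \<Rightarrow> 'a \<Rightarrow> real"
  assumes brownian: "gaussian_family M (UNIV \<times> {0..1}) (\<lambda>(i, t). B i t)
    (\<lambda>(i, s) (j, t). if i = j then min s t else 0)"
begin

lemma measurable_B: "0 \<le> t \<Longrightarrow> t \<le> 1 \<Longrightarrow> B i t \<in> borel_measurable M"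
  using brownian unfolding gaussian_family_def by auto

lemma grid_increments:
  assumes h: "0 \<le> h" and \<tau>: "\<And>i. \<tau> i = s + real i * h" and s: "0 \<le> s" "s + real N * h \<le> 1"
  shows "gaussian_family M (UNIV \<times> {..<N}) (\<lambda>(j, i) x. B j (\<tau> (Suc i)) x - B j (\<tau> i) x)
    (\<lambda>(j, i) (j', i'). if j = j' \<and> i = i' then h else 0)"
proof -
  have mono: "\<tau> i \<le> \<tau> i'" if "i \<le> i'" for i i'
    using that h unfolding \<tau> by (simp add: mult_right_mono)
  have in01: "\<tau> i \<in> {0..1}" if "i \<le> N" for i
    using mono[of 0 i] mono[OF that] s by (simp add: \<tau>)
  let ?C = "\<lambda>(i, s) (j, t). if i = j then min s t else (0::real)"
  let ?\<phi> = "\<lambda>(j, i). (j, \<tau> (Suc i))" and ?\<psi> = "\<lambda>(j, i). (j, \<tau> i)"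
  show ?thesis
  proof (rule gaussian_family_cong[OF gaussian_family_combine[OF brownian, of _ ?\<phi> ?\<psi> "\<lambda>_. 1" "\<lambda>_. - 1"]])
    fix k k' :: "nat \<times> nat"
    obtain j i j' i' where k: "k = (j, i)" "k' = (j', i')" by (metis surj_pair)
    consider "i = i'" | "Suc i \<le> i'" | "Suc i' \<le> i" by linarith
    then have "min (\<tau> (Suc i)) (\<tau> (Suc i')) - min (\<tau> (Suc i)) (\<tau> i') - min (\<tau> i) (\<tau> (Suc i')) + min (\<tau> i) (\<tau> i')
        = (if i = i' then h else 0)"
    proof cases
      case 1
      then show ?thesis using mono[of i "Suc i"] by (simp add: \<tau> algebra_simps)
    next
      case 2
      then show ?thesis
        using mono[of "Suc i" i'] mono[of i' "Suc i'"] mono[of i "Suc i"] by (simp add: min_def)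
    next
      case 3
      then show ?thesis
        using mono[of "Suc i'" i] mono[of i' "Suc i'"] mono[of i "Suc i"] by (simp add: min_def)
    qed
    then show "1 * 1 * ?C (?\<phi> k) (?\<phi> k') + 1 * - 1 * ?C (?\<phi> k) (?\<psi> k') + - 1 * 1 * ?C (?\<psi> k) (?\<phi> k')
         + - 1 * - 1 * ?C (?\<psi> k) (?\<psi> k') =
        (case k of (j, i) \<Rightarrow> \<lambda>(j', i'). if j = j' \<and> i = i' then h else 0) k'"
      unfolding k prod.case by (cases "j = j'"; cases "i = i'") auto
  qed (use in01 in auto)
qed

text \<open>Each product u * v of half increments is polarised into squares of u + v and u - v. For
  j \<noteq> l the factors are uncorrelated with equal variances, so u + v and u - v are
  uncorrelated too; after normalisation the sum is a signed sum of squares over an independent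
  standard family.\<close>

lemma triangle_sum_moment:
  assumes jl: "j \<noteq> l" and n: "0 < n" and m: "0 < m" "a + m \<le> n"
  shows "(\<integral>\<^sup>+ x. ennreal ((pl_area (2 * n) (\<lambda>t. B j t x) (\<lambda>t. B l t x) (real a / real n) (real (a + m) / real n)
      - pl_area n (\<lambda>t. B j t x) (\<lambda>t. B l t x) (real a / real n) (real (a + m) / real n)) ^ (2 * r)) \<partial>M)
    \<le> ennreal (4 * fact (2 * r) * (real m / (real n)\<^sup>2) ^ r)"
  (is "(\<integral>\<^sup>+ x. ennreal (?Z x ^ _) \<partial>M) \<le> _")
proof -
  \<comment> \<open>In (i, b, \<sigma>), i is the cell, b selects one of the two products in the
    determinant, and \<sigma> is the sign in the polarisation.\<close>
  define K :: "(nat \<times> bool \<times> bool) set" where "K = {..<m} \<times> UNIV"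
  define \<tau> where "\<tau> i = real i / real (2 * n)" for i
  define D where "D k i x = B k (\<tau> (Suc i)) x - B k (\<tau> i) x" for k i x
  define sg :: "bool \<Rightarrow> real" where "sg \<sigma> = (if \<sigma> then 1 else - 1)" for \<sigma>
  define \<phi> where "\<phi> = (\<lambda>(i, b, \<sigma>::bool). (j, 2 * (a + i) + (if b then 1 else 0)))"
  define \<psi> where "\<psi> = (\<lambda>(i, b, \<sigma>::bool). (l, 2 * (a + i) + (if b then 0 else 1)))"
  \<comment> \<open>An increment over a half cell has variance 1 / (2 * n); the sum or difference of
    two independent ones has variance 1/n, normalised by \<open>sqrt n\<close>.\<close>
  define U where "U k x = sqrt n * D (fst (\<phi> k)) (snd (\<phi> k)) x + (sg (snd (snd k)) * sqrt n) * D (fst (\<psi> k)) (snd (\<psi> k)) x" for k x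
  define \<epsilon> where "\<epsilon> = (\<lambda>(i::nat, b, \<sigma>). (if b then - 1 else 1) * sg \<sigma>)"
  have K: "finite K" "K \<noteq> {}" "card K = 4 * m"
    unfolding K_def using m by (auto simp: card_cartesian_product card_UNIV_bool simp flip: UNIV_Times_UNIV)
  have inc: "gaussian_family M (UNIV \<times> {..<2 * n}) (\<lambda>(k, i) x. D k i x)
    (\<lambda>(j, i) (j', i'). if j = j' \<and> i = i' then 1 / real (2 * n) else 0)"
    unfolding D_def by (rule grid_increments[where s = 0]) (use n in \<open>auto simp: \<tau>_def\<close>)
  have G: "gaussian_family M K U (\<lambda>k k'. if k = k' then 1 else 0)"
  proof (rule gaussian_family_cong[OF gaussian_family_combine[OF inc, of K \<phi> \<psi> "\<lambda>_. sqrt n" "\<lambda>k. sg (snd (snd k)) * sqrt n"]])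
    fix k k' assume "k \<in> K" "k' \<in> K"
    obtain i b \<sigma> where k: "k = (i, b, \<sigma>)" by (metis surj_pair)
    obtain i' b' \<sigma>' where k': "k' = (i', b', \<sigma>')" by (metis surj_pair)
    have e: "2 * (a + i) + (if b then 1 else 0) = 2 * (a + i') + (if b' then 1 else (0::nat)) \<longleftrightarrow> i = i' \<and> b = b'"
      "2 * (a + i) + (if b then 0 else 1) = 2 * (a + i') + (if b' then 0 else (1::nat)) \<longleftrightarrow> i = i' \<and> b = b'"
      by (cases b; cases b'; simp; presburger)+
    let ?C = "\<lambda>(j, i) (j', i'). if j = j' \<and> i = i' then 1 / real (2 * n) else (0::real)"
    have c: "?C (\<phi> k) (\<phi> k') = (if i = i' \<and> b = b' then 1 / real (2 * n) else 0)"
      "?C (\<psi> k) (\<psi> k') = (if i = i' \<and> b = b' then 1 / real (2 * n) else 0)"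
      "?C (\<phi> k) (\<psi> k') = 0" "?C (\<psi> k) (\<phi> k') = 0"
      unfolding k k' \<phi>_def \<psi>_def prod.case e using jl by auto
    show "sqrt n * sqrt n * ?C (\<phi> k) (\<phi> k') + sqrt n * (sg (snd (snd k')) * sqrt n) * ?C (\<phi> k) (\<psi> k') +
       sg (snd (snd k)) * sqrt n * sqrt n * ?C (\<psi> k) (\<phi> k') +
       sg (snd (snd k)) * sqrt n * (sg (snd (snd k')) * sqrt n) * ?C (\<psi> k) (\<psi> k') = (if k = k' then 1 else 0)"
      unfolding c using n by (auto simp: k k' sg_def)
  qed (use m in \<open>auto simp: K_def \<phi>_def \<psi>_def U_def\<close>)
  have s0: "(\<Sum>k\<in>K. \<epsilon> k) = 0"
    unfolding K_def \<epsilon>_def by (simp flip: sum.cartesian_product UNIV_Times_UNIV add: UNIV_bool sg_def)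
  have e1: "\<bar>\<epsilon> k\<bar> = 1" for k by (cases k) (auto simp: \<epsilon>_def sg_def)
  \<comment> \<open>The 8 is 4 from the polarisation times 2 from the triangle area; n undoes the
    normalisation of \<open>U\<close>.\<close>
  have id: "?Z x
      = (\<Sum>k\<in>K. \<epsilon> k * (U k x)\<^sup>2) / (8 * real n)" for x
  proof -
    have "(\<Sum>k\<in>K. \<epsilon> k * (U k x)\<^sup>2) / (8 * real n) = (\<Sum>i<m. (\<Sum>b\<in>UNIV. \<Sum>\<sigma>\<in>UNIV. \<epsilon> (i, b, \<sigma>) * (U (i, b, \<sigma>) x)\<^sup>2) / (8 * real n))"
      unfolding K_def by (simp add: sum.cartesian_product sum_divide_distrib)
    also have "\<dots> = (\<Sum>i<m. (D j (2 * (a + i)) x * D l (Suc (2 * (a + i))) x - D j (Suc (2 * (a + i))) x * D l (2 * (a + i)) x) / 2)"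
    proof (rule sum.cong[OF refl])
      fix i
      have sq: "(sqrt n * u + sqrt n * v)\<^sup>2 = n * (u + v)\<^sup>2" "(sqrt n * u - sqrt n * v)\<^sup>2 = n * (u - v)\<^sup>2" for u v :: real
        by (simp_all add: power_mult_distrib flip: distrib_left right_diff_distrib)
      show "(\<Sum>b\<in>UNIV. \<Sum>\<sigma>\<in>UNIV. \<epsilon> (i, b, \<sigma>) * (U (i, b, \<sigma>) x)\<^sup>2) / (8 * real n)
        = (D j (2 * (a + i)) x * D l (Suc (2 * (a + i))) x - D j (Suc (2 * (a + i))) x * D l (2 * (a + i)) x) / 2"
        using n by (simp add: UNIV_bool \<epsilon>_def sg_def U_def \<phi>_def \<psi>_def sq) (simp add: field_simps power2_eq_square)
    qed
    also have "\<dots> = ?Z x"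
      unfolding pl_area_double[OF n m(2)] by (intro sum.cong refl) (simp add: D_def \<tau>_def add_ac)
    finally show ?thesis ..
  qed
  have Um: "U k \<in> borel_measurable M" if "k \<in> K" for k
    using G that unfolding gaussian_family_def by blast
  have "(\<integral>\<^sup>+ x. ennreal (((\<Sum>k\<in>K. \<epsilon> k * (U k x)\<^sup>2) / (8 * real n)) ^ (2 * r)) \<partial>M)
     = (\<integral>\<^sup>+ x. ennreal (1 / (64 * (real n)\<^sup>2) ^ r) * ennreal ((\<Sum>k\<in>K. \<epsilon> k * (U k x)\<^sup>2) ^ (2 * r)) \<partial>M)"
    by (intro nn_integral_cong) (simp add: power_divide power_mult power_mult_distrib flip: ennreal_mult)
  also have "\<dots> = ennreal (1 / (64 * (real n)\<^sup>2) ^ r) * (\<integral>\<^sup>+ x. ennreal ((\<Sum>k\<in>K. \<epsilon> k * (U k x)\<^sup>2) ^ (2 * r)) \<partial>M)"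
    using Um by (intro nn_integral_cmult) measurable
  also have "\<dots> \<le> ennreal (1 / (64 * (real n)\<^sup>2) ^ r) * ennreal (4 * fact (2 * r) * (16 * real (card K)) ^ r)"
    by (intro mult_left_mono gaussian_chaos_moment[OF prob_space_axioms K(1,2) G e1 s0]) simp
  also have "\<dots> = ennreal (1 / (64 * (real n)\<^sup>2) ^ r * (4 * fact (2 * r) * (16 * real (card K)) ^ r))"
    by (simp flip: ennreal_mult)
  also have "1 / (64 * (real n)\<^sup>2) ^ r * (4 * fact (2 * r) * (16 * real (card K)) ^ r) = 4 * fact (2 * r) * (real m / (real n)\<^sup>2) ^ r"
  proof -
    have "16 * real (card K) = 64 * real m" by (simp add: K(3))
    then have "(16 * real (card K)) ^ r = 64 ^ r * real m ^ r" by (simp only: power_mult_distrib)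
    then show ?thesis by (simp add: power_divide power_mult_distrib)
  qed
  finally show ?thesis unfolding id .
qed

section \<open>Mean square estimates for midpoint sums\<close>

lemma strat_sum_refine:
  fixes s t :: real
  assumes m: "0 < m" "0 < K"
  defines "\<tau> \<equiv> \<lambda>i. s + real i * (t - s) / real (m * K)"
  shows "strat_sum Y Z s t m x - strat_sum Y Z s t (m * K) x
    = (\<Sum>b<m * K. ((Y (\<tau> (b div K * K)) x - Y (\<tau> b) x) + (Y (\<tau> (Suc (b div K) * K)) x - Y (\<tau> (Suc b)) x)) / 2
        * (Z (\<tau> (Suc b)) x - Z (\<tau> b) x))"
proof -
  have tk: "s + real k * (t - s) / real m = \<tau> (k * K)" for k
    using m unfolding \<tau>_def by simp
  let ?F = "\<lambda>b. ((Y (\<tau> (b div K * K)) x + Y (\<tau> (Suc (b div K) * K)) x) / 2 - Y s x) * (Z (\<tau> (Suc b)) x - Z (\<tau> b) x)"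
  have "strat_sum Y Z s t m x = (\<Sum>k<m. ((Y (\<tau> (k * K)) x + Y (\<tau> (Suc k * K)) x) / 2 - Y s x)
      * (Z (\<tau> (Suc k * K)) x - Z (\<tau> (k * K)) x))"
    unfolding strat_sum_def Let_def tk ..
  \<comment> \<open>Each coarse increment of Z is telescoped over the fine points;
    \<open>b div K\<close> recovers the coarse interval that contains the fine one numbered
    b.\<close>
  also have "\<dots> = (\<Sum>k<m. \<Sum>b\<in>{k * K..<k * K + K}. ?F b)"
  proof (rule sum.cong[OF refl])
    fix k
    have "(\<Sum>b\<in>{k * K..<k * K + K}. ?F b) = (\<Sum>b\<in>{k * K..<k * K + K}.
       ((Y (\<tau> (k * K)) x + Y (\<tau> (Suc k * K)) x) / 2 - Y s x) * (Z (\<tau> (Suc b)) x - Z (\<tau> b) x))"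
    proof (rule sum.cong[OF refl])
      fix b assume "b \<in> {k * K..<k * K + K}"
      then have "b div K = k" by (intro div_nat_eqI) (auto simp: mult.commute)
      then show "?F b = ((Y (\<tau> (k * K)) x + Y (\<tau> (Suc k * K)) x) / 2 - Y s x) * (Z (\<tau> (Suc b)) x - Z (\<tau> b) x)"
        by simp
    qed
    also have "\<dots> = ((Y (\<tau> (k * K)) x + Y (\<tau> (Suc k * K)) x) / 2 - Y s x) * (Z (\<tau> (Suc k * K)) x - Z (\<tau> (k * K)) x)"
      unfolding sum_distrib_left[symmetric] by (subst sum_Suc_diff') (auto simp: add.commute)
    finally show "((Y (\<tau> (k * K)) x + Y (\<tau> (Suc k * K)) x) / 2 - Y s x) * (Z (\<tau> (Suc k * K)) x - Z (\<tau> (k * K)) x)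
      = (\<Sum>b\<in>{k * K..<k * K + K}. ?F b)" ..
  qed
  also have "\<dots> = (\<Sum>b<m * K. ?F b)" by (rule sum.nat_group)
  finally have 1: "strat_sum Y Z s t m x = (\<Sum>b<m * K. ?F b)" .
  have 2: "strat_sum Y Z s t (m * K) x = (\<Sum>b<m * K. ((Y (\<tau> b) x + Y (\<tau> (Suc b)) x) / 2 - Y s x) * (Z (\<tau> (Suc b)) x - Z (\<tau> b) x))"
    unfolding strat_sum_def Let_def \<tau>_def ..
  show ?thesis
    unfolding 1 2 sum_subtractf[symmetric] by (intro sum.cong refl) (simp add: field_simps)
qed

text \<open>By Isserlis' formula and j \<noteq> l, the only terms of the squared sum that survive
  are those in which both increments of coordinate l are over the same fine interval. Each of the N
  survivors is of order K * h * h, which totals order 1/m.\<close>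

lemma strat_sum_refine_L2:
  assumes jl: "j \<noteq> l" and m: "0 < m" "0 < K" and st: "0 \<le> s" "s \<le> t" "t \<le> 1"
  shows "(\<integral>\<^sup>+ x. ennreal ((strat_sum (B j) (B l) s t m x - strat_sum (B j) (B l) s t (m * K) x)\<^sup>2) \<partial>M) \<le> ennreal (2 / real m)"
proof -
  define N where "N = m * K"
  have N: "0 < N" using m by (simp add: N_def)
  define h where "h = (t - s) / real N"
  define \<tau> where "\<tau> i = s + real i * (t - s) / real N" for i
  have \<tau>h: "\<tau> i = s + real i * h" for i by (simp add: \<tau>_def h_def)
  have h: "0 \<le> h" "real N * h \<le> 1" using st N by (auto simp: h_def)
  have in01: "\<tau> i \<in> {0..1}" if "i \<le> N" for i
  proof -
    have "real i * h \<le> real N * h" using that h by (intro mult_right_mono) auto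
    also have "\<dots> = t - s" using N by (simp add: h_def)
    finally show ?thesis using st h by (simp add: \<tau>h)
  qed
  \<comment> \<open>Index 0 is the gap from the fine point b to the start of its block, index 1 the
    gap from \<open>Suc b\<close> to the end of the block, and index 2 the increment of coordinate
    l.\<close>
  define \<phi> :: "nat \<times> nat \<Rightarrow> nat \<times> real" where "\<phi> = (\<lambda>(\<kappa>, b). if \<kappa> = 0 then (j, \<tau> (b div K * K)) else if \<kappa> = 1 then (j, \<tau> (Suc (b div K) * K)) else (l, \<tau> (Suc b)))"
  define \<psi> :: "nat \<times> nat \<Rightarrow> nat \<times> real" where "\<psi> = (\<lambda>(\<kappa>, b). if \<kappa> = 0 then (j, \<tau> b) else if \<kappa> = 1 then (j, \<tau> (Suc b)) else (l, \<tau> b))"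
  define C0 :: "nat \<times> real \<Rightarrow> nat \<times> real \<Rightarrow> real" where "C0 = (\<lambda>(i, s) (j, t). if i = j then min s t else 0)"
  define C where "C k k' = C0 (\<phi> k) (\<phi> k') - C0 (\<phi> k) (\<psi> k') - C0 (\<psi> k) (\<phi> k') + C0 (\<psi> k) (\<psi> k')" for k k'
  define X where "X k x = (case \<phi> k of (i, u) \<Rightarrow> B i u x) - (case \<psi> k of (i, u) \<Rightarrow> B i u x)" for k x
  define I :: "(nat \<times> nat) set" where "I = UNIV \<times> {..<N}"
  have blk: "b div K * K \<le> b" "b < b div K * K + K" "Suc (b div K) * K \<le> N" if "b < N" for b
  proof -
    show "b div K * K \<le> b" by (rule div_times_less_eq_dividend)
    show "b < b div K * K + K" using dividend_less_div_times[OF m(2), of b] by simp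
    have "b div K < m" using that m by (simp add: N_def less_mult_imp_div_less)
    then show "Suc (b div K) * K \<le> N" unfolding N_def by (intro mult_le_mono1) simp
  qed
  have ph: "\<phi> k \<in> UNIV \<times> {0..1}" and ps: "\<psi> k \<in> UNIV \<times> {0..1}" if kI: "k \<in> I" for k
  proof -
    obtain \<kappa> b where k: "k = (\<kappa>, b)" "b < N" using kI unfolding I_def by (cases k) auto
    have "b div K * K \<le> N" using blk(1)[OF k(2)] k(2) by (rule order_trans[OF _ less_imp_le])
    note i = in01[OF this] in01[OF blk(3)[OF k(2)]] in01[of b] in01[of "Suc b"]
    then show "\<phi> k \<in> UNIV \<times> {0..1}" "\<psi> k \<in> UNIV \<times> {0..1}"
      using k(2) i unfolding k(1) \<phi>_def \<psi>_def by simp_all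
  qed
  have C0sym: "C0 u v = C0 v u" for u v by (auto simp: C0_def min.commute split: prod.splits)
  have G: "gaussian_family M I X C"
    by (rule gaussian_family_cong[OF gaussian_family_combine[OF brownian, of I \<phi> \<psi> "\<lambda>_. 1" "\<lambda>_. - 1", folded C0_def]])
       (use ph ps in \<open>auto simp: C_def X_def split: prod.splits\<close>)
  have sym: "C k k' = C k' k" for k k' unfolding C_def using C0sym by simp
  note iss = gaussian_family_isserlis[OF prob_space_axioms G sym]
  have C22: "C (2, b) (2, d) = (if b = d then h else 0)" for b d
  proof -
    have mono: "\<tau> i \<le> \<tau> i'" if "i \<le> i'" for i i' using that h unfolding \<tau>h by (simp add: mult_right_mono)
    consider "b = d" | "Suc b \<le> d" | "Suc d \<le> b" by linarith
    then show ?thesis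
    proof cases
      case 1
      then show ?thesis using mono[of b "Suc b"] by (simp add: C_def C0_def \<phi>_def \<psi>_def \<tau>h algebra_simps)
    next
      case 2
      then show ?thesis using mono[of "Suc b" d] mono[of b "Suc b"] mono[of d "Suc d"]
        by (simp add: C_def C0_def \<phi>_def \<psi>_def min_def)
    next
      case 3
      then show ?thesis using mono[of "Suc d" b] mono[of b "Suc b"] mono[of d "Suc d"]
        by (simp add: C_def C0_def \<phi>_def \<psi>_def min_def)
    qed
  qed
  have Cx2: "C (\<kappa>, b) (2, d) = 0" if "\<kappa> < 2" for \<kappa> b d
    using that jl by (auto simp: C_def C0_def \<phi>_def \<psi>_def)
  \<comment> \<open>Each gap spans at most K fine intervals and \<open>min\<close> is 1-Lipschitz;
    the covariance consists of two such differences, hence the factor 2.\<close>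
  have Cb: "C (\<kappa>, b) (\<kappa>', b) \<le> 2 * real K * h" if "\<kappa> < 2" "\<kappa>' < 2" "b < N" for \<kappa> \<kappa>' b
  proof -
    have lip: "\<bar>min u z - min v z\<bar> \<le> \<bar>u - v\<bar>" for u v z :: real by (auto simp: min_def)
    have d: "\<bar>\<tau> i - \<tau> i'\<bar> \<le> real K * h" if "i \<le> i' + K" "i' \<le> i + K" for i i'
    proof -
      have "\<tau> i - \<tau> i' = (real i - real i') * h" by (simp add: \<tau>h left_diff_distrib)
      moreover have "\<bar>real i - real i'\<bar> \<le> real K" using that by linarith
      ultimately show ?thesis using h by (simp add: abs_mult mult_right_mono)
    qed
    have le: "b div K * K \<le> b + K" "b \<le> b div K * K + K" "Suc (b div K) * K \<le> Suc b + K" "Suc b \<le> Suc (b div K) * K + K"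
      using blk(1,2)[OF that(3)] by (simp_all only: mult_Suc)
    note d[OF le(1,2)] d[OF le(3,4)]
    then have g: "\<bar>snd (\<phi> (\<kappa>, b)) - snd (\<psi> (\<kappa>, b))\<bar> \<le> real K * h"
      using that unfolding \<phi>_def \<psi>_def by (auto simp del: mult_Suc)
    have f: "fst (\<phi> (\<kappa>, b)) = j" "fst (\<psi> (\<kappa>, b)) = j" "fst (\<phi> (\<kappa>', b)) = j" "fst (\<psi> (\<kappa>', b)) = j"
      using that unfolding \<phi>_def \<psi>_def by auto
    have "C (\<kappa>, b) (\<kappa>', b) = (min (snd (\<phi> (\<kappa>, b))) (snd (\<phi> (\<kappa>', b))) - min (snd (\<psi> (\<kappa>, b))) (snd (\<phi> (\<kappa>', b))))
      - (min (snd (\<phi> (\<kappa>, b))) (snd (\<psi> (\<kappa>', b))) - min (snd (\<psi> (\<kappa>, b))) (snd (\<psi> (\<kappa>', b))))"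
      unfolding C_def C0_def using f by (simp add: case_prod_beta)
    also have "\<dots> \<le> 2 * real K * h"
      using lip[of "snd (\<phi> (\<kappa>, b))" "snd (\<phi> (\<kappa>', b))" "snd (\<psi> (\<kappa>, b))"]
        lip[of "snd (\<phi> (\<kappa>, b))" "snd (\<psi> (\<kappa>', b))" "snd (\<psi> (\<kappa>, b))"] g unfolding abs_le_iff by linarith
    finally show ?thesis .
  qed
  define R where "R x = (\<Sum>b<N. (X (0, b) x + X (1, b) x) / 2 * X (2, b) x)" for x
  have R: "strat_sum (B j) (B l) s t m x - strat_sum (B j) (B l) s t (m * K) x = R x" for x
    unfolding strat_sum_refine[OF m] R_def
    by (intro sum.cong) (simp_all add: X_def \<phi>_def \<psi>_def \<tau>_def N_def)
  define W where "W \<kappa> \<kappa>' b d x = X (\<kappa>, b) x * X (\<kappa>', d) x * X (2, b) x * X (2, d) x" for \<kappa> \<kappa>' b d x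
  have R2: "(R x)\<^sup>2 = (\<Sum>b<N. \<Sum>d<N. \<Sum>\<kappa><2. \<Sum>\<kappa>'<2. W \<kappa> \<kappa>' b d x) / 4" for x
    unfolding R_def power2_eq_square sum_product sum_divide_distrib
    by (intro sum.cong refl) (simp add: W_def numeral_2_eq_2 field_simps)
  have ii: "integrable M (W \<kappa> \<kappa>' b d)" if "b < N" "d < N" for \<kappa> \<kappa>' b d
    using that unfolding W_def by (intro iss(1)) (auto simp: I_def)
  have ev: "(LINT x|M. W \<kappa> \<kappa>' b d x) = C (\<kappa>, b) (\<kappa>', d) * C (2, b) (2, d)"
    if "b < N" "d < N" "\<kappa> < 2" "\<kappa>' < 2" for \<kappa> \<kappa>' b d
    using that unfolding W_def by (subst iss(2)) (auto simp: I_def Cx2)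
  have iR: "integrable M (\<lambda>x. (R x)\<^sup>2)"
    unfolding R2 by (intro integrable_divide Bochner_Integration.integrable_sum ii) auto
  have "(LINT x|M. (R x)\<^sup>2) = (\<Sum>b<N. \<Sum>d<N. \<Sum>\<kappa><2. \<Sum>\<kappa>'<2. C (\<kappa>, b) (\<kappa>', d) * C (2, b) (2, d)) / 4"
  proof -
    have "has_bochner_integral M (W \<kappa> \<kappa>' b d) (C (\<kappa>, b) (\<kappa>', d) * C (2, b) (2, d))"
      if "b < N" "d < N" "\<kappa> < 2" "\<kappa>' < 2" for \<kappa> \<kappa>' b d
      using ii[OF that(1,2)] ev[OF that] by (simp add: has_bochner_integral_iff)
    then have "has_bochner_integral M (\<lambda>x. \<Sum>b<N. \<Sum>d<N. \<Sum>\<kappa><2. \<Sum>\<kappa>'<2. W \<kappa> \<kappa>' b d x)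
       (\<Sum>b<N. \<Sum>d<N. \<Sum>\<kappa><2. \<Sum>\<kappa>'<2. C (\<kappa>, b) (\<kappa>', d) * C (2, b) (2, d))"
      by (intro has_bochner_integral_sum) auto
    then show ?thesis unfolding R2 by (simp add: has_bochner_integral_iff)
  qed
  also have "\<dots> = (\<Sum>b<N. \<Sum>\<kappa><2. \<Sum>\<kappa>'<2. C (\<kappa>, b) (\<kappa>', b) * h) / 4"
  proof -
    have "(\<Sum>d<N. \<Sum>\<kappa><2. \<Sum>\<kappa>'<2. C (\<kappa>, b) (\<kappa>', d) * C (2, b) (2, d)) = (\<Sum>\<kappa><2. \<Sum>\<kappa>'<2. C (\<kappa>, b) (\<kappa>', b) * h)"
      if "b < N" for b
      using that by (subst sum.remove[of _ b]) (auto simp: C22 intro!: sum.neutral)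
    then show ?thesis by simp
  qed
  \<comment> \<open>The four pairs of indices make up for the denominator 4, which leaves
    \<open>2 * real K * h * h\<close> for each of the N fine intervals.\<close>
  also have "\<dots> \<le> (\<Sum>b<N. \<Sum>\<kappa><(2::nat). \<Sum>\<kappa>'<(2::nat). 2 * real K * h * h) / 4"
    using h by (intro divide_right_mono sum_mono mult_right_mono Cb) auto
  also have "\<dots> = 2 * (real N * h)\<^sup>2 * (real K / real N)"
    using N by (simp add: power2_eq_square field_simps)
  also have "\<dots> \<le> 2 * 1 * (real K / real N)"
    using h by (intro mult_right_mono mult_left_mono) (auto simp: power_le_one)
  also have "\<dots> = 2 / real m" using m by (simp add: N_def)
  finally have "(LINT x|M. (R x)\<^sup>2) \<le> 2 / real m" .
  then show ?thesis
    unfolding R using iR by (subst nn_integral_eq_integral) (auto intro: ennreal_leI)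
qed

end

subsection \<open>Almost sure bounds on all grids\<close>

lemma pl_area_double_scale:
  fixes a b n :: nat
  assumes "0 < n" "a \<le> b" "b \<le> n"
  shows "pl_area (2 * n) (\<lambda>t. c * f t) (\<lambda>t. d * g t) (real a / real n) (real b / real n)
      - pl_area n (\<lambda>t. c * f t) (\<lambda>t. d * g t) (real a / real n) (real b / real n)
    = c * d * (pl_area (2 * n) f g (real a / real n) (real b / real n) - pl_area n f g (real a / real n) (real b / real n))"
proof -
  obtain m where b: "b = a + m" using assms(2) le_Suc_ex by blast
  show ?thesis
    using assms unfolding b
    by (simp only: pl_area_double sum_distrib_left Let_def) (simp add: field_simps)
qed

text \<open>A path with two equal coordinates runs along a line, so every triangle is degenerate.
  This settles the case j = l, which the Gaussian estimate excludes.\<close>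

lemma pl_area_double_diag:
  fixes a b n :: nat
  assumes "0 < n" "a \<le> b" "b \<le> n"
  shows "pl_area (2 * n) f f (real a / real n) (real b / real n) - pl_area n f f (real a / real n) (real b / real n) = 0"
proof -
  obtain m where b: "b = a + m" using assms(2) le_Suc_ex by blast
  show ?thesis
    using assms unfolding b by (simp only: pl_area_double Let_def) simp
qed

lemma strat_sum_scale:
  "strat_sum (\<lambda>r x. c * Y r x) (\<lambda>r x. d * Z r x) s t m x = c * d * strat_sum Y Z s t m x"
  unfolding strat_sum_def Let_def sum_distrib_left by (intro sum.cong refl) (simp add: field_simps)

text \<open>Every summand is half a difference of squares, so the sum telescopes to a value
  independent of m. This settles j = l in the mean square comparison.\<close>

lemma strat_sum_diag:
  assumes "0 < m"
  shows "strat_sum Y Y s t m x = (Y t x - Y s x)\<^sup>2 / 2"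
proof -
  let ?\<tau> = "\<lambda>k. s + real k * (t - s) / real m"
  have "strat_sum Y Y s t m x = (\<Sum>k<m. (Y (?\<tau> (Suc k)) x - Y s x)\<^sup>2 / 2 - (Y (?\<tau> k) x - Y s x)\<^sup>2 / 2)"
    unfolding strat_sum_def Let_def by (intro sum.cong refl) (simp add: power2_eq_square field_simps)
  also have "\<dots> = (Y (?\<tau> m) x - Y s x)\<^sup>2 / 2 - (Y (?\<tau> 0) x - Y s x)\<^sup>2 / 2"
    by (rule sum_lessThan_telescope)
  finally show ?thesis using assms by simp
qed

section \<open>The Q-Wiener process in coordinates\<close>

locale q_wiener_basis =
  fixes M :: "'a measure" and e :: "nat \<Rightarrow> 'v::{real_inner,complete_space}"
    and q :: "nat \<Rightarrow> real" and \<beta> :: real and \<omega> :: "real \<Rightarrow> 'a \<Rightarrow> 'v"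
  assumes prob: "prob_space M" and basis: "orthonormal_basis e"
    and \<beta>: "1/4 < \<beta>" "\<beta> < 1/2" and q: "\<And>i. 0 < q i" "summable q"
    and wiener: "q_wiener M e q \<omega>"
begin

text \<open>Half the distance from \<beta> to 1/2: then \<gamma> is still an admissible Hoelder
  exponent, and the same \<theta> leaves room in the moment bounds, where
  \<open>4 * \<beta> - 2\<close> becomes \<open>- (8 * \<theta>)\<close>.\<close>

definition "\<theta> = (1/2 - \<beta>) / 2"
definition "\<gamma> = \<beta> + \<theta>"
definition "coord i t x = (e i \<bullet> \<omega> t x) / sqrt (q i)"

lemma theta: "0 < \<theta>" "\<gamma> < 1/2" "0 < \<gamma>" "4 * \<beta> - 2 = - (8 * \<theta>)"
  using \<beta> by (auto simp: \<theta>_def \<gamma>_def field_simps)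

lemma on: "e i \<bullet> e j = (if i = j then 1 else 0)"
  using basis unfolding orthonormal_basis_def by blast

sublocale brownian_coords M coord
proof (intro brownian_coords.intro brownian_coords_axioms.intro prob)
  have "gaussian_family M (UNIV \<times> {0..1}) (\<lambda>(i,t) x. (e i \<bullet> \<omega> t x) / sqrt (q i))
        (\<lambda>(i,s) (j,t). if i = j then min s t else 0)"
    using wiener unfolding q_wiener_def by blast
  then show "gaussian_family M (UNIV \<times> {0..1}) (\<lambda>(i, t). coord i t) (\<lambda>(i, s) (j, t). if i = j then min s t else 0)"
    by (rule gaussian_family_cong) (auto simp: coord_def)
qed

lemma coord: "e i \<bullet> \<omega> t x = sqrt (q i) * coord i t x"
  using q(1)[of i] by (simp add: coord_def)

lemma holder_path_ex:
  assumes "x \<in> space M"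
  shows "\<exists>C. holder_path e (\<lambda>r. \<omega> r x) C \<beta> \<theta> \<gamma>"
proof -
  obtain C where C: "\<forall>s\<in>{0..1}. \<forall>t\<in>{0..1}. norm (\<omega> t x - \<omega> s x) \<le> C * \<bar>t - s\<bar> powr \<gamma>"
    using wiener assms theta unfolding q_wiener_def by blast
  have "holder_path e (\<lambda>r. \<omega> r x) \<bar>C\<bar> \<beta> \<theta> \<gamma>"
  proof
    show "norm (\<omega> t x - \<omega> s x) \<le> \<bar>C\<bar> * (t - s) powr \<gamma>" if "0 \<le> s" "s \<le> t" "t \<le> 1" for s t
    proof -
      have "norm (\<omega> t x - \<omega> s x) \<le> C * (t - s) powr \<gamma>" using C[rule_format, of s t] that by simp
      also have "\<dots> \<le> \<bar>C\<bar> * (t - s) powr \<gamma>" by (intro mult_right_mono) auto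
      finally show ?thesis .
    qed
  qed (use theta \<beta> on in \<open>auto simp: \<gamma>_def\<close>)
  then show ?thesis ..
qed

section \<open>Changes of the area between successive grids\<close>

definition area :: "nat \<Rightarrow> nat \<Rightarrow> nat \<Rightarrow> real \<Rightarrow> real \<Rightarrow> 'a \<Rightarrow> real" where
  "area n j l s t x = path_area e (\<lambda>r. \<omega> r x) n j l s t"

definition incr :: "nat \<Rightarrow> nat \<Rightarrow> nat \<Rightarrow> nat \<Rightarrow> nat \<Rightarrow> 'a \<Rightarrow> real" where
  "incr n j l a b x = pl_area (2 * n) (\<lambda>t. coord j t x) (\<lambda>t. coord l t x) (real a / real n) (real b / real n)
    - pl_area n (\<lambda>t. coord j t x) (\<lambda>t. coord l t x) (real a / real n) (real b / real n)"

lemma area_incr: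
  assumes "0 < n" "a \<le> b" "b \<le> n"
  shows "area (2 * n) j l (real a / real n) (real b / real n) x - area n j l (real a / real n) (real b / real n) x
    = sqrt (q j) * sqrt (q l) * incr n j l a b x"
  unfolding area_def path_area_def coord incr_def by (rule pl_area_double_scale[OF assms])

lemma measurable_incr:
  assumes "0 < n" "a \<le> b" "b \<le> n"
  shows "incr n j l a b \<in> borel_measurable M"
proof -
  obtain m where b: "b = a + m" using assms(2) le_Suc_ex by blast
  have "coord k (real i / real (2 * n)) \<in> borel_measurable M" if "i \<le> 2 * n" for k i
    using that assms(1) by (intro measurable_B) auto
  then show ?thesis
    unfolding incr_def b pl_area_double[OF assms(1) assms(3)[unfolded b]] Let_def
    using assms(3) b by (intro borel_measurable_sum borel_measurable_divide borel_measurable_diff borel_measurable_times borel_measurable_const) (auto simp del: of_nat_Suc of_nat_add of_nat_mult)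
qed

lemma incr_moment:
  assumes n: "0 < n" "a < b" "b \<le> n" and r: "0 < r"
  shows "(\<integral>\<^sup>+ x. ennreal (incr n j l a b x ^ (2 * r)) \<partial>M) \<le> ennreal (4 * fact (2 * r) * (real (b - a) / (real n)\<^sup>2) ^ r)"
proof (cases "j = l")
  case True
  then have "incr n j l a b x = 0" for x
    unfolding incr_def using pl_area_double_diag[of n a b] n by simp
  then show ?thesis using r by (simp add: zero_power)
next
  case False
  then show ?thesis
    using triangle_sum_moment[of j l n "b - a" a r] n unfolding incr_def by simp
qed

text \<open>The squared increment divided by the square of the bound aimed at,
  \<open>n powr (- \<theta>)\<close> times the \<open>2 * \<beta>\<close> power of the length. The
  grid estimate amounts to bounding weighted sums of this quantity.\<close>

definition scaled :: "nat \<Rightarrow> nat \<Rightarrow> nat \<Rightarrow> nat \<Rightarrow> nat \<Rightarrow> 'a \<Rightarrow> real" where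
  "scaled n j l a b x = real n powr (2 * \<theta>) * (incr n j l a b x)\<^sup>2 / (real (b - a) / real n) powr (4 * \<beta>)"

lemma scaled_moment:
  assumes n: "0 < n" "a < b" "b \<le> n" and r: "0 < r"
  shows "(\<integral>\<^sup>+ x. ennreal (scaled n j l a b x ^ r) \<partial>M) \<le> ennreal (4 * fact (2 * r) * (real n powr (- (6 * \<theta>))) ^ r)"
proof -
  define \<rho> where "\<rho> = real (b - a) / real n"
  have \<rho>: "1 / real n \<le> \<rho>" "0 < \<rho>" unfolding \<rho>_def using n by (auto simp: divide_right_mono)
  define c where "c = real n powr (2 * \<theta>) / \<rho> powr (4 * \<beta>)"
  have c: "0 \<le> c" by (simp add: c_def)
  note [measurable] = measurable_incr[OF n(1) less_imp_le[OF n(2)] n(3)]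
  have "(\<integral>\<^sup>+ x. ennreal (scaled n j l a b x ^ r) \<partial>M) = (\<integral>\<^sup>+ x. ennreal (c ^ r) * ennreal (incr n j l a b x ^ (2 * r)) \<partial>M)"
    using c by (intro nn_integral_cong)
      (simp add: scaled_def c_def \<rho>_def power_mult power_mult_distrib power_divide flip: ennreal_mult)
  also have "\<dots> = ennreal (c ^ r) * (\<integral>\<^sup>+ x. ennreal (incr n j l a b x ^ (2 * r)) \<partial>M)"
    by (intro nn_integral_cmult) measurable
  also have "\<dots> \<le> ennreal (c ^ r) * ennreal (4 * fact (2 * r) * (real (b - a) / (real n)\<^sup>2) ^ r)"
    by (intro mult_left_mono incr_moment n r) simp
  also have "\<dots> = ennreal (4 * fact (2 * r) * (c * (real (b - a) / (real n)\<^sup>2)) ^ r)"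
  proof -
    have "c ^ r * (4 * fact (2 * r) * (real (b - a) / (real n)\<^sup>2) ^ r) = 4 * fact (2 * r) * (c * (real (b - a) / (real n)\<^sup>2)) ^ r"
      by (simp only: power_mult_distrib mult_ac)
    then show ?thesis using c by (simp flip: ennreal_mult)
  qed
  also have "\<dots> \<le> ennreal (4 * fact (2 * r) * (real n powr (- (6 * \<theta>))) ^ r)"
  proof (intro ennreal_leI mult_left_mono power_mono)
    have "c * (real (b - a) / (real n)\<^sup>2) = real n powr (2 * \<theta>) * (\<rho> powr (1 - 4 * \<beta>) / real n)"
      unfolding c_def using \<rho> n by (simp add: powr_diff \<rho>_def power2_eq_square)
    \<comment> \<open>As \<beta> > 1/4, the exponent \<open>1 - 4 * \<beta>\<close> is negative, so
      the shortest possible interval, of length 1/n, is the worst case.\<close>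
    also have "\<dots> \<le> real n powr (2 * \<theta>) * ((1 / real n) powr (1 - 4 * \<beta>) / real n)"
      using \<rho> n \<beta> by (intro mult_left_mono divide_right_mono powr_mono2') auto
    also have "\<dots> = real n powr (2 * \<theta> + (4 * \<beta> - 2))"
    proof -
      have "(1 / real n) powr (1 - 4 * \<beta>) / real n = real n powr (4 * \<beta> - 1) * real n powr (- 1)"
        using n by (simp add: powr_divide powr_minus_divide powr_diff)
      also have "\<dots> = real n powr (4 * \<beta> - 2)" by (simp only: powr_add[symmetric]) simp
      finally show ?thesis by (simp add: powr_add)
    qed
    also have "2 * \<theta> + (4 * \<beta> - 2) = - (6 * \<theta>)" using theta(4) by simp
    finally show "c * (real (b - a) / (real n)\<^sup>2) \<le> real n powr (- (6 * \<theta>))" .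
  qed (use c in auto)
  finally show ?thesis .
qed

text \<open>At this power the moments are at most of order \<open>n powr (- 4)\<close>; summed over
  fewer than about n * n pairs of nodes they leave the summable order
  \<open>n powr (- 2)\<close>.\<close>

definition "rexp = Suc (nat \<lceil>4 / (6 * \<theta>)\<rceil>)"

lemma rexp: "0 < rexp" "4 \<le> 6 * \<theta> * real rexp"
proof -
  have "4 / (6 * \<theta>) \<le> real rexp" unfolding rexp_def by linarith
  then show "4 \<le> 6 * \<theta> * real rexp" using theta by (simp add: field_simps)
qed (simp add: rexp_def)

text \<open>One variable that dominates all grids, pairs of nodes and coordinates, so that a single
  almost sure event suffices. It is extended-valued, which lets it be integrated before it is known
  to converge; \<open>Suc n\<close> skips the empty grid.\<close>

definition total :: "'a \<Rightarrow> ennreal" where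
  "total x = (\<Sum>n. \<Sum>j. \<Sum>l. ennreal (q j) * (ennreal (q l) *
     (\<Sum>a\<in>{..<Suc n}. \<Sum>b\<in>{a<..Suc n}. ennreal (scaled (Suc n) j l a b x ^ rexp))))"

lemma scaled_nonneg: "0 \<le> scaled n j l a b x"
  by (simp add: scaled_def)

lemma measurable_scaled: "0 < n \<Longrightarrow> a < b \<Longrightarrow> b \<le> n \<Longrightarrow> scaled n j l a b \<in> borel_measurable M"
  using measurable_incr[of n a b j l] unfolding scaled_def by measurable

lemma total_finite: "AE x in M. total x \<noteq> \<infinity>"
proof (rule nn_integral_PInf_AE)
  define G where "G n j l x = (\<Sum>a\<in>{..<Suc n}. \<Sum>b\<in>{a<..Suc n}. ennreal (scaled (Suc n) j l a b x ^ rexp))" for n j l x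
  have [measurable]: "G n j l \<in> borel_measurable M" for n j l
    unfolding G_def
    using measurable_scaled[of "Suc n"]
    by (intro borel_measurable_sum measurable_compose[OF _ measurable_ennreal] borel_measurable_power) auto
  show "total \<in> borel_measurable M" unfolding total_def G_def[symmetric] by measurable
  define c where "c = 4 * fact (2 * rexp) * (1::real)"
  have c: "0 \<le> c" by (simp add: c_def)
  have inner: "(\<integral>\<^sup>+ x. G n j l x \<partial>M) \<le> ennreal (c * (1 / (real (Suc n))\<^sup>2))"
    for n j l
  proof -
    have mi: "(\<lambda>x. ennreal (scaled (Suc n) j l a b x ^ rexp)) \<in> borel_measurable M" if "a \<in> {..<Suc n}" "b \<in> {a<..Suc n}" for a b
      using measurable_scaled[of "Suc n" a b j l] that by (intro measurable_compose[OF _ measurable_ennreal] borel_measurable_power) auto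
    have "(\<integral>\<^sup>+ x. G n j l x \<partial>M) = (\<Sum>a\<in>{..<Suc n}. \<integral>\<^sup>+ x. (\<Sum>b\<in>{a<..Suc n}. ennreal (scaled (Suc n) j l a b x ^ rexp)) \<partial>M)"
      unfolding G_def by (intro nn_integral_sum borel_measurable_sum mi)
    also have "\<dots> = (\<Sum>a\<in>{..<Suc n}. \<Sum>b\<in>{a<..Suc n}. \<integral>\<^sup>+ x. ennreal (scaled (Suc n) j l a b x ^ rexp) \<partial>M)"
      by (intro sum.cong nn_integral_sum mi refl)
    also have "\<dots> \<le> (\<Sum>a\<in>{..<Suc n}. \<Sum>b\<in>{a<..Suc n}. ennreal (c * (real (Suc n) powr (- (6 * \<theta>))) ^ rexp))"
      unfolding c_def mult_1_right by (intro sum_mono scaled_moment rexp) auto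
    also have "\<dots> \<le> (\<Sum>a\<in>{..<Suc n}. \<Sum>b\<in>{1..Suc n}. ennreal (c * (real (Suc n) powr (- (6 * \<theta>))) ^ rexp))"
      by (intro sum_mono sum_mono2) auto
    also have "\<dots> = ennreal (real (Suc n) * (real (Suc n) * (c * (real (Suc n) powr (- (6 * \<theta>))) ^ rexp)))"
      using c by (simp only: sum_constant card_lessThan card_atLeastAtMost diff_Suc_1 ennreal_of_nat_eq_real_of_nat)
        (simp only: ennreal_mult[symmetric] of_nat_0_le_iff mult_nonneg_nonneg zero_le_power powr_ge_zero)
    also have "\<dots> \<le> ennreal (c * (1 / (real (Suc n))\<^sup>2))"
    proof (rule ennreal_leI)
      have "(real (Suc n) powr (- (6 * \<theta>))) ^ rexp = real (Suc n) powr (- (6 * \<theta>) * real rexp)"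
        by (simp only: powr_powr[symmetric] powr_realpow powr_gt_zero of_nat_0_less_iff zero_less_Suc)
      also have "\<dots> \<le> real (Suc n) powr (- 4)"
        using rexp(2) by (intro powr_mono) auto
      also have "\<dots> = 1 / real (Suc n) ^ 4"
        using powr_realpow[of "real (Suc n)" 4] by (simp add: powr_minus_divide)
      finally have "(real (Suc n) powr (- (6 * \<theta>))) ^ rexp \<le> 1 / real (Suc n) ^ 4" .
      then have "real (Suc n) * (real (Suc n) * (c * (real (Suc n) powr (- (6 * \<theta>))) ^ rexp))
        \<le> real (Suc n) * (real (Suc n) * (c * (1 / real (Suc n) ^ 4)))"
        using c by (intro mult_left_mono) auto
      also have "\<dots> = c * (1 / (real (Suc n))\<^sup>2)"
        by (simp add: power2_eq_square power4_eq_xxxx del: of_nat_Suc)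
      finally show "real (Suc n) * (real (Suc n) * (c * (real (Suc n) powr (- (6 * \<theta>))) ^ rexp)) \<le> c * (1 / (real (Suc n))\<^sup>2)" .
    qed
    finally show ?thesis .
  qed
  have sq: "summable (\<lambda>n. c * (1 / (real (Suc n))\<^sup>2))"
    using inverse_squares_sums by (intro summable_mult) (simp add: sums_iff)
  have "(\<integral>\<^sup>+ x. total x \<partial>M) = (\<Sum>n. \<Sum>j. \<Sum>l. ennreal (q j) * (ennreal (q l) * (\<integral>\<^sup>+ x. G n j l x \<partial>M)))"
    unfolding total_def G_def[symmetric] by (simp add: nn_integral_suminf nn_integral_cmult)
  also have "\<dots> \<le> (\<Sum>n. \<Sum>j. \<Sum>l. ennreal (q j) * (ennreal (q l) * ennreal (c * (1 / (real (Suc n))\<^sup>2))))"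
    by (intro suminf_le mult_left_mono inner summableI allI) auto
  \<comment> \<open>The sum factors into the squared trace of Q and a convergent series in
    n.\<close>
  also have "\<dots> = (\<Sum>j. ennreal (q j)) * ((\<Sum>l. ennreal (q l)) * (\<Sum>n. ennreal (c * (1 / (real (Suc n))\<^sup>2))))"
    by (simp only: ennreal_suminf_cmult ennreal_suminf_multc)
  also have "\<dots> < \<infinity>"
  proof -
    have "(\<Sum>n. ennreal (c * (1 / (real (Suc n))\<^sup>2))) = ennreal (\<Sum>n. c * (1 / (real (Suc n))\<^sup>2))"
      using c by (intro suminf_ennreal2 sq) simp
    moreover have "(\<Sum>j. ennreal (q j)) = ennreal (suminf q)"
      using q by (intro suminf_ennreal2) (auto simp: less_imp_le)
    ultimately show ?thesis by (simp only: ennreal_mult_less_top ennreal_less_top infinity_ennreal_def simp_thms)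
  qed
  finally show "(\<integral>\<^sup>+ x. total x \<partial>M) \<noteq> \<infinity>" by simp
qed

definition "qsum = suminf q"

lemma sum_q_le: "(\<Sum>j<N. q j) \<le> qsum" "0 \<le> qsum"
  unfolding qsum_def using q by (auto intro!: sum_le_suminf suminf_nonneg simp: less_imp_le)

lemma sum_scaled_le:
  assumes "total x \<noteq> \<infinity>" "0 < n" "a < b" "b \<le> n"
  shows "(\<Sum>j<N. \<Sum>l<N. q j * q l * scaled n j l a b x ^ rexp) \<le> enn2real (total x)"
proof -
  obtain n' where n: "n = Suc n'" using assms gr0_implies_Suc by blast
  let ?g = "\<lambda>n j l. \<Sum>a\<in>{..<Suc n}. \<Sum>b\<in>{a<..Suc n}. ennreal (scaled (Suc n) j l a b x ^ rexp)"
  have "ennreal (scaled n j l a b x ^ rexp) \<le> ?g n' j l" for j l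
  proof -
    have "ennreal (scaled n j l a b x ^ rexp) \<le> (\<Sum>b\<in>{a<..Suc n'}. ennreal (scaled (Suc n') j l a b x ^ rexp))"
      using assms n member_le_sum[of b "{a<..Suc n'}" "\<lambda>b. ennreal (scaled (Suc n') j l a b x ^ rexp)"] by auto
    also have "\<dots> \<le> ?g n' j l"
      using assms n member_le_sum[of a "{..<Suc n'}" "\<lambda>a. \<Sum>b\<in>{a<..Suc n'}. ennreal (scaled (Suc n') j l a b x ^ rexp)"] by auto
    finally show ?thesis .
  qed
  then have "(\<Sum>j<N. \<Sum>l<N. ennreal (q j) * (ennreal (q l) * ennreal (scaled n j l a b x ^ rexp)))
    \<le> (\<Sum>j<N. \<Sum>l<N. ennreal (q j) * (ennreal (q l) * ?g n' j l))"
    by (intro sum_mono mult_left_mono) auto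
  also have "\<dots> \<le> (\<Sum>j. \<Sum>l. ennreal (q j) * (ennreal (q l) * ?g n' j l))"
    by (intro order_trans[OF sum_mono sum_le_suminf] sum_le_suminf summableI) auto
  also have "\<dots> \<le> total x"
    unfolding total_def
    using sum_le_suminf[OF summableI, of "{n'}" "\<lambda>n. \<Sum>j. \<Sum>l. ennreal (q j) * (ennreal (q l) * ?g n j l)"] by simp
  also have "(\<Sum>j<N. \<Sum>l<N. ennreal (q j) * (ennreal (q l) * ennreal (scaled n j l a b x ^ rexp)))
    = ennreal (\<Sum>j<N. \<Sum>l<N. q j * q l * scaled n j l a b x ^ rexp)"
    using q scaled_nonneg by (simp add: less_imp_le sum_nonneg mult.assoc flip: ennreal_mult)
  also have "total x = ennreal (enn2real (total x))" using assms(1) by (simp add: less_top)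
  finally show ?thesis by (simp add: ennreal_le_iff)
qed

text \<open>The power \<open>rexp\<close> is removed through \<open>z \<le> 1 + z ^ rexp\<close>.
  Against the weights \<open>q j * q l\<close> the 1 costs the squared trace of Q and the power
  costs \<open>total\<close>, which explains the constant under the root.\<close>

lemma grid_bound:
  assumes "total x \<noteq> \<infinity>" and n: "0 < n" "a < b" "b \<le> n"
  shows "hs_bound (\<lambda>j l. area (2 * n) j l (real a / real n) (real b / real n) x - area n j l (real a / real n) (real b / real n) x)
    (sqrt (qsum\<^sup>2 + enn2real (total x)) * real n powr (- \<theta>) * (real b / real n - real a / real n) powr (2 * \<beta>))"
proof (rule hs_boundI)
  define \<rho> where "\<rho> = real (b - a) / real n"
  have \<rho>: "0 < \<rho>" "real b / real n - real a / real n = \<rho>"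
    unfolding \<rho>_def using n by (simp, simp add: of_nat_diff diff_divide_distrib)
  define R where "R = qsum\<^sup>2 + enn2real (total x)"
  have R: "0 \<le> R" by (simp add: R_def)
  show "0 \<le> sqrt (qsum\<^sup>2 + enn2real (total x)) * real n powr (- \<theta>) * (real b / real n - real a / real n) powr (2 * \<beta>)"
    by simp
  fix N
  define k where "k = real n powr (- (2 * \<theta>)) * \<rho> powr (4 * \<beta>)"
  have k: "0 \<le> k" by (simp add: k_def)
  have sq: "(sqrt (q j) * sqrt (q l) * incr n j l a b x)\<^sup>2 \<le> k * (q j * q l * (1 + scaled n j l a b x ^ rexp))" for j l
  proof -
    let ?z = "scaled n j l a b x"
    have z: "?z \<le> 1 + ?z ^ rexp"
    proof (cases "?z \<le> 1")
      case True
      then show ?thesis using scaled_nonneg[of n j l a b x] by (simp add: add_increasing2)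
    next
      case False
      then have "?z ^ 1 \<le> ?z ^ rexp" using rexp by (intro power_increasing) auto
      then show ?thesis by simp
    qed
    have "(incr n j l a b x)\<^sup>2 = k * ?z"
      unfolding k_def scaled_def \<rho>_def[symmetric] using n \<rho> by (simp add: powr_minus)
    then have "(sqrt (q j) * sqrt (q l) * incr n j l a b x)\<^sup>2 = k * (q j * q l * ?z)"
      using q(1)[of j] q(1)[of l] by (simp add: power_mult_distrib)
    also have "\<dots> \<le> k * (q j * q l * (1 + ?z ^ rexp))"
      using z k q(1)[of j] q(1)[of l] by (intro mult_left_mono) auto
    finally show ?thesis .
  qed
  have "(\<Sum>j<N. \<Sum>l<N. (sqrt (q j) * sqrt (q l) * incr n j l a b x)\<^sup>2)
    \<le> (\<Sum>j<N. \<Sum>l<N. k * (q j * q l * (1 + scaled n j l a b x ^ rexp)))"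
    by (intro sum_mono sq)
  also have "\<dots> = k * ((\<Sum>j<N. q j) * (\<Sum>l<N. q l) + (\<Sum>j<N. \<Sum>l<N. q j * q l * scaled n j l a b x ^ rexp))"
    unfolding sum_product by (simp add: sum_distrib_left distrib_left sum.distrib)
  also have "\<dots> \<le> k * (qsum * qsum + enn2real (total x))"
    using k sum_q_le q by (intro mult_left_mono add_mono mult_mono sum_scaled_le assms) (auto intro!: sum_nonneg simp: less_imp_le)
  also have "\<dots> = (sqrt R * real n powr (- \<theta>) * \<rho> powr (2 * \<beta>))\<^sup>2"
  proof -
    have "(u powr v)\<^sup>2 = u powr (2 * v)" for u v :: real
      unfolding power2_eq_square by (simp flip: powr_add)
    then show ?thesis using R by (simp add: power_mult_distrib k_def R_def power2_eq_square[of qsum] mult_ac)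
  qed
  finally show "(\<Sum>j<N. \<Sum>l<N. (area (2 * n) j l (real a / real n) (real b / real n) x - area n j l (real a / real n) (real b / real n) x)\<^sup>2)
     \<le> (sqrt (qsum\<^sup>2 + enn2real (total x)) * real n powr (- \<theta>) * (real b / real n - real a / real n) powr (2 * \<beta>))\<^sup>2"
    unfolding \<rho> R_def using area_incr n by simp
qed

lemma AE_holder_path_conv: "AE x in M. \<exists>C K. holder_path_conv e (\<lambda>r. \<omega> r x) C \<beta> \<theta> \<gamma> K"
  using total_finite
proof (rule AE_mp, intro AE_I2 impI)
  fix x assume x: "x \<in> space M" "total x \<noteq> \<infinity>"
  obtain C where C: "holder_path e (\<lambda>r. \<omega> r x) C \<beta> \<theta> \<gamma>" using holder_path_ex x by blast
  interpret holder_path e "\<lambda>r. \<omega> r x" C \<beta> \<theta> \<gamma> by (rule C)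
  let ?R = "sqrt (qsum\<^sup>2 + enn2real (total x))"
  have "holder_path_conv e (\<lambda>r. \<omega> r x) C \<beta> \<theta> \<gamma> (?R + 9 * (3 * C)\<^sup>2)"
  proof
    show "hs_bound (\<lambda>j l. A (2 * n) j l s t - A n j l s t)
        ((?R + 9 * (3 * C)\<^sup>2) * real n powr (- \<theta>) * (t - s) powr (2 * \<beta>))"
      if "0 < n" "0 \<le> s" "s \<le> t" "t \<le> 1" for n s t
      using that grid_bound[OF x(2) \<open>0 < n\<close>] by (intro A_diff_bound) (auto simp: area_def)
  qed simp
  then show "\<exists>C K. holder_path_conv e (\<lambda>r. \<omega> r x) C \<beta> \<theta> \<gamma> K" by blast
qed

end

subsection \<open>Identification with the Stratonovich integral\<close>

lemma (in holder_path) path_continuous: "continuous_on {0..1} w"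
  unfolding continuous_on_def
proof
  fix s :: real assume s: "s \<in> {0..1}"
  have "((\<lambda>t. \<bar>t - s\<bar> powr \<gamma>) \<longlongrightarrow> 0) (at s within {0..1})"
    using exponents by (intro tendsto_zero_powrI[of _ _ "\<lambda>_. \<gamma>" \<gamma>] tendsto_eq_intros) auto
  then have "((\<lambda>t. C * \<bar>t - s\<bar> powr \<gamma>) \<longlongrightarrow> 0) (at s within {0..1})"
    by (rule tendsto_mult_right_zero)
  moreover have "\<forall>\<^sub>F t in at s within {0..1}. norm (w t - w s) \<le> C * \<bar>t - s\<bar> powr \<gamma>"
    unfolding eventually_at_filter
  proof (intro always_eventually allI impI)
    fix t :: real assume "t \<noteq> s" "t \<in> {0..1}"
    then show "norm (w t - w s) \<le> C * \<bar>t - s\<bar> powr \<gamma>"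
      using holder[of s t] holder[of t s] s by (cases "s \<le> t") (auto simp: norm_minus_commute)
  qed
  ultimately have "((\<lambda>t. w t - w s) \<longlongrightarrow> 0) (at s within {0..1})"
    by (rule Lim_null_comparison[rotated])
  then show "(w \<longlongrightarrow> w s) (at s within {0..1})" by (rule LIM_zero_cancel)
qed

lemma (in holder_path_conv) grid_floor_tendsto:
  assumes "0 < n" "0 \<le> t" "t \<le> 1"
  shows "(\<lambda>r. grid_floor (n * 2 ^ r) t) \<longlonglongrightarrow> t"
proof -
  have "(\<lambda>r. (t - grid_floor (n * 2 ^ r) t) powr 1) \<longlonglongrightarrow> 0"
    by (intro grid_floor_powr_tendsto assms) simp
  moreover have "0 \<le> t - grid_floor (n * 2 ^ r) t" for r
    using grid_floor_facts[of "n * 2 ^ r" t] assms by simp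
  ultimately have "(\<lambda>r. t - grid_floor (n * 2 ^ r) t) \<longlonglongrightarrow> 0" by simp
  then have "(\<lambda>r. t - (t - grid_floor (n * 2 ^ r) t)) \<longlonglongrightarrow> t - 0" by (intro tendsto_diff tendsto_const)
  then show ?thesis by simp
qed

text \<open>With m fixed only finitely many points of the path are involved, so continuity is enough
  to let the endpoints move.\<close>

lemma strat_sum_tendsto:
  fixes Y Z :: "real \<Rightarrow> 'a \<Rightarrow> real"
  assumes cont: "continuous_on {0..1} (\<lambda>r. Y r x)" "continuous_on {0..1} (\<lambda>r. Z r x)"
    and lim: "S \<longlonglongrightarrow> s" "T \<longlonglongrightarrow> t" and m: "0 < m"
    and o: "\<And>r. 0 \<le> S r" "\<And>r. S r \<le> T r" "\<And>r. T r \<le> 1"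
  shows "(\<lambda>r. strat_sum Y Z (S r) (T r) m x) \<longlonglongrightarrow> strat_sum Y Z s t m x"
proof -
  have st: "0 \<le> s" "s \<le> t" "t \<le> 1"
    using LIMSEQ_le_const[OF lim(1)] LIMSEQ_le[OF lim] LIMSEQ_le_const2[OF lim(2)] o by auto
  have in01: "a + real k * (b - a) / real m \<in> {0..1}" if "0 \<le> a" "a \<le> b" "b \<le> 1" "k \<le> m" for a b k
  proof -
    have "real k * (b - a) \<le> real m * (b - a)" using that by (intro mult_right_mono) auto
    then have "real k * (b - a) / real m \<le> b - a" using m by (simp add: pos_divide_le_eq mult.commute)
    moreover have "0 \<le> real k * (b - a) / real m" using that by simp
    ultimately show ?thesis using that by simp
  qed
  have pt: "(\<lambda>r. S r + real k * (T r - S r) / real m) \<longlonglongrightarrow> s + real k * (t - s) / real m" for k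
    using m by (intro tendsto_intros lim) auto
  have c: "(\<lambda>r. h (S r + real k * (T r - S r) / real m)) \<longlonglongrightarrow> h (s + real k * (t - s) / real m)"
    if "continuous_on {0..1} h" "k \<le> m" for h :: "real \<Rightarrow> real" and k
    using in01 st o that(2)
    by (intro continuous_on_tendsto_compose[OF that(1) pt] always_eventually allI) auto
  have c0: "(\<lambda>r. Y (S r) x) \<longlonglongrightarrow> Y s x" using c[OF cont(1), of 0] by simp
  show ?thesis
    unfolding strat_sum_def Let_def
    by (intro tendsto_sum tendsto_mult tendsto_diff tendsto_divide tendsto_add c[OF cont(1)] c[OF cont(2)] c0 tendsto_const) auto
qed

lemma ennreal_double_add:
  assumes "0 \<le> c" "0 \<le> a" "0 \<le> b"
  shows "ennreal (c * (2 * a + 2 * b)) = ennreal (c * 2) * ennreal a + ennreal (c * 2) * ennreal b"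
proof -
  have "ennreal (c * (2 * a + 2 * b)) = ennreal (c * 2 * a + c * 2 * b)" by (simp add: algebra_simps)
  also have "\<dots> = ennreal (c * 2 * a) + ennreal (c * 2 * b)" using assms by (intro ennreal_plus) auto
  finally show ?thesis using assms by (simp only: ennreal_mult mult_nonneg_nonneg zero_le_numeral)
qed

section \<open>Measurability and mean square convergence of the areas\<close>

context q_wiener_basis
begin

abbreviation "Y \<equiv> \<lambda>j r x. e j \<bullet> \<omega> r x"

lemma measurable_Y: "0 \<le> t \<Longrightarrow> t \<le> 1 \<Longrightarrow> Y j t \<in> borel_measurable M"
  unfolding coord by (intro borel_measurable_times borel_measurable_const measurable_B)

lemma measurable_pl_Y:
  assumes "0 < n"
  shows "(\<lambda>x. pl_interp n (\<lambda>r. Y j r x) t) \<in> borel_measurable M"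
  unfolding pl_interp_def Let_def real_scaleR_def
  using assms by (intro borel_measurable_add borel_measurable_times borel_measurable_diff borel_measurable_const measurable_Y) auto

text \<open>Measurability in the random parameter is read off from the closed formula on cells and
  propagated by Chen's relation, without measuring the integral itself.\<close>

lemma measurable_area:
  assumes "0 < n" "0 \<le> s" "s \<le> t" "t \<le> 1"
  shows "area n j l s t \<in> borel_measurable M"
  using assms
proof (induction rule: cells_induct)
  case (cell k s t)
  have "area n j l s t = (\<lambda>x. (pl_interp n (\<lambda>r. Y j r x) t - pl_interp n (\<lambda>r. Y j r x) s)
      * (pl_interp n (\<lambda>r. Y l r x) t - pl_interp n (\<lambda>r. Y l r x) s) / 2)"
    unfolding area_def path_area_def using pl_area_cell[OF assms(1) cell] by blast
  then show ?case using measurable_pl_Y[OF assms(1)] by simp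
next
  case (trans s t u)
  have "area n j l s u = (\<lambda>x. area n j l s t x + area n j l t u x + (pl_interp n (\<lambda>r. Y j r x) t - pl_interp n (\<lambda>r. Y j r x) s)
      * (pl_interp n (\<lambda>r. Y l r x) u - pl_interp n (\<lambda>r. Y l r x) t))"
    unfolding area_def path_area_def using pl_area_chen[OF assms(1) trans(1-4)] by blast
  then show ?case using trans measurable_pl_Y[OF assms(1)] by simp
qed

definition area_lim :: "nat \<Rightarrow> nat \<Rightarrow> nat \<Rightarrow> real \<Rightarrow> real \<Rightarrow> 'a \<Rightarrow> real" where
  "area_lim n j l s t x = path_area_lim e (\<lambda>r. \<omega> r x) n j l s t"

text \<open>\<open>lim\<close> depends measurably on a sequence whether or not it converges, so the
  area limit is a random variable on the whole space although it is meaningful only almost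
  surely.\<close>

lemma measurable_area_lim:
  assumes "0 < n" "0 \<le> s" "s \<le> t" "t \<le> 1"
  shows "area_lim n j l s t \<in> borel_measurable M"
proof -
  have "(\<lambda>x. lim (\<lambda>r. area (n * 2 ^ r) j l s t x)) \<in> borel_measurable M"
    using assms by (intro borel_measurable_lim_metric measurable_area) auto
  then show ?thesis by (simp add: area_lim_def[abs_def] path_area_lim_def area_def[abs_def])
qed

lemma measurable_strat_sum:
  assumes "0 \<le> s" "s \<le> t" "t \<le> 1"
  shows "strat_sum (Y j) (Y l) s t m \<in> borel_measurable M"
proof -
  have in01: "0 \<le> s + real k * (t - s) / real m" "s + real k * (t - s) / real m \<le> 1" if "k \<le> m" "0 < m" for k
  proof -
    have "real k * (t - s) \<le> real m * (t - s)" using that assms by (intro mult_right_mono) auto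
    then have "real k * (t - s) / real m \<le> t - s" using that by (simp add: pos_divide_le_eq mult.commute)
    then show "s + real k * (t - s) / real m \<le> 1" using assms by simp
  qed (use assms in simp)
  show ?thesis
    unfolding strat_sum_def[abs_def] Let_def
    using assms in01
    by (intro borel_measurable_sum borel_measurable_times borel_measurable_diff borel_measurable_divide borel_measurable_add
        borel_measurable_const measurable_Y) (auto simp del: of_nat_Suc)
qed

lemma area_grid_strat_sum:
  assumes "0 < n" "a < b" "b \<le> n"
  shows "area n j l (real a / real n) (real b / real n) x
    = strat_sum (Y j) (Y l) (real a / real n) (real b / real n) (b - a) x"
proof -
  obtain m where b: "b = a + m" using assms(2) less_imp_add_positive by blast
  have m: "0 < m" using assms b by simp
  have pt: "real a / real n + real k * (real (a + m) / real n - real a / real n) / real m = real (a + k) / real n" for k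
    using m assms(1) by (simp add: field_simps)
  show ?thesis
    unfolding area_def path_area_def b using assms b
    by (subst pl_area_grid) (simp_all add: strat_sum_def Let_def pt del: of_nat_add of_nat_Suc)
qed

text \<open>Both sums are compared with their common refinement into m * m' intervals. Each error 2
  / m is doubled by the elementary bound for the square of a difference.\<close>

lemma strat_sum_L2:
  assumes m: "0 < m" "0 < m'" and st: "0 \<le> s" "s \<le> t" "t \<le> 1"
  shows "(\<integral>\<^sup>+ x. ennreal ((strat_sum (Y j) (Y l) s t m x - strat_sum (Y j) (Y l) s t m' x)\<^sup>2) \<partial>M)
    \<le> ennreal (q j * q l * (4 / real m + 4 / real m'))"
proof -
  let ?S = "\<lambda>k x. strat_sum (Y j) (Y l) s t k x"
  let ?D = "\<lambda>k x. strat_sum (coord j) (coord l) s t k x"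
  have qq: "0 \<le> q j * q l" using q(1)[of j] q(1)[of l] by simp
  have sc: "?S k x = sqrt (q j) * sqrt (q l) * ?D k x" for k x
    unfolding coord strat_sum_scale ..
  have ref: "(\<integral>\<^sup>+ x. ennreal ((?D k x - ?D (k * k') x)\<^sup>2) \<partial>M) \<le> ennreal (2 / real k)" if "0 < k" "0 < k'" for k k'
  proof (cases "j = l")
    case True
    then show ?thesis using that by (simp add: strat_sum_diag)
  next
    case False
    then show ?thesis using strat_sum_refine_L2[of j l k k' s t] that st by simp
  qed
  have mD[measurable]: "?D k \<in> borel_measurable M" for k
  proof -
    have "?D k = (\<lambda>x. ?S k x / (sqrt (q j) * sqrt (q l)))"
      using q(1)[of j] q(1)[of l] by (auto simp: sc)
    then show ?thesis using measurable_strat_sum[OF st, of j l k] by simp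
  qed
  have tri: "(sqrt (q j) * sqrt (q l) * u - sqrt (q j) * sqrt (q l) * v)\<^sup>2 \<le> q j * q l * (2 * (u - w)\<^sup>2 + 2 * (v - w)\<^sup>2)" for u v w
  proof -
    have "(sqrt (q j) * sqrt (q l) * u - sqrt (q j) * sqrt (q l) * v)\<^sup>2 = q j * q l * (u - v)\<^sup>2"
      using q(1)[of j] q(1)[of l] by (simp add: power_mult_distrib flip: right_diff_distrib)
    also have "(u - v)\<^sup>2 \<le> 2 * (u - w)\<^sup>2 + 2 * (v - w)\<^sup>2"
    proof -
      have "2 * (u - w)\<^sup>2 + 2 * (v - w)\<^sup>2 - (u - v)\<^sup>2 = (u + v - 2 * w)\<^sup>2" by algebra
      then show ?thesis by (smt (verit) zero_le_power2)
    qed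
    finally show ?thesis using qq by (simp add: mult_left_mono)
  qed
  have "(\<integral>\<^sup>+ x. ennreal ((?S m x - ?S m' x)\<^sup>2) \<partial>M)
    \<le> (\<integral>\<^sup>+ x. ennreal (q j * q l * 2) * ennreal ((?D m x - ?D (m * m') x)\<^sup>2)
        + ennreal (q j * q l * 2) * ennreal ((?D m' x - ?D (m' * m) x)\<^sup>2) \<partial>M)"
  proof (intro nn_integral_mono)
    fix x
    have "ennreal ((?S m x - ?S m' x)\<^sup>2)
      \<le> ennreal (q j * q l * (2 * (?D m x - ?D (m * m') x)\<^sup>2 + 2 * (?D m' x - ?D (m * m') x)\<^sup>2))"
      unfolding sc by (intro ennreal_leI tri)
    also have "\<dots> = ennreal (q j * q l * 2) * ennreal ((?D m x - ?D (m * m') x)\<^sup>2)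
        + ennreal (q j * q l * 2) * ennreal ((?D m' x - ?D (m' * m) x)\<^sup>2)"
      unfolding mult.commute[of m' m] using qq by (intro ennreal_double_add) auto
    finally show "ennreal ((?S m x - ?S m' x)\<^sup>2)
      \<le> ennreal (q j * q l * 2) * ennreal ((?D m x - ?D (m * m') x)\<^sup>2)
        + ennreal (q j * q l * 2) * ennreal ((?D m' x - ?D (m' * m) x)\<^sup>2)" .
  qed
  also have "\<dots> = ennreal (q j * q l * 2) * (\<integral>\<^sup>+ x. ennreal ((?D m x - ?D (m * m') x)\<^sup>2) \<partial>M)
        + ennreal (q j * q l * 2) * (\<integral>\<^sup>+ x. ennreal ((?D m' x - ?D (m' * m) x)\<^sup>2) \<partial>M)"
    by (subst nn_integral_add) (auto simp: nn_integral_cmult)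
  also have "\<dots> \<le> ennreal (q j * q l * 2) * ennreal (2 / real m) + ennreal (q j * q l * 2) * ennreal (2 / real m')"
    by (intro add_mono mult_left_mono ref m) auto
  also have "\<dots> = ennreal (q j * q l * (2 * (2 / real m) + 2 * (2 / real m')))"
    using qq by (intro ennreal_double_add[symmetric]) auto
  finally show ?thesis by simp
qed

text \<open>Between nodes the area is itself a midpoint sum, with \<open>kb r - ka r\<close>
  intervals, so \<open>strat_sum_L2\<close> applies there. Moving s and t to nodes, both terms
  converge almost surely and the bound survives.\<close>

lemma strat_sum_area_lim_L2:
  assumes n: "0 < n" and m: "0 < m" and st: "0 \<le> s" "s < t" "t \<le> 1"
  shows "(\<integral>\<^sup>+ x. ennreal ((strat_sum (Y j) (Y l) s t m x - area_lim n j l s t x)\<^sup>2) \<partial>M)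
    \<le> ennreal (q j * q l * (8 / real m))"
  (is "(\<integral>\<^sup>+ x. ennreal ((?Z x)\<^sup>2) \<partial>M) \<le> _")
proof -
  define N where "N r = n * 2 ^ r" for r
  have N: "0 < N r" for r using n by (simp add: N_def)
  define ka where "ka r = nat \<lfloor>real (N r) * s\<rfloor>" for r
  define kb where "kb r = nat \<lfloor>real (N r) * t\<rfloor>" for r
  define S where "S r = real (ka r) / real (N r)" for r
  define T where "T r = real (kb r) / real (N r)" for r
  have ST: "S r = grid_floor (N r) s" "T r = grid_floor (N r) t" for r
    by (simp_all add: S_def T_def ka_def kb_def grid_floor_def)
  have t01: "0 \<le> t" "s \<le> 1" "s \<le> t" using st by auto
  have o: "0 \<le> S r" "S r \<le> T r" "T r \<le> 1" for r
    using in_cellD[OF grid_floor_in_cell[OF N[of r] st(1) t01(2)]] in_cellD[OF grid_floor_in_cell[OF N[of r] t01(1) st(3)]]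
      grid_floor_mono[OF t01(3), of "N r"] by (auto simp: ST)
  have kbN: "kb r \<le> N r" for r using o(3)[of r] N[of r] by (simp add: T_def)
  \<comment> \<open>As s < t, eventually at least m cells lie between the two nodes. The error of
    the finer sum is then no larger than that of the sum with m intervals, which gives 8 / m in
    total.\<close>
  have Kinf: "\<forall>\<^sub>F r in sequentially. ka r + m \<le> kb r"
  proof -
    have "filterlim (\<lambda>r. real (N r)) at_top sequentially"
      unfolding N_def by (rule filterlim_compose[OF filterlim_real_sequentially filterlim_mult_power2[OF n]])
    then have "filterlim (\<lambda>r. (t - s) * real (N r)) at_top sequentially"
      using st by (intro filterlim_tendsto_pos_mult_at_top[OF tendsto_const]) auto
    then have "\<forall>\<^sub>F r in sequentially. real m + 1 \<le> (t - s) * real (N r)"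
      unfolding filterlim_at_top by blast
    then show ?thesis
    proof eventually_elim
      case (elim r)
      have "real (ka r) \<le> real (N r) * s" "real (N r) * t - 1 \<le> real (kb r)"
        unfolding ka_def kb_def using st t01 by auto
      then have "real (ka r) + real m \<le> real (kb r)" using elim by (simp add: left_diff_distrib mult.commute)
      then show ?case by linarith
    qed
  qed
  define f where "f r x = strat_sum (Y j) (Y l) (S r) (T r) m x - strat_sum (Y j) (Y l) (S r) (T r) (kb r - ka r) x" for r x
  have fm[measurable]: "f r \<in> borel_measurable M" for r
    unfolding f_def using measurable_strat_sum[OF o] by (intro borel_measurable_diff)
  have fb: "\<forall>\<^sub>F r in sequentially. (\<integral>\<^sup>+ x. ennreal ((f r x)\<^sup>2) \<partial>M) \<le> ennreal (q j * q l * (8 / real m))"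
    using Kinf
  proof eventually_elim
    case (elim r)
    have "(\<integral>\<^sup>+ x. ennreal ((f r x)\<^sup>2) \<partial>M) \<le> ennreal (q j * q l * (4 / real m + 4 / real (kb r - ka r)))"
      unfolding f_def using elim m by (intro strat_sum_L2 o) auto
    also have "\<dots> \<le> ennreal (q j * q l * (8 / real m))"
    proof (intro ennreal_leI mult_left_mono)
      have "4 / real (kb r - ka r) \<le> 4 / real m" using elim m by (intro divide_left_mono) auto
      then show "4 / real m + 4 / real (kb r - ka r) \<le> 8 / real m" by simp
    qed (use q(1)[of j] q(1)[of l] in simp)
    finally show ?case .
  qed
  have "AE x in M. ennreal ((?Z x)\<^sup>2) \<le> liminf (\<lambda>r. ennreal ((f r x)\<^sup>2))"
    using AE_holder_path_conv
  proof eventually_elim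
    case (elim x)
    then obtain C K where "holder_path_conv e (\<lambda>r. \<omega> r x) C \<beta> \<theta> \<gamma> K" by blast
    then interpret h: holder_path_conv e "\<lambda>r. \<omega> r x" C \<beta> \<theta> \<gamma> K .
    have c: "continuous_on {0..1} (\<lambda>r. Y i r x)" for i
      by (intro continuous_intros h.path_continuous)
    have "S \<longlonglongrightarrow> s" "T \<longlonglongrightarrow> t"
      unfolding ST N_def using h.grid_floor_tendsto[OF n] st t01 by auto
    then have 1: "(\<lambda>r. strat_sum (Y j) (Y l) (S r) (T r) m x) \<longlonglongrightarrow> strat_sum (Y j) (Y l) s t m x"
      by (intro strat_sum_tendsto c m o)
    have "(\<lambda>r. area (N r) j l (S r) (T r) x) \<longlonglongrightarrow> area_lim n j l s t x"
      unfolding area_def area_lim_def ST N_def using st t01 by (intro h.A_grid_tendsto n) auto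
    moreover have "\<forall>\<^sub>F r in sequentially. area (N r) j l (S r) (T r) x = strat_sum (Y j) (Y l) (S r) (T r) (kb r - ka r) x"
      using Kinf by eventually_elim (use m in \<open>auto simp: S_def T_def intro!: area_grid_strat_sum N kbN\<close>)
    ultimately have "(\<lambda>r. strat_sum (Y j) (Y l) (S r) (T r) (kb r - ka r) x) \<longlonglongrightarrow> area_lim n j l s t x"
      by (rule Lim_transform_eventually)
    with 1 have "(\<lambda>r. f r x) \<longlonglongrightarrow> ?Z x"
      unfolding f_def by (rule tendsto_diff)
    then have "(\<lambda>r. ennreal ((f r x)\<^sup>2)) \<longlonglongrightarrow> ennreal ((?Z x)\<^sup>2)"
      by (intro tendsto_ennrealI tendsto_power)
    then show ?case using lim_imp_Liminf[OF sequentially_bot] by (metis order_refl)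
  qed
  then have "(\<integral>\<^sup>+ x. ennreal ((?Z x)\<^sup>2) \<partial>M)
    \<le> (\<integral>\<^sup>+ x. liminf (\<lambda>r. ennreal ((f r x)\<^sup>2)) \<partial>M)"
    by (rule nn_integral_mono_AE)
  also have "\<dots> \<le> liminf (\<lambda>r. \<integral>\<^sup>+ x. ennreal ((f r x)\<^sup>2) \<partial>M)"
    by (intro nn_integral_liminf) measurable
  also have "\<dots> \<le> liminf (\<lambda>r. ennreal (q j * q l * (8 / real m)))"
    by (intro Liminf_mono fb)
  also have "\<dots> = ennreal (q j * q l * (8 / real m))" by (simp add: Liminf_const)
  finally show ?thesis .
qed

text \<open>Both limits are close in mean square to the same midpoint sum, which does not involve n;
  then m tends to infinity. The 32 is twice 8 for each of the two.\<close>

lemma area_lim_unique: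
  assumes n: "0 < n" and st: "0 \<le> s" "s < t" "t \<le> 1"
  shows "AE x in M. area_lim n j l s t x = area_lim 1 j l s t x"
proof -
  let ?D = "\<lambda>x. area_lim n j l s t x - area_lim 1 j l s t x"
  have [measurable]: "area_lim k j l s t \<in> borel_measurable M" if "0 < k" for k
    using that st by (intro measurable_area_lim) auto
  have mD[measurable]: "?D \<in> borel_measurable M" using n by measurable
  have qq: "0 \<le> q j * q l" using q(1)[of j] q(1)[of l] by simp
  have le: "(\<integral>\<^sup>+ x. ennreal ((?D x)\<^sup>2) \<partial>M) \<le> ennreal (q j * q l * 32 * (1 / real (Suc m)))" for m
  proof -
    let ?s = "\<lambda>x. strat_sum (Y j) (Y l) s t (Suc m) x"
    have [measurable]: "?s \<in> borel_measurable M" using st by (intro measurable_strat_sum) auto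
    have "(\<integral>\<^sup>+ x. ennreal ((?D x)\<^sup>2) \<partial>M)
      \<le> (\<integral>\<^sup>+ x. 2 * ennreal ((?s x - area_lim n j l s t x)\<^sup>2) + 2 * ennreal ((?s x - area_lim 1 j l s t x)\<^sup>2) \<partial>M)"
    proof (intro nn_integral_mono)
      fix x
      have "2 * (u - v)\<^sup>2 + 2 * (u - w)\<^sup>2 - (v - w)\<^sup>2 = (2 * u - v - w)\<^sup>2" for u v w :: real by algebra
      then have "(v - w)\<^sup>2 \<le> 2 * (u - v)\<^sup>2 + 2 * (u - w)\<^sup>2" for u v w :: real by (smt (verit) zero_le_power2)
      then have "ennreal ((?D x)\<^sup>2) \<le> ennreal (2 * (?s x - area_lim n j l s t x)\<^sup>2 + 2 * (?s x - area_lim 1 j l s t x)\<^sup>2)"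
        by (intro ennreal_leI)
      then show "ennreal ((?D x)\<^sup>2) \<le> 2 * ennreal ((?s x - area_lim n j l s t x)\<^sup>2) + 2 * ennreal ((?s x - area_lim 1 j l s t x)\<^sup>2)"
        using ennreal_double_add[of 1 "(?s x - area_lim n j l s t x)\<^sup>2" "(?s x - area_lim 1 j l s t x)\<^sup>2"] by simp
    qed
    also have "\<dots> = 2 * (\<integral>\<^sup>+ x. ennreal ((?s x - area_lim n j l s t x)\<^sup>2) \<partial>M)
        + 2 * (\<integral>\<^sup>+ x. ennreal ((?s x - area_lim 1 j l s t x)\<^sup>2) \<partial>M)"
      using n by (subst nn_integral_add) (auto simp: nn_integral_cmult)
    also have "\<dots> \<le> 2 * ennreal (q j * q l * (8 / real (Suc m))) + 2 * ennreal (q j * q l * (8 / real (Suc m)))"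
      by (intro add_mono mult_left_mono strat_sum_area_lim_L2 n st) auto
    also have "\<dots> = ennreal (2 * (q j * q l * (8 / real (Suc m))) + 2 * (q j * q l * (8 / real (Suc m))))"
      using ennreal_double_add[of 1 "q j * q l * (8 / real (Suc m))" "q j * q l * (8 / real (Suc m))"] qq
      by (simp del: of_nat_Suc)
    also have "2 * (q j * q l * (8 / real (Suc m))) + 2 * (q j * q l * (8 / real (Suc m))) = q j * q l * 32 * (1 / real (Suc m))"
      by simp
    finally show ?thesis .
  qed
  have "(\<lambda>m. q j * q l * 32 * (1 / real (Suc m))) \<longlonglongrightarrow> 0"
    by (intro tendsto_mult_right_zero LIMSEQ_Suc[OF lim_1_over_n])
  then have "(\<lambda>m. ennreal (q j * q l * 32 * (1 / real (Suc m)))) \<longlonglongrightarrow> ennreal 0"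
    by (rule tendsto_ennrealI)
  then have "(\<integral>\<^sup>+ x. ennreal ((?D x)\<^sup>2) \<partial>M) \<le> ennreal 0"
    by (rule LIMSEQ_le_const) (use le in auto)
  then have "(\<integral>\<^sup>+ x. ennreal ((?D x)\<^sup>2) \<partial>M) = 0" by simp
  moreover have "(\<lambda>x. ennreal ((?D x)\<^sup>2)) \<in> borel_measurable M" by measurable
  ultimately have "AE x in M. ennreal ((?D x)\<^sup>2) = 0" by (simp only: nn_integral_0_iff_AE)
  then show ?thesis by eventually_elim simp
qed

text \<open>Chebyshev's inequality turns the mean square bound into convergence in probability of
  the midpoint sums.\<close>

lemma area_lim_stratonovich:
  assumes st: "0 \<le> s" "s < t" "t \<le> 1"
  shows "is_stratonovich M (Y j) (Y l) s t (area_lim 1 j l s t)"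
  unfolding is_stratonovich_def
proof (intro conjI allI impI)
  show mA[measurable]: "area_lim 1 j l s t \<in> borel_measurable M" using st by (intro measurable_area_lim) auto
  fix \<epsilon> :: real assume \<epsilon>: "0 < \<epsilon>"
  let ?P = "\<lambda>m. measure M {x \<in> space M. \<epsilon> < \<bar>strat_sum (Y j) (Y l) s t m x - area_lim 1 j l s t x\<bar>}"
  have bound: "?P m
    \<le> q j * q l * 8 / \<epsilon>\<^sup>2 * (1 / real m)" if m: "0 < m" for m
  proof -
    let ?f = "\<lambda>x. strat_sum (Y j) (Y l) s t m x - area_lim 1 j l s t x"
    let ?E = "{x \<in> space M. \<epsilon> < \<bar>?f x\<bar>}"
    have [measurable]: "strat_sum (Y j) (Y l) s t m \<in> borel_measurable M" using st by (intro measurable_strat_sum) auto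
    have E: "?E \<in> sets M" by measurable
    have "ennreal (\<epsilon>\<^sup>2) * emeasure M ?E = (\<integral>\<^sup>+ x. ennreal (\<epsilon>\<^sup>2) * indicator ?E x \<partial>M)"
      using E by (simp add: nn_integral_cmult_indicator)
    also have "\<dots> \<le> (\<integral>\<^sup>+ x. ennreal ((?f x)\<^sup>2) \<partial>M)"
    proof (intro nn_integral_mono)
      fix x
      have "\<epsilon>\<^sup>2 \<le> (?f x)\<^sup>2" if "\<epsilon> < \<bar>?f x\<bar>"
        using that \<epsilon> by (metis abs_le_square_iff abs_of_pos less_imp_le)
      then show "ennreal (\<epsilon>\<^sup>2) * indicator ?E x \<le> ennreal ((?f x)\<^sup>2)"
        by (auto simp: indicator_def intro: ennreal_leI)
    qed
    also have "\<dots> \<le> ennreal (q j * q l * (8 / real m))"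
      by (intro strat_sum_area_lim_L2 m st) simp
    finally have "ennreal (\<epsilon>\<^sup>2 * measure M ?E) \<le> ennreal (q j * q l * (8 / real m))"
      by (simp add: emeasure_eq_measure ennreal_mult)
    then have "\<epsilon>\<^sup>2 * measure M ?E \<le> q j * q l * (8 / real m)"
      using q(1)[of j] q(1)[of l] by (simp add: ennreal_le_iff)
    then have "measure M ?E \<le> q j * q l * (8 / real m) / \<epsilon>\<^sup>2"
      using \<epsilon> by (simp only: pos_le_divide_eq zero_less_power mult.commute)
    then show ?thesis by (simp only: times_divide_eq_right times_divide_eq_left mult_1_right divide_divide_eq_left mult.commute)
  qed
  show "(\<lambda>m. ?P m) \<longlonglongrightarrow> 0"
  proof (rule tendsto_sandwich[OF _ _ tendsto_const])
    show "(\<lambda>m. q j * q l * 8 / \<epsilon>\<^sup>2 * (1 / real m)) \<longlonglongrightarrow> 0"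
      by (intro tendsto_mult_right_zero lim_1_over_n)
    show "\<forall>\<^sub>F m in sequentially. ?P m
      \<le> q j * q l * 8 / \<epsilon>\<^sup>2 * (1 / real m)"
      using eventually_gt_at_top[of 0] by eventually_elim (rule bound)
  qed auto
qed

text \<open>The order of quantifiers is the point: one null set and one random K serve all s, t and
  n at the same time.\<close>

lemma AE_area_bounds:
  "AE x in M. \<exists>K. 0 \<le> K \<and> (\<forall>s t. 0 \<le> s \<longrightarrow> s < t \<longrightarrow> t \<le> 1 \<longrightarrow>
      hs_bound (\<lambda>j l. area_lim 1 j l s t x) (K * (t - s) powr (2 * \<beta>)) \<and>
      (\<forall>n>0. hs_bound (\<lambda>j l. area_lim 1 j l s t x - area n j l s t x)
        (K * real n powr (- \<theta>) * (t - s) powr (2 * \<beta>))))"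
proof -
  \<comment> \<open>The null set of \<open>area_lim_unique\<close> depends on s and t, so it is used
    only at rational nodes, of which there are countably many.\<close>
  have "AE x in M. \<forall>n j l N a b. 0 < n \<longrightarrow> a < b \<longrightarrow> b \<le> N \<longrightarrow>
    area_lim n j l (real a / real N) (real b / real N) x = area_lim 1 j l (real a / real N) (real b / real N) x"
    unfolding AE_all_countable
  proof (intro allI AE_impI)
    fix n j l N a b :: nat assume "0 < n" "a < b" "b \<le> N"
    then show "AE x in M. area_lim n j l (real a / real N) (real b / real N) x = area_lim 1 j l (real a / real N) (real b / real N) x"
      by (intro area_lim_unique) (auto simp: divide_strict_right_mono)
  qed
  with AE_holder_path_conv show ?thesis
  proof eventually_elim
    case (elim x)
    then obtain C K where "holder_path_conv e (\<lambda>r. \<omega> r x) C \<beta> \<theta> \<gamma> K" by blast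
    then interpret h: holder_path_conv e "\<lambda>r. \<omega> r x" C \<beta> \<theta> \<gamma> K .
    have grid: "h.Alim n j l (real a / real N) (real b / real N) = h.Alim 1 j l (real a / real N) (real b / real N)"
      if "0 < n" "0 < N" "a \<le> b" "b \<le> N" for n N a b j l
    proof (cases "a = b")
      case True
      then show ?thesis by (simp add: path_area_lim_def h.A_refl)
    next
      case False
      then show ?thesis using elim(2)[rule_format, of n a b N j l] that by (simp add: area_lim_def)
    qed
    let ?K = "K * h.\<kappa> + h.L\<^sup>2"
    have "hs_bound (\<lambda>j l. area_lim 1 j l s t x) (?K * (t - s) powr (2 * \<beta>)) \<and>
      (\<forall>n>0. hs_bound (\<lambda>j l. area_lim 1 j l s t x - area n j l s t x) (?K * real n powr (- \<theta>) * (t - s) powr (2 * \<beta>)))"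
      if st: "0 \<le> s" "s < t" "t \<le> 1" for s t
    proof (intro conjI allI impI)
      show "hs_bound (\<lambda>j l. area_lim 1 j l s t x) (?K * (t - s) powr (2 * \<beta>))"
        unfolding area_lim_def using st by (intro h.Alim_one_bound) auto
      fix n :: nat assume n: "0 < n"
      have "h.Alim n j l s t = h.Alim 1 j l s t" for j l
        by (rule h.Alim_eq_Alim_one[OF n _ _ _ grid[OF n]]) (use st in auto)
      moreover have "hs_bound (\<lambda>j l. h.Alim n j l s t - h.A n j l s t) (K * h.\<kappa> * real n powr (- \<theta>) * (t - s) powr (2 * \<beta>))"
        using st by (intro h.Alim_bound n) auto
      ultimately have "hs_bound (\<lambda>j l. h.Alim 1 j l s t - h.A n j l s t) (K * h.\<kappa> * real n powr (- \<theta>) * (t - s) powr (2 * \<beta>))"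
        by simp
      then show "hs_bound (\<lambda>j l. area_lim 1 j l s t x - area n j l s t x) (?K * real n powr (- \<theta>) * (t - s) powr (2 * \<beta>))"
        unfolding area_lim_def area_def by (rule hs_bound_mono) (intro mult_right_mono, auto)
    qed
    moreover have "0 \<le> ?K" using h.K h.kappa_nonneg by simp
    ultimately show ?case by blast
  qed
qed

end

subsection \<open>Hilbert--Schmidt norms\<close>

lemma nn_integral_hs_bound:
  assumes "hs_bound f B"
  shows "(\<integral>\<^sup>+ p. ennreal ((f (fst p) (snd p))\<^sup>2) \<partial>count_space UNIV) \<le> ennreal (B\<^sup>2)"
proof -
  let ?g = "\<lambda>p. ennreal ((f (fst p) (snd p))\<^sup>2)"
  have bij: "bij_betw prod_decode UNIV UNIV" by (rule bij_prod_decode)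
  have "(\<integral>\<^sup>+ p. ?g p \<partial>count_space UNIV) = (\<integral>\<^sup>+ n. ?g (prod_decode n) \<partial>count_space UNIV)"
    by (rule nn_integral_bij_count_space[OF bij, symmetric])
  also have "\<dots> = (\<Sum>n. ?g (prod_decode n))" by (rule nn_integral_count_space_nat)
  also have "\<dots> \<le> ennreal (B\<^sup>2)"
  proof (rule suminf_le_const[OF summableI])
    fix N
    have inj: "inj_on prod_decode {..<N}" by (rule inj_prod_decode)
    have "(\<Sum>n<N. ?g (prod_decode n)) = ennreal (\<Sum>p\<in>prod_decode ` {..<N}. (f (fst p) (snd p))\<^sup>2)"
      by (simp add: sum.reindex[OF inj])
    also have "\<dots> \<le> ennreal (B\<^sup>2)"
    proof (rule ennreal_leI)
      have "L2_set (\<lambda>p. f (fst p) (snd p)) (prod_decode ` {..<N}) \<le> B"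
        using assms unfolding hs_bound_def by blast
      then show "(\<Sum>p\<in>prod_decode ` {..<N}. (f (fst p) (snd p))\<^sup>2) \<le> B\<^sup>2"
        unfolding L2_set_def by (meson real_sqrt_le_iff sqrt_le_D)
    qed
    finally show "(\<Sum>n<N. ?g (prod_decode n)) \<le> ennreal (B\<^sup>2)" .
  qed
  finally show ?thesis .
qed

lemma ennsqrt_le:
  assumes "a \<le> ennreal (b\<^sup>2)" "0 \<le> b"
  shows "ennsqrt a \<le> ennreal b"
proof -
  have "a \<noteq> \<top>" using assms(1) by (metis ennreal_neq_top neq_top_trans)
  moreover have "enn2real a \<le> b\<^sup>2"
    using enn2real_mono[OF assms(1)] by simp
  then have "sqrt (enn2real a) \<le> b" using assms(2) by (simp add: real_le_lsqrt)
  ultimately show ?thesis by (simp add: ennsqrt_def ennreal_leI)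
qed

text \<open>The index k enters only through its weight, and the image of the basis operator (k, j)
  has its coefficients in row k alone. The squared norm therefore factors into the sum of
  \<open>lam k powr (- 2 * \<delta>)\<close> and the squared norm of the matrix f.\<close>

lemma hs_norm_tensor_int_map_le:
  assumes f: "hs_bound f B" and lam: "summable (\<lambda>i. lam i powr (- 2 * \<delta>))"
  shows "hs_norm (tensor_int_map lam \<delta> f) \<le> ennreal (sqrt (\<Sum>i. lam i powr (- 2 * \<delta>)) * B)"
  unfolding hs_norm_def
proof (rule ennsqrt_le)
  let ?\<Lambda> = "\<Sum>i. lam i powr (- 2 * \<delta>)"
  have L: "0 \<le> ?\<Lambda>" using lam by (intro suminf_nonneg) auto
  show "0 \<le> sqrt ?\<Lambda> * B" using L hs_bound_nonneg[OF f] by simp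
  let ?\<Phi> = "tensor_int_map lam \<delta> f"
  have inner: "(\<integral>\<^sup>+ c. ennreal ((?\<Phi> (k, j) c)\<^sup>2) \<partial>count_space UNIV)
    = ennreal (lam k powr (- 2 * \<delta>)) * (\<integral>\<^sup>+ l. ennreal ((f j l)\<^sup>2) \<partial>count_space UNIV)" for k j
  proof -
    have sq: "(lam k powr (- \<delta>))\<^sup>2 = lam k powr (- 2 * \<delta>)"
      by (simp add: power2_eq_square flip: powr_add)
    have "(\<integral>\<^sup>+ c. ennreal ((?\<Phi> (k, j) c)\<^sup>2) \<partial>count_space UNIV)
      = (\<integral>\<^sup>+ k'. \<integral>\<^sup>+ l. ennreal ((?\<Phi> (k, j) (k', l))\<^sup>2) \<partial>count_space UNIV \<partial>count_space UNIV)"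
      by (rule nn_integral_fst_count_space[symmetric])
    also have "\<dots> = (\<integral>\<^sup>+ k'. (\<integral>\<^sup>+ l. ennreal (lam k powr (- 2 * \<delta>)) * ennreal ((f j l)\<^sup>2) \<partial>count_space UNIV) * indicator {k} k' \<partial>count_space UNIV)"
      by (intro nn_integral_cong)
        (auto simp: tensor_int_map_def indicator_def power_mult_distrib sq ennreal_mult)
    also have "\<dots> = (\<integral>\<^sup>+ l. ennreal (lam k powr (- 2 * \<delta>)) * ennreal ((f j l)\<^sup>2) \<partial>count_space UNIV)"
      by (simp add: nn_integral_cmult_indicator)
    also have "\<dots> = ennreal (lam k powr (- 2 * \<delta>)) * (\<integral>\<^sup>+ l. ennreal ((f j l)\<^sup>2) \<partial>count_space UNIV)"
      by (rule nn_integral_cmult) simp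
    finally show ?thesis .
  qed
  have "(\<integral>\<^sup>+ b. (\<integral>\<^sup>+ c. ennreal ((?\<Phi> b c)\<^sup>2) \<partial>count_space UNIV) \<partial>count_space UNIV)
    = (\<integral>\<^sup>+ k. \<integral>\<^sup>+ j. (\<integral>\<^sup>+ c. ennreal ((?\<Phi> (k, j) c)\<^sup>2) \<partial>count_space UNIV) \<partial>count_space UNIV \<partial>count_space UNIV)"
    by (rule nn_integral_fst_count_space[symmetric])
  also have "\<dots> = (\<integral>\<^sup>+ k. ennreal (lam k powr (- 2 * \<delta>)) * (\<integral>\<^sup>+ j. \<integral>\<^sup>+ l. ennreal ((f j l)\<^sup>2) \<partial>count_space UNIV \<partial>count_space UNIV) \<partial>count_space UNIV)"
    unfolding inner by (intro nn_integral_cong nn_integral_cmult) simp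
  also have "\<dots> = (\<integral>\<^sup>+ k. ennreal (lam k powr (- 2 * \<delta>)) \<partial>count_space UNIV)
      * (\<integral>\<^sup>+ j. \<integral>\<^sup>+ l. ennreal ((f j l)\<^sup>2) \<partial>count_space UNIV \<partial>count_space UNIV)"
    by (rule nn_integral_multc) simp
  also have "(\<integral>\<^sup>+ k. ennreal (lam k powr (- 2 * \<delta>)) \<partial>count_space UNIV) = ennreal ?\<Lambda>"
    by (simp only: nn_integral_count_space_nat) (intro suminf_ennreal2 lam, simp)
  also have "(\<integral>\<^sup>+ j. \<integral>\<^sup>+ l. ennreal ((f j l)\<^sup>2) \<partial>count_space UNIV \<partial>count_space UNIV)
      = (\<integral>\<^sup>+ p. ennreal ((f (fst p) (snd p))\<^sup>2) \<partial>count_space UNIV)"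
    using nn_integral_fst_count_space[of "\<lambda>p. ennreal ((f (fst p) (snd p))\<^sup>2)"] by simp
  also have "ennreal ?\<Lambda> * \<dots> \<le> ennreal ?\<Lambda> * ennreal (B\<^sup>2)"
    by (intro mult_left_mono nn_integral_hs_bound f) simp
  also have "\<dots> = ennreal ((sqrt ?\<Lambda> * B)\<^sup>2)"
    using L by (simp add: power_mult_distrib ennreal_mult)
  finally show "(\<integral>\<^sup>+ b. (\<integral>\<^sup>+ c. ennreal ((?\<Phi> b c)\<^sup>2) \<partial>count_space UNIV) \<partial>count_space UNIV) \<le> ennreal ((sqrt ?\<Lambda> * B)\<^sup>2)" .
qed

lemma weighted_hs_norm_le:
  assumes f: "hs_bound f (c * (t - s) powr a)" and "0 \<le> c" "s < t" and lam: "summable (\<lambda>i. lam i powr (- 2 * \<delta>))"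
  shows "hs_norm (tensor_int_map lam \<delta> f) / ennreal ((t - s) powr a) \<le> ennreal (sqrt (\<Sum>i. lam i powr (- 2 * \<delta>)) * c)"
proof -
  let ?\<Lambda> = "\<Sum>i. lam i powr (- 2 * \<delta>)"
  have L: "0 \<le> ?\<Lambda>" using lam by (intro suminf_nonneg) auto
  have p: "0 < (t - s) powr a" using assms by simp
  have "hs_norm (tensor_int_map lam \<delta> f) / ennreal ((t - s) powr a)
    \<le> ennreal (sqrt ?\<Lambda> * (c * (t - s) powr a)) / ennreal ((t - s) powr a)"
    by (intro divide_right_mono_ennreal hs_norm_tensor_int_map_le f lam)
  also have "\<dots> = ennreal (sqrt ?\<Lambda> * c)"
    using p L assms by (subst divide_ennreal) auto
  finally show ?thesis .
qed

theorem theorem5p1: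
  fixes M :: "'a measure" and e :: "nat \<Rightarrow> 'v::{real_inner,complete_space}"
    and lam q :: "nat \<Rightarrow> real" and \<delta> \<beta>' :: real and \<omega> :: "real \<Rightarrow> 'a \<Rightarrow> 'v"
  assumes "prob_space M"
    and "orthonormal_basis e"
    and "\<forall>i. lam i > 0"
    and "filterlim lam at_top sequentially"
    and "0 \<le> \<delta>" and "\<delta> \<le> 1"
    and "summable (\<lambda>i. lam i powr (- 2 * \<delta>))"
    and "1/3 < \<beta>'" and "\<beta>' < 1/2"
    and "\<forall>i. q i > 0" and "summable q"
    and "q_wiener M e q \<omega>"
  shows "\<exists>S :: nat \<Rightarrow> nat \<Rightarrow> real \<Rightarrow> real \<Rightarrow> 'a \<Rightarrow> real.
     (\<forall>j l s t. (s, t) \<in> simplex01 \<longrightarrow>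
        is_stratonovich M (\<lambda>r x. e j \<bullet> \<omega> r x) (\<lambda>r x. e l \<bullet> \<omega> r x) s t (S j l s t)) \<and>
     (AE x in M. (SUP p\<in>simplex01.
        hs_norm (tensor_int_map lam \<delta> (\<lambda>j l. S j l (fst p) (snd p) x))
          / ennreal ((snd p - fst p) powr (2 * \<beta>'))) < \<top>) \<and>
     (AE x in M. (\<lambda>n. SUP p\<in>simplex01.
        hs_norm (tensor_int_map lam \<delta> (\<lambda>j l. S j l (fst p) (snd p) x
            - rs_int (\<lambda>r. e j \<bullet> pl_interp n (\<lambda>r. \<omega> r x) r)
                     (\<lambda>r. e l \<bullet> pl_interp n (\<lambda>r. \<omega> r x) r) (fst p) (snd p)))
          / ennreal ((snd p - fst p) powr (2 * \<beta>'))) \<longlonglongrightarrow> 0)"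
proof -
  interpret W: q_wiener_basis M e q \<beta>' \<omega>
    by (rule q_wiener_basis.intro[OF assms(1,2) _ assms(9) _ assms(11,12)]) (use assms(8,10) in auto)
  let ?\<Lambda> = "\<Sum>i. lam i powr (- 2 * \<delta>)"
  have L: "0 \<le> ?\<Lambda>" using assms(7) by (intro suminf_nonneg) auto
  have area: "rs_int (\<lambda>r. e j \<bullet> pl_interp n (\<lambda>r. \<omega> r x) r) (\<lambda>r. e l \<bullet> pl_interp n (\<lambda>r. \<omega> r x) r) s t
    = W.area n j l s t x" for n j l s t x
    by (simp add: W.area_def path_area_def pl_area_def inner_pl_interp)
  show ?thesis
    unfolding area
  \<comment> \<open>The limit of the chain starting at 1 is chosen as version of the integral: one
    random function for all s and t, controlled path by path.\<close>
  proof (intro exI[of _ "W.area_lim 1"] conjI allI impI)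
    fix j l s t assume "(s, t) \<in> simplex01"
    then show "is_stratonovich M (\<lambda>r x. e j \<bullet> \<omega> r x) (\<lambda>r x. e l \<bullet> \<omega> r x) s t (W.area_lim 1 j l s t)"
      by (intro W.area_lim_stratonovich) (auto simp: simplex01_def)
  next
    show "AE x in M. (SUP p\<in>simplex01. hs_norm (tensor_int_map lam \<delta> (\<lambda>j l. W.area_lim 1 j l (fst p) (snd p) x))
          / ennreal ((snd p - fst p) powr (2 * \<beta>'))) < \<top>"
      using W.AE_area_bounds
    proof eventually_elim
      case (elim x)
      then obtain K where K: "0 \<le> K"
        "\<And>s t. 0 \<le> s \<Longrightarrow> s < t \<Longrightarrow> t \<le> 1 \<Longrightarrow> hs_bound (\<lambda>j l. W.area_lim 1 j l s t x) (K * (t - s) powr (2 * \<beta>'))"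
        by blast
      have "(SUP p\<in>simplex01. hs_norm (tensor_int_map lam \<delta> (\<lambda>j l. W.area_lim 1 j l (fst p) (snd p) x))
          / ennreal ((snd p - fst p) powr (2 * \<beta>'))) \<le> ennreal (sqrt ?\<Lambda> * K)"
        by (intro SUP_least weighted_hs_norm_le K assms(7)) (auto simp: simplex01_def)
      then show ?case using ennreal_less_top le_less_trans by blast
    qed
  next
    show "AE x in M. (\<lambda>n. SUP p\<in>simplex01.
        hs_norm (tensor_int_map lam \<delta> (\<lambda>j l. W.area_lim 1 j l (fst p) (snd p) x - W.area n j l (fst p) (snd p) x))
          / ennreal ((snd p - fst p) powr (2 * \<beta>'))) \<longlonglongrightarrow> 0"
      using W.AE_area_bounds
    proof eventually_elim
      case (elim x)
      then obtain K where K: "0 \<le> K"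
        "\<And>s t n. 0 \<le> s \<Longrightarrow> s < t \<Longrightarrow> t \<le> 1 \<Longrightarrow> 0 < n \<Longrightarrow>
          hs_bound (\<lambda>j l. W.area_lim 1 j l s t x - W.area n j l s t x) (K * real n powr (- W.\<theta>) * (t - s) powr (2 * \<beta>'))"
        by blast
      let ?N = "\<lambda>n. (SUP p\<in>simplex01.
          hs_norm (tensor_int_map lam \<delta> (\<lambda>j l. W.area_lim 1 j l (fst p) (snd p) x - W.area n j l (fst p) (snd p) x))
            / ennreal ((snd p - fst p) powr (2 * \<beta>')))"
      show ?case
      proof (rule tendsto_sandwich[OF _ _ tendsto_const])
        have "(\<lambda>n. real n powr (- W.\<theta>)) \<longlonglongrightarrow> 0"
          using W.theta(1) by (intro tendsto_neg_powr filterlim_real_sequentially) auto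
        then have "(\<lambda>n. ennreal (sqrt ?\<Lambda> * (K * real n powr (- W.\<theta>)))) \<longlonglongrightarrow> ennreal (sqrt ?\<Lambda> * (K * 0))"
          by (intro tendsto_ennrealI tendsto_mult tendsto_const)
        then show "(\<lambda>n. ennreal (sqrt ?\<Lambda> * (K * real n powr (- W.\<theta>)))) \<longlonglongrightarrow> 0" by simp
        \<comment> \<open>Only n > 0 is covered by the pathwise bound, which is enough for the
          limit.\<close>
        show "\<forall>\<^sub>F n in sequentially. ?N n \<le> ennreal (sqrt ?\<Lambda> * (K * real n powr (- W.\<theta>)))"
          using eventually_gt_at_top[of 0]
        proof eventually_elim
          case (elim n)
          then show ?case
            using K(1) by (intro SUP_least weighted_hs_norm_le K(2) assms(7)) (auto simp: simplex01_def)
        qed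
      qed simp
    qed
  qed
qed

end
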